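(* Let $G\curvearrowright X$ be a minimal continuous action of a countably infinite discrete group $G$ on a compact metrizable space $X$. Suppose that the simplex $M_G(X)$ of $G$-invariant Borel probability measures on $X$ is a Bauer simplex whose extreme boundary has finite covering dimension. Then the action $G\curvearrowright X$ has the small boundary property.
   Context: $M_G(X)$ denotes the convex set of all $G$-invariant Borel probability measures on $X$ with the weak$^*$ topology; it is a Choquet simplex. Its extreme boundary (set of extreme points) is the set $M_G^{\mathrm{erg}}(X)$ of ergodic measures. A Choquet simplex is a Bauer simplex if the set of its extreme points is closed. The action $G\curvearrowright X$ has the small boundary property (SBP) if $X$ has a basis of open sets whose boundaries are null for every $G$-invariant Borel probability measure on $X$. *)

theory Defs
  imports "HOL-Probability.Probability" "HOL-Algebra.Group_Action"
begin

section \<open>Topological dynamics\<close>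

definition continuous_action ::
    "('g, 'b) monoid_scheme \<Rightarrow> ('g \<Rightarrow> 'a::topological_space \<Rightarrow> 'a) \<Rightarrow> bool" where
  "continuous_action G \<phi> \<longleftrightarrow>
     group_action G UNIV \<phi> \<and> (\<forall>g\<in>carrier G. continuous_on UNIV (\<phi> g))"

definition minimal_action ::
    "('g, 'b) monoid_scheme \<Rightarrow> ('g \<Rightarrow> 'a::topological_space \<Rightarrow> 'a) \<Rightarrow> bool" where
  "minimal_action G \<phi> \<longleftrightarrow>
     (\<forall>C. closed C \<and> (\<forall>g\<in>carrier G. \<phi> g ` C \<subseteq> C) \<longrightarrow> C = {} \<or> C = UNIV)"


section \<open>The simplex of invariant measures\<close>

definition invariant_measures ::
    "('g, 'b) monoid_scheme \<Rightarrow> ('g \<Rightarrow> 'a::topological_space \<Rightarrow> 'a) \<Rightarrow> 'a measure set" where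
  "invariant_measures G \<phi> =
     {\<mu>. sets \<mu> = sets borel \<and> prob_space \<mu> \<and>
          (\<forall>g\<in>carrier G. distr \<mu> borel (\<phi> g) = \<mu>)}"

text \<open>The weak-star topology on a set of measures: the coarsest topology for which integration
  against each continuous real function is continuous. It is only used over compact spaces, where
  continuous functions are bounded.\<close>

definition weak_star_topology :: "'a::topological_space measure set \<Rightarrow> 'a measure topology" where
  "weak_star_topology K =
     pullback_topology K
       (\<lambda>\<mu>. \<lambda>f\<in>{f :: 'a \<Rightarrow> real. continuous_on UNIV f}. integral\<^sup>L \<mu> f)
       (product_topology (\<lambda>_. euclideanreal) {f. continuous_on UNIV f})"

text \<open>Measures do not form a type of class \<^class>\<open>real_vector\<close>, so \<^const>\<open>extreme_point_of\<close> does not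
  apply; this is the same notion with convex combinations taken setwise.\<close>

definition extreme_measures :: "'a::topological_space measure set \<Rightarrow> 'a measure set" where
  "extreme_measures K =
     {\<mu>\<in>K. \<forall>\<nu>\<^sub>1\<in>K. \<forall>\<nu>\<^sub>2\<in>K. \<forall>t::real. 0 < t \<and> t < 1 \<and>
        (\<forall>A\<in>sets borel. measure \<mu> A = (1 - t) * measure \<nu>\<^sub>1 A + t * measure \<nu>\<^sub>2 A)
        \<longrightarrow> \<nu>\<^sub>1 = \<nu>\<^sub>2}"

text \<open>The extreme boundary of the simplex of invariant measures, that is, the set of ergodic
  measures.\<close>

definition extreme_boundary ::
    "('g, 'b) monoid_scheme \<Rightarrow> ('g \<Rightarrow> 'a::topological_space \<Rightarrow> 'a) \<Rightarrow> 'a measure set" where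
  "extreme_boundary G \<phi> = extreme_measures (invariant_measures G \<phi>)"

text \<open>A Bauer simplex is a Choquet simplex whose set of extreme points is closed. For a continuous
  action on a compact metrizable space the invariant measures always form a Choquet simplex
  (possibly empty), so only the closedness is a condition.\<close>

definition bauer_invariant_measures ::
    "('g, 'b) monoid_scheme \<Rightarrow> ('g \<Rightarrow> 'a::topological_space \<Rightarrow> 'a) \<Rightarrow> bool" where
  "bauer_invariant_measures G \<phi> \<longleftrightarrow>
     closedin (weak_star_topology (invariant_measures G \<phi>)) (extreme_boundary G \<phi>)"

definition extreme_boundary_topology ::
    "('g, 'b) monoid_scheme \<Rightarrow> ('g \<Rightarrow> 'a::topological_space \<Rightarrow> 'a) \<Rightarrow> 'a measure topology" where
  "extreme_boundary_topology G \<phi> =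
     subtopology (weak_star_topology (invariant_measures G \<phi>)) (extreme_boundary G \<phi>)"


section \<open>Covering dimension\<close>

definition covering_dim_le :: "'a topology \<Rightarrow> nat \<Rightarrow> bool" where
  "covering_dim_le T n \<longleftrightarrow>
     (\<forall>\<U>. (\<forall>U\<in>\<U>. openin T U) \<and> \<Union>\<U> = topspace T \<longrightarrow>
       (\<exists>\<V>. (\<forall>V\<in>\<V>. openin T V) \<and> \<Union>\<V> = topspace T \<and>
            (\<forall>V\<in>\<V>. \<exists>U\<in>\<U>. V \<subseteq> U) \<and>
            (\<forall>x\<in>topspace T. finite {V\<in>\<V>. x \<in> V} \<and> card {V\<in>\<V>. x \<in> V} \<le> n + 1)))"

definition finite_covering_dim :: "'a topology \<Rightarrow> bool" where
  "finite_covering_dim T \<longleftrightarrow> (\<exists>n. covering_dim_le T n)"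


section \<open>The small boundary property\<close>

definition small_boundary_property ::
    "('g, 'b) monoid_scheme \<Rightarrow> ('g \<Rightarrow> 'a::topological_space \<Rightarrow> 'a) \<Rightarrow> bool" where
  "small_boundary_property G \<phi> \<longleftrightarrow>
     (\<exists>B. topological_basis B \<and>
          (\<forall>U\<in>B. \<forall>\<mu>\<in>invariant_measures G \<phi>. frontier U \<in> null_sets \<mu>))"

end

(*
  Write K for the set of extreme (ergodic) measures, which is weak-star compact, and regard the
  integral of a continuous function as a function on K. Since every f has a self-adjoint average
  that converges in mean to its integral for each measure in K, Dini's theorem and lattice
  operations show that enough continuous functions \<theta> on K to separate points from closed sets
  lift approximately to continuous functions \<Theta> on X, uniformly in L^1 over K.

  The measures in K have no atoms, so near each of them a given f has a small perturbation with
  uniformly small level sets. Such perturbations f_V, one for each member V of a finite cover of K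
  of multiplicity at most dim K + 1, are glued to max_V (f_V - \<Theta>_V), where \<theta>_V is 0 on a core of V and
  large off V. For \<mu> in K only the few members V containing \<mu> contribute to the zero set
  of this function, so its zero set has small measure. Bauer's maximum principle extends the bound
  from K to all invariant measures, and Baire's theorem makes the zero sets null. Open sets of the
  form {g < 0} then give the basis.
*)

theory Submission
  imports Defs
begin


section \<open>Borel probability measures on a compact metric space\<close>

text \<open>The group need not be amenable, so averages over growing finite sets give no ergodic
  theorem. Powers of one symmetric averaging operator do: it is self-adjoint in \<open>L^2\<close>
  of every invariant measure at once, and the squared norms of its iterates decrease, which is the
  monotonicity that Dini's theorem wants. Sending a point of the space to its ergodic component is
  only a measurable map, so functions on the boundary are lifted in mean and not pointwise; the
  glued function must tolerate a small set where the lifts are wrong.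

  Gluing subtracts from each local perturbation a number that depends on the measure, so control of
  its zero set alone would be lost. Hence all level sets have to be small simultaneously. They are
  measured by integrals of continuous tent functions, since such integrals are weak-star continuous
  and affine in the measure: the first property gives neighbourhoods, the second lets a bound on
  extreme measures pass to all invariant ones.\<close>

definition borel_prob :: "'a::topological_space measure \<Rightarrow> bool" where
  "borel_prob \<mu> \<longleftrightarrow> prob_space \<mu> \<and> sets \<mu> = sets borel"

lemma borel_prob_space: "borel_prob \<mu> \<Longrightarrow> space \<mu> = UNIV"
  unfolding borel_prob_def using sets_eq_imp_space_eq by fastforce

lemma borel_prob_measurable:
  fixes f :: "'a::topological_space \<Rightarrow> real"
  assumes "borel_prob \<mu>" "continuous_on UNIV f"
  shows "f \<in> borel_measurable \<mu>"
  using assms borel_measurable_continuous_onI measurable_cong_sets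
  unfolding borel_prob_def by blast

lemma continuous_bounded_on_compact:
  fixes f :: "'a::topological_space \<Rightarrow> real"
  assumes "compact (UNIV :: 'a set)" "continuous_on UNIV f"
  obtains B where "B > 0" "\<And>x. \<bar>f x\<bar> \<le> B"
proof -
  have "bounded (range f)"
    using assms compact_continuous_image compact_imp_bounded by blast
  then show ?thesis
    using that unfolding bounded_pos by (metis rangeI real_norm_def)
qed

lemma borel_prob_integrable:
  fixes f :: "'a::topological_space \<Rightarrow> real"
  assumes "compact (UNIV :: 'a set)" "borel_prob \<mu>" "continuous_on UNIV f"
  shows "integrable \<mu> f"
proof -
  interpret prob_space \<mu> using assms(2) unfolding borel_prob_def by simp
  obtain B where "\<And>x. \<bar>f x\<bar> \<le> B"
    using continuous_bounded_on_compact[OF assms(1,3)] by metis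
  then show ?thesis
    by (intro integrable_const_bound[of _ B]) (auto intro: borel_prob_measurable assms)
qed

lemma infdist_cutoff_tendsto_0:
  assumes "closed C" "C \<noteq> {}" "x \<notin> C"
  shows "(\<lambda>k. max 0 (1 - real k * infdist x C)) \<longlonglongrightarrow> 0"
proof (rule tendsto_eventually)
  define r where "r = infdist x C"
  have "r > 0"
    using assms infdist_pos_not_in_closed r_def by auto
  obtain N where N: "real N * r > 1"
    using reals_Archimedean3[OF \<open>r > 0\<close>] by auto
  have "max 0 (1 - real k * r) = 0" if "k \<ge> N" for k
  proof -
    have "real N * r \<le> real k * r" using that \<open>r > 0\<close> by simp
    then show ?thesis using N by simp
  qed
  then show "\<forall>\<^sub>F k in sequentially. max 0 (1 - real k * infdist x C) = 0"
    unfolding r_def[symmetric] eventually_sequentially by blast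
qed


section \<open>The Riesz representation theorem\<close>

locale normalized_positive_functional =
  fixes I :: "('a::metric_space \<Rightarrow> real) \<Rightarrow> real"
  assumes compact_UNIV: "compact (UNIV :: 'a set)"
    and add: "\<And>f g. continuous_on UNIV f \<Longrightarrow> continuous_on UNIV g
                \<Longrightarrow> I (\<lambda>x. f x + g x) = I f + I g"
    and scale: "\<And>c f. continuous_on UNIV f \<Longrightarrow> I (\<lambda>x. c * f x) = c * I f"
    and nonneg: "\<And>f. continuous_on UNIV f \<Longrightarrow> (\<And>x. 0 \<le> f x) \<Longrightarrow> 0 \<le> I f"
    and one: "I (\<lambda>_. 1) = 1"
begin

lemma zero: "I (\<lambda>_. 0) = 0"
  using scale[of "\<lambda>_. 1" 0] by simp

lemma diff:
  assumes "continuous_on UNIV f" "continuous_on UNIV g"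
  shows "I (\<lambda>x. f x - g x) = I f - I g"
  using add[of f "\<lambda>x. (-1) * g x"] scale[of g "-1"] assms by (simp add: continuous_intros)

lemma mono:
  assumes "continuous_on UNIV f" "continuous_on UNIV g" "\<And>x. f x \<le> g x"
  shows "I f \<le> I g"
  using diff[of g f] nonneg[of "\<lambda>x. g x - f x"] assms by (simp add: continuous_intros)

lemma sum:
  assumes "\<And>n. continuous_on UNIV (f n)"
  shows "I (\<lambda>x. \<Sum>n<(N::nat). f n x) = (\<Sum>n<N. I (f n))"
proof (induction N)
  case 0
  then show ?case by (simp add: zero)
next
  case (Suc N)
  have "continuous_on UNIV (\<lambda>x. \<Sum>n<N. f n x)"
    by (intro continuous_on_sum assms)
  then show ?case using add[OF _ assms[of N]] Suc by simp
qed

text \<open>Covers by sequences of functions, as in Daniell's construction, in place of covers by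
  open sets. The sums are taken in \<open>ennreal\<close>, so a divergent series counts as
  infinite.\<close>

definition covers :: "'a set \<Rightarrow> (nat \<Rightarrow> 'a \<Rightarrow> real) set" where
  "covers A = {f. (\<forall>n. continuous_on UNIV (f n) \<and> (\<forall>x. 0 \<le> f n x)) \<and>
                  (\<forall>x\<in>A. 1 \<le> (\<Sum>n. ennreal (f n x)))}"

definition outer :: "'a set \<Rightarrow> ennreal" where
  "outer A = (INF f\<in>covers A. \<Sum>n. ennreal (I (f n)))"

lemma outer_le: "f \<in> covers A \<Longrightarrow> outer A \<le> (\<Sum>n. ennreal (I (f n)))"
  unfolding outer_def by (rule INF_lower)

text \<open>\<open>prod_decode\<close> rearranges a doubly indexed family into one sequence. The two
  uses are merging covers of countably many sets and collecting the pieces cut out by the cutoffs of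
  a closed set.\<close>

lemma outer_le_double:
  assumes c: "\<And>m n. continuous_on UNIV (f m n)" and p: "\<And>m n x. 0 \<le> f m n x"
    and cov: "\<And>x. x \<in> A \<Longrightarrow> 1 \<le> (\<Sum>m. \<Sum>n. ennreal (f m n x))"
  shows "outer A \<le> (\<Sum>m. \<Sum>n. ennreal (I (f m n)))"
proof -
  define g where "g i = (case prod_decode i of (m, n) \<Rightarrow> f m n)" for i
  have s: "(\<Sum>i. ennreal (case prod_decode i of (m, n) \<Rightarrow> h m n)) = (\<Sum>m. \<Sum>n. ennreal (h m n))" for h
    using suminf_ennreal_2dimen[of "\<lambda>m. \<Sum>n. ennreal (h m n)" "\<lambda>(m,n). ennreal (h m n)"]
    by (simp add: case_prod_beta)
  have "g \<in> covers A"
    unfolding covers_def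
  proof (intro CollectI conjI allI ballI)
    fix i x
    show "continuous_on UNIV (g i)" "0 \<le> g i x"
      using c p unfolding g_def by (auto split: prod.split)
  next
    fix x assume "x \<in> A"
    then show "1 \<le> (\<Sum>i. ennreal (g i x))"
      using cov s[of "\<lambda>m n. f m n x"] by (simp add: g_def case_prod_beta)
  qed
  from outer_le[OF this] show ?thesis
    using s[of "\<lambda>m n. I (f m n)"] by (simp add: g_def case_prod_beta)
qed

lemma outer_le_single:
  assumes "continuous_on UNIV g" "\<And>x. 0 \<le> g x" "\<And>x. x \<in> A \<Longrightarrow> 1 \<le> g x"
  shows "outer A \<le> ennreal (I g)"
proof -
  let ?f = "\<lambda>n::nat. if n = 0 then g else (\<lambda>_. 0)"
  have f0: "(\<Sum>n. ennreal (h (?f n))) = ennreal (h g)" if "h (\<lambda>_. 0) = 0" for h :: "('a \<Rightarrow> real) \<Rightarrow> real"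
  proof -
    have "(\<Sum>n. ennreal (h (?f n))) = (\<Sum>n\<in>{0}. ennreal (h (?f n)))"
      using that by (intro suminf_finite) simp_all
    then show ?thesis by simp
  qed
  have "?f \<in> covers A"
    unfolding covers_def
  proof (intro CollectI conjI allI ballI)
    fix x assume "x \<in> A"
    then show "1 \<le> (\<Sum>n. ennreal (?f n x))"
      using assms(3) f0[of "\<lambda>k. k x"] by (simp add: ennreal_ge_1)
  qed (use assms in auto)
  from outer_le[OF this] show ?thesis
    using f0[of I] zero by simp
qed

lemma outer_empty: "outer {} = 0"
  using outer_le_single[of "\<lambda>_. 0" "{}"] by (simp add: zero)

lemma outer_mono: "A \<subseteq> B \<Longrightarrow> outer A \<le> outer B"
  unfolding outer_def covers_def by (rule INF_superset_mono) auto

lemma outer_near_cover: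
  assumes "outer A < \<infinity>" "0 < e"
  obtains f where "f \<in> covers A" "(\<Sum>n. ennreal (I (f n))) \<le> outer A + ennreal e"
proof -
  have "outer A < outer A + ennreal e"
    using assms ennreal_add_left_cancel_less[of "outer A" 0 "ennreal e"] by simp
  then show ?thesis
    using that unfolding outer_def INF_less_iff by (meson less_imp_le)
qed

lemma outer_countably_subadditive: "outer (\<Union>i. A i) \<le> (\<Sum>i. outer (A i))"
proof (rule ennreal_le_epsilon)
  fix e :: real
  assume e: "0 < e" and fin: "(\<Sum>i. outer (A i)) < top_class.top"
  have "outer (A i) < \<infinity>" for i
    using ennreal_suminf_lessD[OF fin, of i] by simp
  then have "\<exists>f. f \<in> covers (A i) \<and> (\<Sum>n. ennreal (I (f n))) \<le> outer (A i) + ennreal (e * (1/2)^Suc i)" for i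
    using outer_near_cover[of "A i" "e * (1/2)^Suc i"] e by auto
  then obtain f where f: "\<And>i. f i \<in> covers (A i)"
    and le: "\<And>i. (\<Sum>n. ennreal (I (f i n))) \<le> outer (A i) + ennreal (e * (1/2)^Suc i)"
    by metis
  have "outer (\<Union>i. A i) \<le> (\<Sum>i. \<Sum>n. ennreal (I (f i n)))"
  proof (rule outer_le_double)
    fix x assume "x \<in> (\<Union>i. A i)"
    then obtain i where "x \<in> A i" by auto
    then have "1 \<le> (\<Sum>n. ennreal (f i n x))" using f[of i] by (auto simp: covers_def)
    also have "\<dots> \<le> (\<Sum>i. \<Sum>n. ennreal (f i n x))"
      using sum_le_suminf[of "\<lambda>i. \<Sum>n. ennreal (f i n x)" "{i}"] by simp
    finally show "1 \<le> (\<Sum>i. \<Sum>n. ennreal (f i n x))" .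
  qed (use f in \<open>auto simp: covers_def\<close>)
  also have "\<dots> \<le> (\<Sum>i. outer (A i) + ennreal (e * (1/2)^Suc i))"
    by (intro suminf_le le) auto
  also have "\<dots> = (\<Sum>i. outer (A i)) + (\<Sum>i. ennreal (e * (1/2)^Suc i))"
    by (intro suminf_add[symmetric]) auto
  also have "(\<Sum>i. ennreal (e * (1/2)^Suc i)) = ennreal e"
    using e power_half_series sums_mult[OF power_half_series, of e]
    by (intro suminf_ennreal_eq) auto
  finally show "outer (\<Union>i. A i) \<le> (\<Sum>i. outer (A i)) + ennreal e" .
qed

lemma outer_measure_space_outer: "outer_measure_space (Pow UNIV) outer"
  unfolding outer_measure_space_def positive_def increasing_def countably_subadditive_def
  using outer_empty outer_mono outer_countably_subadditive by auto

lemma outer_union: "outer (A \<union> B) \<le> outer A + outer B"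
proof -
  let ?F = "\<lambda>n::nat. if n = 0 then A else if n = 1 then B else {}"
  have "outer (\<Union>n. ?F n) \<le> (\<Sum>n. outer (?F n))"
    by (rule outer_countably_subadditive)
  also have "\<dots> = (\<Sum>n\<in>{0,1}. outer (?F n))"
    by (rule suminf_finite) (auto simp: outer_empty)
  also have "(\<Union>n. ?F n) = A \<union> B" by (auto split: if_splits)
  finally show ?thesis by simp
qed

text \<open>The cutoffs \<open>\<kappa> k\<close> decrease to the indicator of \<open>C\<close>. A cover \<open>f\<close> of \<open>A\<close> splits for each
  \<open>k\<close> into the cover \<open>f n * \<kappa> k\<close> of \<open>A \<inter> C\<close> and the pieces \<open>f n * (\<kappa> j - \<kappa> (j + 1))\<close> with
  \<open>j < k\<close>, and the latter cover \<open>A - C\<close> in the limit.\<close>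

lemma outer_split_closed:
  assumes "closed C" "C \<noteq> {}"
  shows "outer (C \<inter> A) + outer (A - C) \<le> outer A"
  unfolding outer_def[of A]
proof (rule INF_greatest)
  fix f assume f: "f \<in> covers A"
  then have fc: "continuous_on UNIV (f n)" and fp: "0 \<le> f n x" for n x
    by (auto simp: covers_def)
  define \<kappa> where "\<kappa> k x = max 0 (1 - real k * infdist x C)" for k x
  have \<kappa>c: "continuous_on UNIV (\<kappa> k)" for k
    unfolding \<kappa>_def by (intro continuous_intros)
  have \<kappa>p: "0 \<le> \<kappa> k x" for k x by (simp add: \<kappa>_def)
  have \<kappa>d: "\<kappa> (Suc k) x \<le> \<kappa> k x" for k x
    using infdist_nonneg[of x C] unfolding \<kappa>_def by (auto simp: algebra_simps)
  define S where "S k = (\<Sum>n. ennreal (I (\<lambda>x. f n x * \<kappa> k x)))" for k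
  define d where "d k = (\<Sum>n. ennreal (I (\<lambda>x. f n x * (\<kappa> k x - \<kappa> (Suc k) x))))" for k
  have S0: "S 0 = (\<Sum>n. ennreal (I (f n)))"
    by (simp add: S_def \<kappa>_def)
  have Sstep: "S k = S (Suc k) + d k" for k
  proof -
    have "ennreal (I (\<lambda>x. f n x * \<kappa> k x)) = ennreal (I (\<lambda>x. f n x * \<kappa> (Suc k) x))
        + ennreal (I (\<lambda>x. f n x * (\<kappa> k x - \<kappa> (Suc k) x)))" for n
    proof -
      have "I (\<lambda>x. f n x * \<kappa> k x) = I (\<lambda>x. f n x * \<kappa> (Suc k) x + f n x * (\<kappa> k x - \<kappa> (Suc k) x))"
        by (simp add: algebra_simps)
      also have "\<dots> = I (\<lambda>x. f n x * \<kappa> (Suc k) x) + I (\<lambda>x. f n x * (\<kappa> k x - \<kappa> (Suc k) x))"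
        by (intro add continuous_intros fc \<kappa>c)
      finally show ?thesis
        using \<kappa>d \<kappa>p fp by (simp add: ennreal_plus nonneg fc \<kappa>c continuous_intros)
    qed
    then show ?thesis unfolding S_def d_def by (simp add: suminf_add)
  qed
  have Sd: "S k + (\<Sum>j<k. d j) = S 0" for k
  proof (induction k)
    case (Suc k)
    have "S (Suc k) + (\<Sum>j<Suc k. d j) = (S (Suc k) + d k) + (\<Sum>j<k. d j)"
      by (simp add: ac_simps)
    also have "\<dots> = S 0" using Suc unfolding Sstep[of k, symmetric] .
    finally show ?case .
  qed simp
  have oC: "outer (C \<inter> A) \<le> S k" for k
  proof -
    have "(\<lambda>n x. f n x * \<kappa> k x) \<in> covers (C \<inter> A)"
      unfolding covers_def
    proof (intro CollectI conjI allI ballI)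
      show "continuous_on UNIV (\<lambda>x. f n x * \<kappa> k x)" for n
        by (intro continuous_on_mult fc \<kappa>c)
      show "0 \<le> f n x * \<kappa> k x" for n x
        by (intro mult_nonneg_nonneg fp \<kappa>p)
      fix x assume x: "x \<in> C \<inter> A"
      then have "\<kappa> k x = 1" by (simp add: \<kappa>_def)
      then show "1 \<le> (\<Sum>n. ennreal (f n x * \<kappa> k x))"
        using f x by (simp add: covers_def)
    qed
    from outer_le[OF this] show ?thesis by (simp add: S_def)
  qed
  have oA: "outer (A - C) \<le> (\<Sum>k. d k)"
    unfolding d_def
  proof (rule outer_le_double)
    fix x assume x: "x \<in> A - C"
    have "(\<lambda>k. \<kappa> k x) \<longlonglongrightarrow> 0"
      unfolding \<kappa>_def using x assms by (intro infdist_cutoff_tendsto_0) auto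
    from telescope_sums'[OF this] have "(\<lambda>k. \<kappa> k x - \<kappa> (Suc k) x) sums 1"
      by (simp add: \<kappa>_def)
    with suminf_ennreal_eq[of "\<lambda>k. \<kappa> k x - \<kappa> (Suc k) x"] \<kappa>d
    have 1: "(\<Sum>k. ennreal (\<kappa> k x - \<kappa> (Suc k) x)) = 1"
      by (metis diff_ge_0_iff_ge ennreal_1)
    have "(\<Sum>k. \<Sum>n. ennreal (f n x * (\<kappa> k x - \<kappa> (Suc k) x)))
        = (\<Sum>k. (\<Sum>n. ennreal (f n x)) * ennreal (\<kappa> k x - \<kappa> (Suc k) x))"
      using fp \<kappa>d by (simp add: ennreal_mult ennreal_suminf_multc)
    also have "\<dots> = (\<Sum>n. ennreal (f n x))"
      using 1 by (simp add: ennreal_suminf_cmult)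
    finally show "1 \<le> (\<Sum>k. \<Sum>n. ennreal (f n x * (\<kappa> k x - \<kappa> (Suc k) x)))"
      using f x by (simp add: covers_def)
  qed (use \<kappa>d fp in \<open>auto intro!: continuous_on_mult continuous_on_diff fc \<kappa>c\<close>)
  \<comment> \<open>The two terms are put into one series because the bound is reached through
    partial sums: \<open>outer (C \<inter> A)\<close> plus the first \<open>k\<close> of the
    \<open>d j\<close> is at most \<open>S k\<close> plus the same \<open>d j\<close>, which is
    \<open>S 0\<close>.\<close>
  let ?e = "\<lambda>n. case n of 0 \<Rightarrow> outer (C \<inter> A) | Suc k \<Rightarrow> d k"
  have "outer (C \<inter> A) + (\<Sum>k. d k) = (\<Sum>n. ?e n)"
    using suminf_offset[of ?e 1] by (simp add: add.commute)
  also have "\<dots> \<le> S 0"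
  proof (rule suminf_le_const)
    fix n
    show "sum ?e {..<n} \<le> S 0"
    proof (cases n)
      case (Suc k)
      then have "sum ?e {..<n} = outer (C \<inter> A) + (\<Sum>j<k. d j)"
        by (simp add: sum.lessThan_Suc_shift del: sum.lessThan_Suc)
      then show ?thesis using oC[of k] Sd[of k] by (metis add_right_mono)
    qed simp
  qed simp
  finally show "outer (C \<inter> A) + outer (A - C) \<le> (\<Sum>n. ennreal (I (f n)))"
    using oA S0 by (metis add_left_mono order_trans)
qed

lemma closed_in_lambda_system:
  assumes "closed C"
  shows "C \<in> lambda_system UNIV (Pow UNIV) outer"
\<comment> \<open>The empty set stands apart since \<open>infdist x {}\<close> is \<open>0\<close>,
  which would make every cutoff constantly \<open>1\<close>.\<close>
proof (cases "C = {}")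
  case True
  then show ?thesis by (simp add: lambda_system_def outer_empty)
next
  case False
  have "outer (C \<inter> A) + outer ((UNIV - C) \<inter> A) = outer A" for A
  proof (rule antisym)
    have "(UNIV - C) \<inter> A = A - C" by auto
    then show "outer (C \<inter> A) + outer ((UNIV - C) \<inter> A) \<le> outer A"
      using outer_split_closed[OF assms False] by simp
    have "A = (C \<inter> A) \<union> ((UNIV - C) \<inter> A)" by auto
    then show "outer A \<le> outer (C \<inter> A) + outer ((UNIV - C) \<inter> A)"
      using outer_union by metis
  qed
  then show ?thesis by (simp add: lambda_system_def)
qed

definition riesz_measure :: "'a measure" where
  "riesz_measure = measure_of UNIV (sets borel) outer"

lemma sets_riesz_measure: "sets riesz_measure = sets borel"
  unfolding riesz_measure_def using sets.sigma_sets_eq[of "borel :: 'a measure"] by simp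

text \<open>Closed sets satisfy Caratheodory's criterion and generate the Borel sets, so
  \<open>outer\<close> is a measure on all of them. Without that property \<open>measure_of\<close>
  would silently assign \<open>0\<close> everywhere.\<close>

lemma emeasure_riesz_measure:
  assumes "A \<in> sets borel"
  shows "emeasure riesz_measure A = outer A"
proof -
  let ?L = "lambda_system UNIV (Pow UNIV) outer"
  interpret sigma_algebra UNIV "Pow (UNIV :: 'a set)" by (rule sigma_algebra_Pow)
  have ms: "measure_space UNIV ?L outer"
    by (rule caratheodory_lemma[OF outer_measure_space_outer])
  then interpret L: sigma_algebra UNIV ?L by (simp add: measure_space_def)
  have "sets borel \<subseteq> ?L"
    using L.sigma_sets_subset[of "Collect closed"] closed_in_lambda_system
    by (auto simp: borel_eq_closed)
  then have "measure_space UNIV (sets borel) outer"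
    using measure_down[OF ms] sets.sigma_algebra_axioms[of borel] by simp
  then show ?thesis
    unfolding riesz_measure_def
    using emeasure_measure_of_sigma[of UNIV "sets borel" outer A] assms
    by (simp add: measure_space_def)
qed

text \<open>For the lower bound, the partial sums of a cover increase beyond \<open>1 - e\<close> at
  each point, so by compactness a single partial sum exceeds it everywhere, and there
  \<open>I\<close> is monotone and finitely additive.\<close>

lemma outer_UNIV: "outer UNIV = 1"
proof (rule antisym)
  show "outer UNIV \<le> 1"
    using outer_le_single[of "\<lambda>_. 1" UNIV] by (simp add: one)
  show "1 \<le> outer UNIV"
    unfolding outer_def
  proof (rule INF_greatest)
    fix f assume f: "f \<in> covers UNIV"
    then have fc: "continuous_on UNIV (f n)" and fp: "0 \<le> f n x" for n x
      by (auto simp: covers_def)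
    define s where "s N x = (\<Sum>n<N. f n x)" for N x
    have sc: "continuous_on UNIV (s N)" for N
      unfolding s_def by (intro continuous_intros fc)
    have sm: "s N x \<le> s N' x" if "N \<le> N'" for N N' x
      unfolding s_def using that fp by (intro sum_mono2) auto
    show "1 \<le> (\<Sum>n. ennreal (I (f n)))"
    proof (rule ennreal_le_epsilon)
      fix e :: real assume e: "0 < e"
      have "\<exists>N. 1 - e < s N x" for x
      proof (rule ccontr)
        assume "\<not> ?thesis"
        then have "\<And>N. s N x \<le> 1 - e" by (simp add: not_less)
        then have le: "(\<Sum>n<N. ennreal (f n x)) \<le> ennreal (1 - e)" for N
          using fp by (simp add: s_def sum_ennreal ennreal_leI)
        have "(\<Sum>n. ennreal (f n x)) \<le> ennreal (1 - e)"
          by (rule suminf_le_const) (use le in auto)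
        also have "\<dots> < 1" using e ennreal_lessI[of 1 "1 - e"] by simp
        finally show False using f by (auto simp: covers_def not_le[symmetric])
      qed
      then have cov: "UNIV \<subseteq> (\<Union>N\<in>UNIV. {x. 1 - e < s N x})" by auto
      have "open {x. 1 - e < s N x}" for N
        using sc by (intro open_Collect_less) auto
      then obtain F where "finite F" and F: "UNIV \<subseteq> (\<Union>N\<in>F. {x. 1 - e < s N x})"
        using compactE_image[OF compact_UNIV _ cov] by (metis (no_types, lifting))
      have "1 - e \<le> s (Max F) x" for x
      proof -
        obtain N where "N \<in> F" "1 - e < s N x" using F by auto
        then show ?thesis using sm[of N "Max F" x] \<open>finite F\<close> by simp
      qed
      then have "I (\<lambda>_. (1 - e) * 1) \<le> I (s (Max F))"
        by (intro mono sc) auto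
      also have "\<dots> = (\<Sum>n<Max F. I (f n))"
        unfolding s_def by (rule sum) (rule fc)
      finally have "ennreal 1 \<le> ennreal ((\<Sum>n<Max F. I (f n)) + e)"
        using scale[of "\<lambda>_. 1" "1 - e"] one by (intro ennreal_leI) simp
      also have "\<dots> = (\<Sum>n<Max F. ennreal (I (f n))) + ennreal e"
        using e nonneg[OF fc fp] by (simp add: ennreal_plus sum_nonneg sum_ennreal)
      also have "(\<Sum>n<Max F. ennreal (I (f n))) \<le> (\<Sum>n. ennreal (I (f n)))"
        by (rule sum_le_suminf) auto
      finally show "1 \<le> (\<Sum>n. ennreal (I (f n))) + ennreal e" by (simp add: add_right_mono)
    qed
  qed
qed

lemma borel_prob_riesz_measure: "borel_prob riesz_measure"
  unfolding borel_prob_def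
proof
  have "space riesz_measure = UNIV"
    using sets_eq_imp_space_eq[OF sets_riesz_measure] by simp
  then show "prob_space riesz_measure"
    by (intro prob_spaceI) (simp add: emeasure_riesz_measure outer_UNIV)
qed (rule sets_riesz_measure)

lemma riesz_measure_le:
  assumes "A \<in> sets borel" "continuous_on UNIV g" "\<And>x. 0 \<le> g x" "\<And>x. x \<in> A \<Longrightarrow> 1 \<le> g x"
  shows "measure riesz_measure A \<le> I g"
proof -
  interpret prob_space riesz_measure
    using borel_prob_riesz_measure by (simp add: borel_prob_def)
  show ?thesis
    using outer_le_single[OF assms(2-4)] emeasure_riesz_measure[OF assms(1)] nonneg[OF assms(2,3)]
      ennreal_le_iff[of "I g"]
    by (metis emeasure_eq_measure)
qed

text \<open>Cut \<open>f\<close> into slices \<open>h k\<close> between the heights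
  \<open>k / N\<close> and \<open>(k + 1) / N\<close>. Slice \<open>k + 1\<close> is at most
  \<open>1 / N\<close> and lives where \<open>f\<close> is at least \<open>(k + 1) / N\<close>.
  There the slice below is full, \<open>N * h k = 1\<close>, so the measure of that set is at most
  \<open>I\<close> of \<open>N * h k\<close>. The index shift leaves over the bottom slice, whose
  integral is below \<open>e\<close>.\<close>

lemma integral_riesz_measure_le:
  assumes f: "continuous_on UNIV f" and f01: "\<And>x. 0 \<le> f x" "\<And>x. f x \<le> 1"
  shows "integral\<^sup>L riesz_measure f \<le> I f"
proof (rule field_le_epsilon)
  fix e :: real assume "e > 0"
  interpret prob_space riesz_measure
    using borel_prob_riesz_measure by (simp add: borel_prob_def)
  note bp = borel_prob_riesz_measure
  obtain N where N: "N > 0" "1 / real N < e"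
    using \<open>e > 0\<close> nat_approx_posE[of e] by (metis zero_less_Suc)
  define h where "h k x = min (f x) ((real k + 1) / real N) - min (f x) (real k / real N)" for k x
  have hc: "continuous_on UNIV (h k)" for k
    unfolding h_def by (intro continuous_intros f) (use N in auto)
  have hp: "0 \<le> h k x" for k x
    using N unfolding h_def by (auto simp: min_def field_simps)
  have hs: "(\<Sum>k<n. h k x) = min (f x) (real n / real N)" for n x
    using f01 by (induction n) (auto simp: h_def add.commute)
  have ih: "integrable riesz_measure (h k)" for k
    by (rule borel_prob_integrable[OF compact_UNIV bp hc])
  have step: "integral\<^sup>L riesz_measure (h (Suc k)) \<le> I (h k)" for k
  proof -
    let ?A = "{x. f x \<ge> real (Suc k) / real N}"
    have A: "?A \<in> sets borel"
      using f by (intro borel_closed closed_Collect_le) (auto intro: continuous_on_const)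
    have A': "?A \<in> sets riesz_measure" using A by (simp add: sets_riesz_measure)
    have "integral\<^sup>L riesz_measure (h (Suc k)) \<le> integral\<^sup>L riesz_measure (\<lambda>x. (1 / real N) * indicator ?A x)"
    proof (rule integral_mono[OF ih])
      show "integrable riesz_measure (\<lambda>x. (1 / real N) * indicator ?A x :: real)"
        using A' by (intro integrable_mult_right) (simp add: emeasure_eq_measure)
      show "h (Suc k) x \<le> (1 / real N) * indicator ?A x" for x
      proof (cases "x \<in> ?A")
        case True
        then have "min (f x) (real (Suc k) / real N) = real (Suc k) / real N" by (simp add: min_def)
        then have "h (Suc k) x \<le> (real (Suc k) + 1) / real N - real (Suc k) / real N"
          unfolding h_def by linarith
        also have "\<dots> = 1 / real N" by (simp add: diff_divide_distrib[symmetric])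
        finally show ?thesis using True by simp
      next
        case False
        moreover have "real (Suc k) / real N \<le> (real (Suc k) + 1) / real N"
          using N by (intro divide_right_mono) auto
        ultimately show ?thesis unfolding h_def by simp
      qed
    qed
    also have "\<dots> = (1 / real N) * prob ?A" using A' by simp
    also have "\<dots> \<le> (1 / real N) * I (\<lambda>x. real N * h k x)"
    proof (intro mult_left_mono riesz_measure_le A continuous_intros hc mult_nonneg_nonneg hp)
      fix x assume "x \<in> ?A"
      moreover have "real k / real N \<le> (real k + 1) / real N"
        using N by (intro divide_right_mono) auto
      ultimately have "h k x = (real k + 1) / real N - real k / real N"
        unfolding h_def by (simp add: add.commute)
      also have "\<dots> = 1 / real N" by (simp add: diff_divide_distrib[symmetric])
      finally have "h k x = 1 / real N" .
      then show "1 \<le> real N * h k x" using N by simp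
    qed auto
    also have "\<dots> = I (h k)" using N by (simp add: scale[OF hc])
    finally show ?thesis .
  qed
  have "f = (\<lambda>x. \<Sum>k<N. h k x)"
    using hs[of _ N] f01 N by (auto simp: min_def)
  then have "integral\<^sup>L riesz_measure f = (\<Sum>k<N. integral\<^sup>L riesz_measure (h k))"
    using ih by (simp add: Bochner_Integration.integral_sum)
  also obtain N' where N': "N = Suc N'" using N by (cases N) auto
  also have "(\<Sum>k<Suc N'. integral\<^sup>L riesz_measure (h k))
      = integral\<^sup>L riesz_measure (h 0) + (\<Sum>k<N'. integral\<^sup>L riesz_measure (h (Suc k)))"
    by (rule sum.lessThan_Suc_shift)
  also have "\<dots> \<le> e + (\<Sum>k<N'. I (h k))"
  proof (intro add_mono sum_mono step)
    have "integral\<^sup>L riesz_measure (h 0) \<le> integral\<^sup>L riesz_measure (\<lambda>_. 1 / real N)"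
      by (rule integral_mono[OF ih]) (use f01 N in \<open>auto simp: h_def min_def\<close>)
    then show "integral\<^sup>L riesz_measure (h 0) \<le> e" using N prob_space by simp
  qed
  also have "(\<Sum>k<N'. I (h k)) = I (\<lambda>x. \<Sum>k<N'. h k x)"
    by (rule sum[symmetric]) (rule hc)
  also have "\<dots> \<le> I f"
    by (rule mono) (auto intro!: continuous_on_sum continuous_on_min hc f simp: hs)
  finally show "integral\<^sup>L riesz_measure f \<le> I f + e" by simp
qed

text \<open>Rescaling to values between \<open>0\<close> and \<open>1\<close> gives one inequality
  for every continuous function; applied to the negative of \<open>f\<close> it gives the
  other.\<close>

theorem integral_riesz_measure:
  assumes f: "continuous_on UNIV f"
  shows "integral\<^sup>L riesz_measure f = I f"
proof -
  interpret prob_space riesz_measure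
    using borel_prob_riesz_measure by (simp add: borel_prob_def)
  note int = borel_prob_integrable[OF compact_UNIV borel_prob_riesz_measure]
  have le: "integral\<^sup>L riesz_measure f \<le> I f" if f: "continuous_on UNIV f" for f
  proof -
    obtain B where B: "B > 0" "\<And>x. \<bar>f x\<bar> \<le> B"
      using continuous_bounded_on_compact[OF compact_UNIV f] by metis
    let ?g = "\<lambda>x. (1 / (2*B)) * (f x + B * 1)"
    have "integral\<^sup>L riesz_measure ?g \<le> I ?g"
    proof (rule integral_riesz_measure_le)
      show "continuous_on UNIV ?g" by (intro continuous_intros f)
      show "0 \<le> ?g x" "?g x \<le> 1" for x
        using B(1) B(2)[of x] by (auto simp: field_simps abs_le_iff)
    qed
    moreover have "I ?g = (1 / (2*B)) * (I f + B)"
      using f scale[of "\<lambda>x. f x + B * 1" "1 / (2*B)"] add[of f "\<lambda>_. B * 1"] scale[of "\<lambda>_. 1" B] one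
      by (simp add: continuous_intros)
    moreover have "integral\<^sup>L riesz_measure ?g = (1 / (2*B)) * (integral\<^sup>L riesz_measure f + B)"
      using int[OF f] prob_space by simp
    ultimately show ?thesis using B(1) by (simp add: divide_le_cancel)
  qed
  have "integral\<^sup>L riesz_measure (\<lambda>x. (-1) * f x) \<le> I (\<lambda>x. (-1) * f x)"
    by (intro le continuous_intros f)
  then show ?thesis using le[OF f] scale[OF f, of "-1"] by simp
qed

end


section \<open>Borel probability measures are determined by continuous functions\<close>

lemma infdist_cutoff_tendsto_measure:
  fixes \<mu> :: "'a::metric_space measure"
  assumes "borel_prob \<mu>" "closed C" "C \<noteq> {}"
  shows "(\<lambda>k. \<integral>x. max 0 (1 - real k * infdist x C) \<partial>\<mu>) \<longlonglongrightarrow> measure \<mu> C"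
proof -
  interpret prob_space \<mu> using assms(1) unfolding borel_prob_def by simp
  have "C \<in> sets \<mu>" using assms by (simp add: borel_prob_def)
  have "(\<lambda>k. \<integral>x. max 0 (1 - real k * infdist x C) \<partial>\<mu>) \<longlonglongrightarrow> (\<integral>x. indicator C x \<partial>\<mu>)"
  proof (rule integral_dominated_convergence[where w = "\<lambda>_. 1"])
    show "(\<lambda>x. max 0 (1 - real k * infdist x C)) \<in> borel_measurable \<mu>" for k
      by (intro borel_prob_measurable assms continuous_intros)
    show "AE x in \<mu>. (\<lambda>k. max 0 (1 - real k * infdist x C)) \<longlonglongrightarrow> indicator C x"
    proof (rule AE_I2)
      fix x
      show "(\<lambda>k. max 0 (1 - real k * infdist x C)) \<longlonglongrightarrow> indicator C x"
      proof (cases "x \<in> C")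
        case False
        then show ?thesis
          using infdist_cutoff_tendsto_0[OF assms(2,3)] by simp
      qed simp
    qed
    show "AE x in \<mu>. norm (max 0 (1 - real k * infdist x C)) \<le> 1" for k
      by (rule AE_I2) (simp add: infdist_nonneg)
  qed (use \<open>C \<in> sets \<mu>\<close> in auto)
  then show ?thesis using \<open>C \<in> sets \<mu>\<close> by simp
qed

text \<open>Extremality is stated setwise while decompositions are produced through integrals; this
  is the bridge. Closed sets are limits of cutoffs and form an intersection-stable generator. The
  complement step rests on \<open>a + b = 1\<close>, which comes from testing the constant
  \<open>1\<close>.\<close>

lemma measure_combination_of_integral_combination:
  fixes \<mu> :: "'a::metric_space measure"
  assumes \<mu>: "borel_prob \<mu>" and \<nu>: "borel_prob \<nu>\<^sub>1" "borel_prob \<nu>\<^sub>2"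
    and int: "\<And>f :: 'a \<Rightarrow> real. continuous_on UNIV f \<Longrightarrow>
                integral\<^sup>L \<mu> f = a * integral\<^sup>L \<nu>\<^sub>1 f + b * integral\<^sup>L \<nu>\<^sub>2 f"
    and A: "A \<in> sets borel"
  shows "measure \<mu> A = a * measure \<nu>\<^sub>1 A + b * measure \<nu>\<^sub>2 A"
proof -
  interpret \<mu>: prob_space \<mu> using \<mu> unfolding borel_prob_def by simp
  interpret \<nu>1: prob_space \<nu>\<^sub>1 using \<nu> unfolding borel_prob_def by simp
  interpret \<nu>2: prob_space \<nu>\<^sub>2 using \<nu> unfolding borel_prob_def by simp
  have sets: "sets \<mu> = sets borel" "sets \<nu>\<^sub>1 = sets borel" "sets \<nu>\<^sub>2 = sets borel"
    using \<mu> \<nu> unfolding borel_prob_def by auto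
  have space: "space \<mu> = UNIV" "space \<nu>\<^sub>1 = UNIV" "space \<nu>\<^sub>2 = UNIV"
    using \<mu> \<nu> borel_prob_space by auto
  have "a + b = 1"
    using int[of "\<lambda>_. 1"] \<mu>.prob_space \<nu>1.prob_space \<nu>2.prob_space by simp
  have "Int_stable (Collect closed :: 'a set set)" "Collect closed \<subseteq> Pow (UNIV :: 'a set)"
    "A \<in> sigma_sets UNIV (Collect closed)"
    using A by (auto simp: Int_stable_def borel_eq_closed)
  then show ?thesis
  proof (induction rule: sigma_sets_induct_disjoint)
    case (basic C)
    show ?case
    proof (cases "C = {}")
      case False
      have C: "closed C" using basic by simp
      let ?h = "\<lambda>k x. max 0 (1 - real k * infdist x C)"
      have "(\<lambda>k. a * integral\<^sup>L \<nu>\<^sub>1 (?h k) + b * integral\<^sup>L \<nu>\<^sub>2 (?h k))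
          \<longlonglongrightarrow> a * measure \<nu>\<^sub>1 C + b * measure \<nu>\<^sub>2 C"
        by (intro tendsto_intros infdist_cutoff_tendsto_measure \<nu> C False)
      moreover have "a * integral\<^sup>L \<nu>\<^sub>1 (?h k) + b * integral\<^sup>L \<nu>\<^sub>2 (?h k) = integral\<^sup>L \<mu> (?h k)" for k
        by (rule int[symmetric]) (intro continuous_intros)
      ultimately show ?thesis
        using infdist_cutoff_tendsto_measure[OF \<mu> C False] LIMSEQ_unique by simp
    qed simp
  next
    case (compl B)
    then have "B \<in> sets borel" by (simp add: borel_eq_closed)
    then have "measure \<mu> (UNIV - B) = 1 - measure \<mu> B"
      "measure \<nu>\<^sub>1 (UNIV - B) = 1 - measure \<nu>\<^sub>1 B" "measure \<nu>\<^sub>2 (UNIV - B) = 1 - measure \<nu>\<^sub>2 B"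
      using \<mu>.prob_compl[of B] \<nu>1.prob_compl[of B] \<nu>2.prob_compl[of B] by (simp_all add: sets space)
    moreover have "a * (1 - p) + b * (1 - q) = (a + b) - (a * p + b * q)" for p q
      by (simp add: algebra_simps)
    ultimately show ?case using compl(2) \<open>a + b = 1\<close> by metis
  next
    case (union B)
    then have B: "range B \<subseteq> sets borel" by (simp add: borel_eq_closed)
    have "(\<lambda>i. a * measure \<nu>\<^sub>1 (B i) + b * measure \<nu>\<^sub>2 (B i))
        sums (a * measure \<nu>\<^sub>1 (\<Union>i. B i) + b * measure \<nu>\<^sub>2 (\<Union>i. B i))"
      using B union(1) by (intro sums_add sums_mult \<nu>1.finite_measure_UNION \<nu>2.finite_measure_UNION)
        (auto simp: sets)
    moreover have "(\<lambda>i. measure \<mu> (B i)) sums measure \<mu> (\<Union>i. B i)"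
      using B union(1) by (intro \<mu>.finite_measure_UNION) (auto simp: sets)
    ultimately show ?case using union(3) sums_unique2 by simp
  qed simp
qed

lemma borel_prob_eqI_measure:
  assumes "borel_prob \<mu>" "borel_prob \<nu>" "\<And>A. A \<in> sets borel \<Longrightarrow> measure \<mu> A = measure \<nu> A"
  shows "\<mu> = \<nu>"
proof (rule measure_eqI)
  interpret \<mu>: prob_space \<mu> using assms unfolding borel_prob_def by simp
  interpret \<nu>: prob_space \<nu> using assms unfolding borel_prob_def by simp
  show "sets \<mu> = sets \<nu>" using assms by (simp add: borel_prob_def)
  show "emeasure \<mu> A = emeasure \<nu> A" if "A \<in> sets \<mu>" for A
    using assms that by (simp add: borel_prob_def \<mu>.emeasure_eq_measure \<nu>.emeasure_eq_measure)
qed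

lemma borel_prob_eqI:
  fixes \<mu> :: "'a::metric_space measure"
  assumes "borel_prob \<mu>" "borel_prob \<nu>"
    and "\<And>f :: 'a \<Rightarrow> real. continuous_on UNIV f \<Longrightarrow> integral\<^sup>L \<mu> f = integral\<^sup>L \<nu> f"
  shows "\<mu> = \<nu>"
  using borel_prob_eqI_measure[OF assms(1,2)]
    measure_combination_of_integral_combination[OF assms(1,2,2), of 1 0] assms(3) by simp

text \<open>Integration against the combination is itself a normalized positive functional. Its
  Riesz measure agrees with \<open>\<mu>\<close> on Borel sets, hence is
  \<open>\<mu>\<close>.\<close>

lemma integral_combination_of_measure_combination:
  fixes \<mu> :: "'a::metric_space measure"
  assumes cpt: "compact (UNIV :: 'a set)"
    and \<mu>: "borel_prob \<mu>" and \<nu>: "borel_prob \<nu>\<^sub>1" "borel_prob \<nu>\<^sub>2" and t: "0 \<le> t" "t \<le> 1"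
    and eq: "\<And>A. A \<in> sets borel \<Longrightarrow> measure \<mu> A = (1 - t) * measure \<nu>\<^sub>1 A + t * measure \<nu>\<^sub>2 A"
    and f: "continuous_on UNIV f"
  shows "integral\<^sup>L \<mu> f = (1 - t) * integral\<^sup>L \<nu>\<^sub>1 f + t * integral\<^sup>L \<nu>\<^sub>2 f"
proof -
  interpret \<nu>1: prob_space \<nu>\<^sub>1 using \<nu> unfolding borel_prob_def by simp
  interpret \<nu>2: prob_space \<nu>\<^sub>2 using \<nu> unfolding borel_prob_def by simp
  define I where "I f = (1 - t) * integral\<^sup>L \<nu>\<^sub>1 f + t * integral\<^sup>L \<nu>\<^sub>2 f" for f :: "'a \<Rightarrow> real"
  note int = borel_prob_integrable[OF cpt]
  interpret normalized_positive_functional I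
  proof
    show "0 \<le> I f" if "continuous_on UNIV f" "\<And>x. 0 \<le> f x" for f
      using t that unfolding I_def by (intro add_nonneg_nonneg mult_nonneg_nonneg integral_nonneg) auto
  qed (use cpt t \<nu> \<nu>1.prob_space \<nu>2.prob_space in \<open>simp_all add: I_def int algebra_simps\<close>)
  have "measure riesz_measure A = measure \<mu> A" if "A \<in> sets borel" for A
    using measure_combination_of_integral_combination[OF borel_prob_riesz_measure \<nu>, of "1 - t" t A]
      integral_riesz_measure eq that by (simp add: I_def)
  then have "riesz_measure = \<mu>"
    by (intro borel_prob_eqI_measure borel_prob_riesz_measure \<mu>)
  then show ?thesis using integral_riesz_measure[OF f] by (simp add: I_def)
qed


section \<open>The weak-star topology\<close>

lemma topspace_weak_star: "topspace (weak_star_topology S) = S"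
  unfolding weak_star_topology_def topspace_pullback_topology
  by (auto simp: PiE_def)

lemma continuous_map_weak_star_integral:
  assumes "continuous_on UNIV f"
  shows "continuous_map (weak_star_topology S) euclideanreal (\<lambda>\<mu>. integral\<^sup>L \<mu> f)"
proof -
  let ?C = "{f :: 'a \<Rightarrow> real. continuous_on UNIV f}"
  let ?e = "\<lambda>\<mu>. \<lambda>f\<in>?C. integral\<^sup>L \<mu> f"
  have "continuous_map (product_topology (\<lambda>_. euclideanreal) ?C) euclideanreal (\<lambda>L. L f)"
    using assms by (intro continuous_map_product_projection) simp
  from continuous_map_pullback[OF this, of S ?e] show ?thesis
    using assms by (simp add: weak_star_topology_def o_def)
qed

lemma compact_space_pullback_topology:
  assumes "compactin T (e ` A)"
  shows "compact_space (pullback_topology A e T)"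
  unfolding compact_space_def compactin_def
proof (intro conjI allI impI)
  have sub: "e ` A \<subseteq> topspace T" using assms by (simp add: compactin_subset_topspace)
  then have ts: "topspace (pullback_topology A e T) = A"
    by (auto simp: topspace_pullback_topology)
  fix \<U> assume \<U>: "Ball \<U> (openin (pullback_topology A e T)) \<and>
    topspace (pullback_topology A e T) \<subseteq> \<Union>\<U>"
  then obtain V where V: "\<And>U. U \<in> \<U> \<Longrightarrow> openin T (V U) \<and> U = e -` (V U) \<inter> A"
    unfolding openin_pullback_topology by metis
  have "e ` A \<subseteq> \<Union>(V ` \<U>)"
    using \<U> V unfolding ts by fastforce
  then obtain \<F> where "finite \<F>" "\<F> \<subseteq> V ` \<U>" "e ` A \<subseteq> \<Union>\<F>"
    using assms V unfolding compactin_def by (metis (no_types, lifting) imageE)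
  then obtain \<G> where "finite \<G>" "\<G> \<subseteq> \<U>" "\<F> = V ` \<G>"
    by (meson finite_subset_image)
  moreover have "A \<subseteq> \<Union>\<G>"
  proof
    fix a assume a: "a \<in> A"
    then obtain U where U: "U \<in> \<G>" "e a \<in> V U"
      using \<open>e ` A \<subseteq> \<Union>\<F>\<close> \<open>\<F> = V ` \<G>\<close> by auto
    then have "a \<in> U" using V[of U] a \<open>\<G> \<subseteq> \<U>\<close> by auto
    then show "a \<in> \<Union>\<G>" using U by auto
  qed
  ultimately show "\<exists>\<F>. finite \<F> \<and> \<F> \<subseteq> \<U> \<and> topspace (pullback_topology A e T) \<subseteq> \<Union>\<F>"
    unfolding ts by blast
qed simp

section \<open>Actions on compact metric spaces and the compact convex set of their invariant
  measures\<close>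

locale compact_group_action =
  fixes G :: "('g, 'b) monoid_scheme" and \<phi> :: "'g \<Rightarrow> 'a::metric_space \<Rightarrow> 'a"
  assumes compact_UNIV: "compact (UNIV :: 'a set)"
    and group: "group G"
    and continuous_action: "continuous_action G \<phi>"
begin

abbreviation M :: "'a measure set" where
  "M \<equiv> invariant_measures G \<phi>"

abbreviation K :: "'a measure set" where
  "K \<equiv> extreme_boundary G \<phi>"

lemma K_subset_M: "K \<subseteq> M"
  unfolding extreme_boundary_def extreme_measures_def by auto

lemma continuous_on_action: "g \<in> carrier G \<Longrightarrow> continuous_on UNIV (\<phi> g)"
  using continuous_action unfolding continuous_action_def by simp

lemma continuous_on_compose_action:
  "g \<in> carrier G \<Longrightarrow> continuous_on UNIV f \<Longrightarrow> continuous_on UNIV (\<lambda>x. f (\<phi> g x))"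
  by (rule continuous_on_compose2[OF _ continuous_on_action]) auto

lemma M_borel_prob: "\<mu> \<in> M \<Longrightarrow> borel_prob \<mu>"
  by (simp add: invariant_measures_def borel_prob_def)

lemma M_integrable:
  fixes f :: "'a \<Rightarrow> real"
  shows "\<mu> \<in> M \<Longrightarrow> continuous_on UNIV f \<Longrightarrow> integrable \<mu> f"
  using M_borel_prob borel_prob_integrable compact_UNIV by blast

lemma action_measurable:
  assumes "borel_prob \<mu>" "g \<in> carrier G"
  shows "\<phi> g \<in> measurable \<mu> borel"
  using assms continuous_on_action borel_measurable_continuous_onI measurable_cong_sets
  unfolding borel_prob_def by blast

lemma M_integral_action:
  fixes f :: "'a \<Rightarrow> real"
  assumes "\<mu> \<in> M" "g \<in> carrier G" "continuous_on UNIV f"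
  shows "(\<integral>x. f (\<phi> g x) \<partial>\<mu>) = (\<integral>x. f x \<partial>\<mu>)"
proof -
  have "(\<integral>x. f x \<partial>(distr \<mu> borel (\<phi> g))) = (\<integral>x. f (\<phi> g x) \<partial>\<mu>)"
    using assms action_measurable M_borel_prob
    by (intro integral_distr borel_measurable_continuous_onI) auto
  then show ?thesis using assms by (simp add: invariant_measures_def)
qed

lemma M_I:
  assumes \<mu>: "borel_prob \<mu>"
    and inv: "\<And>g f. g \<in> carrier G \<Longrightarrow> continuous_on UNIV f \<Longrightarrow>
           (\<integral>x. f (\<phi> g x) \<partial>\<mu>) = (\<integral>x. (f :: 'a \<Rightarrow> real) x \<partial>\<mu>)"
  shows "\<mu> \<in> M"
proof -
  interpret prob_space \<mu> using \<mu> unfolding borel_prob_def by simp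
  have "distr \<mu> borel (\<phi> g) = \<mu>" if g: "g \<in> carrier G" for g
  proof (rule borel_prob_eqI[OF _ \<mu>])
    note m = action_measurable[OF \<mu> g]
    show "borel_prob (distr \<mu> borel (\<phi> g))"
      using prob_space_distr[OF m] by (simp add: borel_prob_def)
    show "integral\<^sup>L (distr \<mu> borel (\<phi> g)) f = integral\<^sup>L \<mu> f" if f: "continuous_on UNIV f" for f :: "'a \<Rightarrow> real"
      using integral_distr[OF m borel_measurable_continuous_onI[OF f]] inv[OF g f] by simp
  qed
  then show ?thesis using \<mu> by (simp add: invariant_measures_def borel_prob_def)
qed

text \<open>Sending a measure to its family of integrals maps \<open>M\<close> into a product of
  compact intervals. The closed conditions below (additive, homogeneous, positive, normalized,
  invariant) cut out exactly the image; that nothing else satisfies them is the Riesz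
  theorem.\<close>

lemma compact_space_M: "compact_space (weak_star_topology M)"
  unfolding weak_star_topology_def
proof (rule compact_space_pullback_topology)
  define C where "C = {f :: 'a \<Rightarrow> real. continuous_on UNIV f}"
  define T where "T = product_topology (\<lambda>_. euclideanreal) C"
  define e where "e \<mu> = (\<lambda>f\<in>C. integral\<^sup>L \<mu> f)" for \<mu> :: "'a measure"
  have "\<exists>b. \<forall>x. \<bar>f x\<bar> \<le> b" if "f \<in> C" for f
    using continuous_bounded_on_compact[OF compact_UNIV, of f] that unfolding C_def by blast
  then obtain B where B: "\<And>f x. f \<in> C \<Longrightarrow> \<bar>f x\<bar> \<le> B f"
    by metis
  define P where "P = (\<Pi>\<^sub>E f\<in>C. {- B f..B f})"
  define AD where "AD = (\<Inter>f\<in>C. \<Inter>g\<in>C. {L \<in> topspace T. L (\<lambda>x. f x + g x) - L f - L g \<in> {0}})"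
  define SC where "SC = (\<Inter>f\<in>C. \<Inter>c\<in>UNIV. {L \<in> topspace T. L (\<lambda>x. c * f x) - c * L f \<in> {0}})"
  define PO where "PO = (\<Inter>f\<in>{f\<in>C. \<forall>x. 0 \<le> f x}. {L \<in> topspace T. L f \<in> {0..}})"
  define ON where "ON = {L \<in> topspace T. L (\<lambda>_. 1) \<in> {1}}"
  define IN where "IN = (\<Inter>f\<in>C. \<Inter>g\<in>carrier G. {L \<in> topspace T. L (\<lambda>x. f (\<phi> g x)) - L f \<in> {0}})"
  have one: "(\<lambda>_. 1) \<in> C" and zero: "(\<lambda>_. 0) \<in> C" and ne: "carrier G \<noteq> {}"
    using group.is_monoid[OF group] monoid.one_closed by (auto simp: C_def)
  have ac: "(\<lambda>x. f (\<phi> g x)) \<in> C" if "f \<in> C" "g \<in> carrier G" for f g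
    using that continuous_on_compose_action by (simp add: C_def)
  have addC: "(\<lambda>x. f x + g x) \<in> C" if "f \<in> C" "g \<in> C" for f g
    using that by (simp add: C_def continuous_on_add)
  have multC: "(\<lambda>x. c * f x) \<in> C" if "f \<in> C" for f c
    using that by (simp add: C_def continuous_on_mult_left)
  have proj: "continuous_map T euclideanreal (\<lambda>L. L f)" if "f \<in> C" for f
    unfolding T_def using that by (rule continuous_map_product_projection)
  have "compactin T P"
    unfolding T_def P_def compactin_PiE by auto
  moreover have "closedin T AD" unfolding AD_def
    by (intro closedin_INT closedin_continuous_map_preimage[of _ euclideanreal] continuous_map_diff proj addC)
      (use one in auto)
  moreover have "closedin T SC" unfolding SC_def
    by (intro closedin_INT closedin_continuous_map_preimage[of _ euclideanreal] continuous_map_diff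
        continuous_map_real_mult_left proj multC)
      (use one in auto)
  moreover have "closedin T PO" unfolding PO_def
    by (intro closedin_INT closedin_continuous_map_preimage[of _ euclideanreal] proj)
      (use zero in auto)
  moreover have "closedin T ON" unfolding ON_def
    by (intro closedin_continuous_map_preimage[of _ euclideanreal] proj one) auto
  moreover have "closedin T IN" unfolding IN_def
    by (intro closedin_INT closedin_continuous_map_preimage[of _ euclideanreal] continuous_map_diff proj ac)
      (use one ne in auto)
  ultimately have "compactin T (P \<inter> (AD \<inter> SC \<inter> PO \<inter> ON \<inter> IN))"
    by (intro compact_Int_closedin closedin_Int)
  also have "P \<inter> (AD \<inter> SC \<inter> PO \<inter> ON \<inter> IN) = e ` M"
  proof (intro equalityI subsetI)
    fix L assume L: "L \<in> P \<inter> (AD \<inter> SC \<inter> PO \<inter> ON \<inter> IN)"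
    interpret normalized_positive_functional L
    proof
      show "L (\<lambda>x. f x + g x) = L f + L g" if "continuous_on UNIV f" "continuous_on UNIV g" for f g
        using L that unfolding AD_def C_def by (auto simp: algebra_simps)
      show "L (\<lambda>x. c * f x) = c * L f" if "continuous_on UNIV f" for f c
        using L that unfolding SC_def C_def by auto
      show "0 \<le> L f" if "continuous_on UNIV f" "\<And>x. 0 \<le> f x" for f
        using L that unfolding PO_def C_def by auto
      show "L (\<lambda>_. 1) = 1" using L unfolding ON_def by auto
    qed (rule compact_UNIV)
    have "riesz_measure \<in> M"
    proof (rule M_I[OF borel_prob_riesz_measure])
      fix g and f :: "'a \<Rightarrow> real" assume "g \<in> carrier G" "continuous_on UNIV f"
      moreover from this have "L (\<lambda>x. f (\<phi> g x)) = L f"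
        using L unfolding IN_def C_def by auto
      ultimately show "(\<integral>x. f (\<phi> g x) \<partial>riesz_measure) = (\<integral>x. f x \<partial>riesz_measure)"
        using integral_riesz_measure[OF continuous_on_compose_action, of g f] integral_riesz_measure[of f]
        by simp
    qed
    moreover have "L = e riesz_measure"
      using L integral_riesz_measure unfolding e_def P_def C_def
      by (auto simp: fun_eq_iff PiE_def extensional_def)
    ultimately show "L \<in> e ` M" by blast
  next
    fix L assume "L \<in> e ` M"
    then obtain \<mu> where \<mu>: "\<mu> \<in> M" "L = e \<mu>" by auto
    interpret prob_space \<mu> using \<mu> M_borel_prob unfolding borel_prob_def by simp
    have eC: "e \<mu> f = integral\<^sup>L \<mu> f" if "f \<in> C" for f using that by (simp add: e_def)
    have int: "integrable \<mu> f" if "f \<in> C" for f using M_integrable \<mu> that by (simp add: C_def)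
    have ts: "e \<mu> \<in> topspace T" by (simp add: T_def e_def)
    have "\<bar>integral\<^sup>L \<mu> f\<bar> \<le> B f" if "f \<in> C" for f
    proof -
      have "\<bar>integral\<^sup>L \<mu> f\<bar> \<le> (\<integral>x. \<bar>f x\<bar> \<partial>\<mu>)" by (rule integral_abs_bound)
      also have "\<dots> \<le> (\<integral>x. B f \<partial>\<mu>)"
        by (rule integral_mono) (use B int that in auto)
      finally show ?thesis by (simp add: prob_space)
    qed
    then have "e \<mu> \<in> P" unfolding P_def e_def by (auto simp: abs_le_iff minus_le_iff)
    moreover have "e \<mu> \<in> AD"
    proof -
      have "e \<mu> (\<lambda>x. f x + g x) - e \<mu> f - e \<mu> g = 0" if "f \<in> C" "g \<in> C" for f g
      proof -
        show ?thesis using that int addC by (simp add: eC)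
      qed
      then show ?thesis unfolding AD_def using ts by simp
    qed
    moreover have "e \<mu> \<in> SC"
    proof -
      have "e \<mu> (\<lambda>x. c * f x) - c * e \<mu> f = 0" if "f \<in> C" for f c
      proof -
        show ?thesis using that int multC by (simp add: eC)
      qed
      then show ?thesis unfolding SC_def using ts by simp
    qed
    moreover have "e \<mu> \<in> PO" "e \<mu> \<in> ON" unfolding PO_def ON_def using ts one prob_space
      by (auto simp: eC)
    moreover have "e \<mu> \<in> IN" unfolding IN_def using ts ac \<mu> M_integral_action
      by (auto simp: eC) (simp add: C_def)
    ultimately show "L \<in> P \<inter> (AD \<inter> SC \<inter> PO \<inter> ON \<inter> IN)" using \<mu>(2) by auto
  qed
  finally show "compactin (product_topology (\<lambda>_. euclideanreal) {f. continuous_on UNIV f})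
     ((\<lambda>\<mu>. \<lambda>f\<in>{f. continuous_on UNIV f}. integral\<^sup>L \<mu> f) ` M)"
    by (simp add: T_def e_def[abs_def] C_def)
qed

text \<open>A minimal nonempty closed face on which \<open>u\<close> is maximal consists of one extreme measure,
  because the measures in it that maximize any given continuous function form a smaller closed
  face.\<close>

lemma integral_le_of_extreme:
  fixes u :: "'a \<Rightarrow> real"
  assumes u: "continuous_on UNIV u" and K: "\<And>\<mu>. \<mu> \<in> K \<Longrightarrow> integral\<^sup>L \<mu> u \<le> c" and \<mu>: "\<mu> \<in> M"
  shows "integral\<^sup>L \<mu> u \<le> c"
proof -
  let ?W = "weak_star_topology M"
  define face where "face F \<longleftrightarrow> F \<subseteq> M \<and> F \<noteq> {} \<and> closedin ?W F \<and>
     (\<forall>\<mu>\<in>F. \<forall>\<nu>\<^sub>1\<in>M. \<forall>\<nu>\<^sub>2\<in>M. \<forall>t::real. 0 < t \<and> t < 1 \<and>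
        (\<forall>A\<in>sets borel. measure \<mu> A = (1 - t) * measure \<nu>\<^sub>1 A + t * measure \<nu>\<^sub>2 A)
        \<longrightarrow> \<nu>\<^sub>1 \<in> F \<and> \<nu>\<^sub>2 \<in> F)" for F
  have face_sub: "F \<subseteq> M" and face_ne: "F \<noteq> {}" and face_closed: "closedin ?W F" if "face F" for F
    using that unfolding face_def by blast+
  have comb: "integral\<^sup>L \<mu> f = (1 - t) * integral\<^sup>L \<nu>\<^sub>1 f + t * integral\<^sup>L \<nu>\<^sub>2 f"
    if "\<mu> \<in> M" "\<nu>\<^sub>1 \<in> M" "\<nu>\<^sub>2 \<in> M" "0 < t" "t < 1"
      "\<forall>A\<in>sets borel. measure \<mu> A = (1 - t) * measure \<nu>\<^sub>1 A + t * measure \<nu>\<^sub>2 A"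
      "continuous_on UNIV f" for \<mu> \<nu>\<^sub>1 \<nu>\<^sub>2 t and f :: "'a \<Rightarrow> real"
    using that by (intro integral_combination_of_measure_combination compact_UNIV M_borel_prob) auto
  have maximizers: "face {\<mu>\<in>F. \<forall>\<nu>\<in>F. integral\<^sup>L \<nu> f \<le> integral\<^sup>L \<mu> f}"
    if F: "face F" and f: "continuous_on UNIV f" for F and f :: "'a \<Rightarrow> real"
  proof -
    let ?i = "\<lambda>\<mu>. integral\<^sup>L \<mu> f"
    have cm: "continuous_map ?W euclideanreal ?i"
      by (rule continuous_map_weak_star_integral[OF f])
    have "compactin ?W F"
      using compact_space_M closedin_compact_space face_closed[OF F] by blast
    then have "compact (?i ` F)"
      using image_compactin[OF _ cm] by simp
    moreover have "?i ` F \<noteq> {}" using face_ne[OF F] by simp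
    ultimately have "\<exists>s\<in>?i ` F. \<forall>t\<in>?i ` F. t \<le> s" by (rule compact_attains_sup)
    then obtain \<mu>0 where \<mu>0: "\<mu>0 \<in> F" "\<And>\<nu>. \<nu> \<in> F \<Longrightarrow> ?i \<nu> \<le> ?i \<mu>0"
      by blast
    have eq: "{\<mu>\<in>F. \<forall>\<nu>\<in>F. ?i \<nu> \<le> ?i \<mu>} = {\<mu> \<in> F. ?i \<mu> \<in> {?i \<mu>0..}}"
      using \<mu>0 by force
    have "closedin ?W {\<mu> \<in> F. ?i \<mu> \<in> {?i \<mu>0..}}"
      by (intro closedin_continuous_map_preimage_gen[OF cm] face_closed F) auto
    moreover have "\<nu>\<^sub>1 \<in> {\<mu> \<in> F. ?i \<mu> \<in> {?i \<mu>0..}} \<and> \<nu>\<^sub>2 \<in> {\<mu> \<in> F. ?i \<mu> \<in> {?i \<mu>0..}}"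
      if h: "\<mu> \<in> {\<mu> \<in> F. ?i \<mu> \<in> {?i \<mu>0..}}" "\<nu>\<^sub>1 \<in> M" "\<nu>\<^sub>2 \<in> M" "0 < t \<and> t < 1 \<and>
        (\<forall>A\<in>sets borel. measure \<mu> A = (1 - t) * measure \<nu>\<^sub>1 A + t * measure \<nu>\<^sub>2 A)" for \<mu> \<nu>\<^sub>1 \<nu>\<^sub>2 t
    proof -
      have \<nu>: "\<nu>\<^sub>1 \<in> F" "\<nu>\<^sub>2 \<in> F" using F h unfolding face_def by blast+
      have t: "0 < t" "0 < 1 - t" using h(4) by auto
      have c: "?i \<mu> = (1 - t) * ?i \<nu>\<^sub>1 + t * ?i \<nu>\<^sub>2"
        using h face_sub[OF F] by (intro comb f) auto
      have le: "?i \<mu>0 \<le> (1 - t) * ?i \<nu>\<^sub>1 + t * ?i \<nu>\<^sub>2" using h(1) c by simp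
      have "(1 - t) * ?i \<nu>\<^sub>1 \<le> (1 - t) * ?i \<mu>0" "t * ?i \<nu>\<^sub>2 \<le> t * ?i \<mu>0"
        using \<mu>0(2) \<nu> t by simp_all
      moreover have "(1 - t) * ?i \<mu>0 + t * ?i \<mu>0 = ?i \<mu>0" by (simp add: algebra_simps)
      ultimately have "(1 - t) * ?i \<mu>0 \<le> (1 - t) * ?i \<nu>\<^sub>1" "t * ?i \<mu>0 \<le> t * ?i \<nu>\<^sub>2"
        using le by linarith+
      then show ?thesis using \<nu> t by simp
    qed
    ultimately show ?thesis
      unfolding eq using F \<mu>0(1) unfolding face_def by blast
  qed
  have "face M"
    using \<mu> closedin_topspace[of ?W] unfolding face_def topspace_weak_star by blast
  define F0 where "F0 = {\<mu>\<in>M. \<forall>\<nu>\<in>M. integral\<^sup>L \<nu> u \<le> integral\<^sup>L \<mu> u}"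
  have F0: "face F0" unfolding F0_def by (rule maximizers[OF \<open>face M\<close> u])
  \<comment> \<open>\<open>subset_Zorn_nonempty\<close> yields maximal sets, so faces enter through
    their complements in \<open>M\<close>: a maximal complement is a minimal face.\<close>
  define \<A> where "\<A> = {M - F |F. face F \<and> F \<subseteq> F0}"
  have "\<exists>N\<in>\<A>. \<forall>X\<in>\<A>. N \<subseteq> X \<longrightarrow> X = N"
  proof (rule subset_Zorn_nonempty)
    show "\<A> \<noteq> {}" using F0 by (auto simp: \<A>_def)
    fix \<C> assume ne: "\<C> \<noteq> {}" and chain: "subset.chain \<A> \<C>"
    define \<D> where "\<D> = (\<lambda>X. M - X) ` \<C>"
    have \<C>: "\<exists>F. X = M - F \<and> face F \<and> F \<subseteq> F0" if "X \<in> \<C>" for X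
      using chain that unfolding subset.chain_def \<A>_def by blast
    have \<D>: "face F \<and> F \<subseteq> F0" if FD: "F \<in> \<D>" for F
    proof -
      obtain X where X: "X \<in> \<C>" "F = M - X" using FD unfolding \<D>_def by blast
      obtain F' where F': "X = M - F'" "face F'" "F' \<subseteq> F0" using \<C>[OF X(1)] by auto
      then have "F = F'" using X face_sub by blast
      then show ?thesis using F' by simp
    qed
    have \<D>ne: "\<D> \<noteq> {}" using ne by (simp add: \<D>_def)
    have tot: "E \<subseteq> F \<or> F \<subseteq> E" if "E \<in> \<D>" "F \<in> \<D>" for E F
      using that chain unfolding subset.chain_def \<D>_def by blast
    have fin: "\<Inter>\<F> \<in> \<D>" if "finite \<F>" "\<F> \<noteq> {}" "\<F> \<subseteq> \<D>" for \<F>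
      using that
    proof (induction rule: finite_ne_induct)
      case (insert E \<F>)
      then have "E \<in> \<D>" "\<Inter>\<F> \<in> \<D>" by auto
      then show ?case using tot[of E "\<Inter>\<F>"] by (auto simp: Int_absorb1 Int_absorb2)
    qed simp
    have "\<Inter>\<D> \<noteq> {}"
    proof -
      have "\<forall>C\<in>\<D>. closedin ?W C" using \<D> face_closed by blast
      moreover have "\<Inter>\<F> \<noteq> {}" if "finite \<F>" "\<F> \<subseteq> \<D>" for \<F>
        using fin[OF that(1) _ that(2)] \<D> face_ne by (cases "\<F> = {}") auto
      ultimately show ?thesis
        using compact_space_M[unfolded compact_space_fip, THEN spec, of \<D>] by auto
    qed
    moreover have "closedin ?W (\<Inter>\<D>)"
      using \<D> \<D>ne face_closed by (intro closedin_Inter) blast+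
    moreover have "\<Inter>\<D> \<subseteq> F0" "\<Inter>\<D> \<subseteq> M" using \<D> \<D>ne face_sub by blast+
    ultimately have "face (\<Inter>\<D>)" "\<Inter>\<D> \<subseteq> F0"
      using \<D> unfolding face_def by blast+
    moreover have "\<Union>\<C> = M - \<Inter>\<D>"
    proof -
      have "X \<subseteq> M" if "X \<in> \<C>" for X using \<C>[OF that] by auto
      then show ?thesis unfolding \<D>_def by auto
    qed
    ultimately show "\<Union>\<C> \<in> \<A>" unfolding \<A>_def by blast
  qed
  then obtain N where N: "N \<in> \<A>" "\<And>X. X \<in> \<A> \<Longrightarrow> N \<subseteq> X \<Longrightarrow> X = N"
    by blast
  then obtain F where F: "face F" "F \<subseteq> F0" and NF: "N = M - F"
    unfolding \<A>_def by blast
  have max: "M - E = M - F" if "face E" "E \<subseteq> F0" "M - F \<subseteq> M - E" for E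
  proof -
    have "M - E \<in> \<A>" unfolding \<A>_def using that by blast
    then show ?thesis using N(2)[of "M - E"] NF that by simp
  qed
  have min: "E = F" if "face E" "E \<subseteq> F" for E
    using max[of E] that F face_sub[of E] face_sub[of F] by blast
  have single: "\<mu>1 = \<mu>2" if "\<mu>1 \<in> F" "\<mu>2 \<in> F" for \<mu>1 \<mu>2
  proof (rule borel_prob_eqI)
    show "borel_prob \<mu>1" "borel_prob \<mu>2"
      using that face_sub[OF F(1)] by (auto intro!: M_borel_prob)
    fix f :: "'a \<Rightarrow> real" assume f: "continuous_on UNIV f"
    have "{\<mu>\<in>F. \<forall>\<nu>\<in>F. integral\<^sup>L \<nu> f \<le> integral\<^sup>L \<mu> f} = F"
      by (rule min[OF maximizers[OF F(1) f]]) auto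
    then have "\<forall>\<nu>\<in>F. integral\<^sup>L \<nu> f \<le> integral\<^sup>L \<mu>1 f" "\<forall>\<nu>\<in>F. integral\<^sup>L \<nu> f \<le> integral\<^sup>L \<mu>2 f"
      using that by blast+
    then show "integral\<^sup>L \<mu>1 f = integral\<^sup>L \<mu>2 f" using that by (meson antisym)
  qed
  obtain \<mu>1 where \<mu>1: "\<mu>1 \<in> F" using face_ne[OF F(1)] by blast
  have "\<mu>1 \<in> K"
    unfolding extreme_boundary_def extreme_measures_def
    using F(1) \<mu>1 single unfolding face_def by blast
  moreover have "integral\<^sup>L \<mu> u \<le> integral\<^sup>L \<mu>1 u"
    using \<mu>1 F(2) \<mu> by (auto simp: F0_def)
  ultimately show ?thesis using K by fastforce
qed

end


section \<open>A self-adjoint averaging operator\<close>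

lemma geometric_series_continuous:
  fixes F :: "nat \<Rightarrow> 'a::metric_space \<Rightarrow> real"
  assumes cont: "\<And>n. continuous_on UNIV (F n)" and bound: "\<And>n x. \<bar>F n x\<bar> \<le> B"
  defines "S \<equiv> \<lambda>x. \<Sum>n. (1/2)^Suc n * F n x"
  shows "continuous_on UNIV S" "\<And>x. \<bar>S x\<bar> \<le> B" "\<And>x. (\<lambda>n. (1/2)^Suc n * F n x) sums S x"
proof -
  have half: "(\<lambda>n. (1/2)^Suc n * B) sums B"
    using sums_mult2[OF power_half_series, of B] by simp
  have le: "norm ((1/2)^Suc n * F n x) \<le> (1/2)^Suc n * B" for n x
    using bound[of n x] by (simp add: abs_mult mult_left_mono)
  have unif: "uniform_limit UNIV (\<lambda>N x. \<Sum>n<N. (1/2)^Suc n * F n x) S sequentially"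
    unfolding S_def by (rule Weierstrass_m_test[OF le]) (rule sums_summable[OF half])
  have "\<forall>\<^sub>F N in sequentially. continuous_on UNIV (\<lambda>x. \<Sum>n<N. (1/2)^Suc n * F n x)"
    by (intro always_eventually allI continuous_on_sum continuous_on_mult continuous_on_const cont)
  from uniform_limit_theorem[OF this unif] show "continuous_on UNIV S" by simp
  show sums: "(\<lambda>n. (1/2)^Suc n * F n x) sums S x" for x
    unfolding S_def
    by (intro summable_sums summable_comparison_test[OF _ sums_summable[OF half]] exI allI impI le)
  have "(1/2)^Suc n * F n x \<le> (1/2)^Suc n * B" "(1/2)^Suc n * (- B) \<le> (1/2)^Suc n * F n x" for n x
    using bound[of n x] by (intro mult_left_mono; simp add: abs_le_iff)+
  from sums_le[OF this(1) sums half] sums_le[OF this(2) sums_mult2[OF power_half_series, of "-B", simplified mult_1] sums]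
  show "\<bar>S x\<bar> \<le> B" for x
    by (simp add: abs_le_iff minus_le_iff[of "S x"])
qed

lemma geometric_series_integral:
  fixes F :: "nat \<Rightarrow> 'a::metric_space \<Rightarrow> real"
  assumes cpt: "compact (UNIV :: 'a set)" and \<mu>: "borel_prob \<mu>"
    and cont: "\<And>n. continuous_on UNIV (F n)" and bound: "\<And>n x. \<bar>F n x\<bar> \<le> B"
    and h: "continuous_on UNIV h"
  shows "(\<lambda>n. (1/2)^Suc n * (\<integral>x. F n x * h x \<partial>\<mu>)) sums (\<integral>x. (\<Sum>n. (1/2)^Suc n * F n x) * h x \<partial>\<mu>)"
proof -
  interpret prob_space \<mu> using \<mu> unfolding borel_prob_def by simp
  obtain H where H: "H > 0" "\<And>x. \<bar>h x\<bar> \<le> H"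
    using continuous_bounded_on_compact[OF cpt h] by metis
  note S = geometric_series_continuous[of F B, OF cont bound]
  let ?s = "\<lambda>N x. (\<Sum>n<N. (1/2)^Suc n * F n x)"
  have sc: "continuous_on UNIV (?s N)" for N
    by (intro continuous_on_sum continuous_on_mult continuous_on_const cont)
  have "(\<lambda>N. \<integral>x. ?s N x * h x \<partial>\<mu>) \<longlonglongrightarrow> (\<integral>x. (\<Sum>n. (1/2)^Suc n * F n x) * h x \<partial>\<mu>)"
  proof (rule integral_dominated_convergence[where w = "\<lambda>_. B * H"])
    show "AE x in \<mu>. (\<lambda>N. ?s N x * h x) \<longlonglongrightarrow> (\<Sum>n. (1/2)^Suc n * F n x) * h x"
      using S(3) unfolding sums_def by (intro AE_I2 tendsto_mult tendsto_const) auto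
    show "AE x in \<mu>. norm (?s N x * h x) \<le> B * H" for N
    proof (rule AE_I2)
      fix x
      have B: "0 \<le> B" using bound[of 0 x] by linarith
      have "\<bar>?s N x\<bar> \<le> (\<Sum>n<N. (1/2)^Suc n * B)"
        by (intro order_trans[OF sum_abs] sum_mono) (use bound in \<open>simp add: abs_mult mult_left_mono\<close>)
      also have "\<dots> \<le> B"
        using sums_mult2[OF power_half_series, of B] B sum_le_suminf[of "\<lambda>n. (1/2)^Suc n * B" "{..<N}"]
        by (simp add: sums_iff)
      finally have "\<bar>?s N x\<bar> * \<bar>h x\<bar> \<le> B * H"
        using H(2)[of x] B by (intro mult_mono) auto
      then show "norm (?s N x * h x) \<le> B * H" by (simp only: real_norm_def abs_mult)
    qed
    show "(\<lambda>x. (\<Sum>n. (1/2)^Suc n * F n x) * h x) \<in> borel_measurable \<mu>"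
      by (intro borel_prob_measurable[OF \<mu>] continuous_on_mult S(1) h)
    show "(\<lambda>x. ?s N x * h x) \<in> borel_measurable \<mu>" for N
      by (intro borel_prob_measurable[OF \<mu>] continuous_on_mult sc h)
  qed simp
  moreover have "(\<integral>x. ?s N x * h x \<partial>\<mu>) = (\<Sum>n<N. (1/2)^Suc n * (\<integral>x. F n x * h x \<partial>\<mu>))" for N
  proof -
    have int: "integrable \<mu> (\<lambda>x. F n x * h x)" for n
      by (intro borel_prob_integrable[OF cpt \<mu>] continuous_on_mult cont h)
    have "(\<integral>x. ?s N x * h x \<partial>\<mu>) = (\<integral>x. (\<Sum>n<N. (1/2)^Suc n * (F n x * h x)) \<partial>\<mu>)"
      by (simp only: sum_distrib_right mult.assoc)
    also have "\<dots> = (\<Sum>n<N. (\<integral>x. (1/2)^Suc n * (F n x * h x) \<partial>\<mu>))"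
      by (intro Bochner_Integration.integral_sum integrable_mult_right int)
    also have "\<dots> = (\<Sum>n<N. (1/2)^Suc n * (\<integral>x. F n x * h x \<partial>\<mu>))"
      by simp
    finally show ?thesis .
  qed
  ultimately show ?thesis unfolding sums_def by simp
qed

lemma abs_midpoint_le:
  fixes a b B :: real
  assumes "\<bar>a\<bar> \<le> B" "\<bar>b\<bar> \<le> B"
  shows "\<bar>(a + b) / 2\<bar> \<le> B"
  using assms abs_triangle_ineq[of a b] by simp

locale countable_group_action = compact_group_action G \<phi>
  for G :: "('g, 'b) monoid_scheme" and \<phi> :: "'g \<Rightarrow> 'a::metric_space \<Rightarrow> 'a" +
  assumes countable_carrier: "countable (carrier G)"
begin

lemma action_inverse:
  assumes "g \<in> carrier G"
  shows "\<phi> g (\<phi> (inv\<^bsub>G\<^esub> g) x) = x" "\<phi> (inv\<^bsub>G\<^esub> g) (\<phi> g x) = x"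
proof -
  interpret group_action G UNIV \<phi>
    using continuous_action by (simp add: continuous_action_def)
  show "\<phi> (inv\<^bsub>G\<^esub> g) (\<phi> g x) = x" using orbit_sym_aux[OF assms, of x "\<phi> g x"] by simp
  show "\<phi> g (\<phi> (inv\<^bsub>G\<^esub> g) x) = x"
    using orbit_sym_aux[of "inv\<^bsub>G\<^esub> g" x] group.inv_closed[OF group assms] group.inv_inv[OF group assms]
    by simp
qed

definition enum :: "nat \<Rightarrow> 'g" where
  "enum = from_nat_into (carrier G)"

text \<open>Pairing an element with its inverse makes the operator self-adjoint in
  \<open>L^2\<close> of every invariant measure.\<close>

definition sym_translate :: "nat \<Rightarrow> ('a \<Rightarrow> real) \<Rightarrow> 'a \<Rightarrow> real" where
  "sym_translate n u x = (u (\<phi> (enum n) x) + u (\<phi> (inv\<^bsub>G\<^esub> (enum n)) x)) / 2"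

text \<open>One step of a symmetric random walk. Every group element occurs with positive weight, so
  a function almost fixed in mean square is almost invariant under each element; repetitions in
  \<open>enum\<close> are harmless.\<close>

definition average :: "('a \<Rightarrow> real) \<Rightarrow> 'a \<Rightarrow> real" where
  "average u x = (\<Sum>n. (1/2)^Suc n * sym_translate n u x)"

text \<open>The identity is mixed in as in a lazy random walk. The operator becomes positive, and
  the squared norm lost in one application controls how far \<open>u\<close> is from being invariant
  (\<open>lazy_average_defect\<close>).\<close>

definition lazy_average :: "('a \<Rightarrow> real) \<Rightarrow> 'a \<Rightarrow> real" where
  "lazy_average u x = (u x + average u x) / 2"

lemma carrier_nonempty: "carrier G \<noteq> {}"
  using group.is_monoid[OF group] monoid.one_closed by auto

lemma enum_in_carrier: "enum n \<in> carrier G" "inv\<^bsub>G\<^esub> (enum n) \<in> carrier G"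
  using from_nat_into[OF carrier_nonempty] group.inv_closed[OF group]
  by (simp_all add: enum_def)

lemma enum_surj: "g \<in> carrier G \<Longrightarrow> \<exists>n. g = enum n"
  unfolding enum_def using from_nat_into_surj[OF countable_carrier] by metis

lemma continuous_on_sym_translate:
  "continuous_on UNIV u \<Longrightarrow> continuous_on UNIV (sym_translate n u)"
  unfolding sym_translate_def[abs_def]
  by (intro continuous_on_divide continuous_on_add continuous_on_const
      continuous_on_compose_action enum_in_carrier) auto

lemma abs_sym_translate_le: "(\<And>x. \<bar>u x\<bar> \<le> B) \<Longrightarrow> \<bar>sym_translate n u x\<bar> \<le> B"
proof -
  assume B: "\<And>x. \<bar>u x\<bar> \<le> B"
  show ?thesis
    using B[of "\<phi> (enum n) x"] B[of "\<phi> (inv\<^bsub>G\<^esub> (enum n)) x"]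
    unfolding sym_translate_def by (rule abs_midpoint_le)
qed

lemma continuous_on_average:
  assumes "continuous_on UNIV u"
  shows "continuous_on UNIV (average u)"
proof -
  obtain B where "\<And>x. \<bar>u x\<bar> \<le> B"
    using continuous_bounded_on_compact[OF compact_UNIV assms] by metis
  then show ?thesis
    unfolding average_def[abs_def]
    by (intro geometric_series_continuous(1) continuous_on_sym_translate assms abs_sym_translate_le)
qed

lemma abs_average_le:
  assumes "continuous_on UNIV u" "\<And>x. \<bar>u x\<bar> \<le> B"
  shows "\<bar>average u x\<bar> \<le> B"
  unfolding average_def
  by (intro geometric_series_continuous(2) continuous_on_sym_translate assms abs_sym_translate_le)

lemma average_integral_sums:
  assumes "\<mu> \<in> M" "continuous_on UNIV u" "continuous_on UNIV v"
  shows "(\<lambda>n. (1/2)^Suc n * (\<integral>x. sym_translate n u x * v x \<partial>\<mu>)) sums (\<integral>x. average u x * v x \<partial>\<mu>)"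
proof -
  obtain B where B: "\<And>x. \<bar>u x\<bar> \<le> B"
    using continuous_bounded_on_compact[OF compact_UNIV assms(2)] by metis
  show ?thesis
    unfolding average_def
    by (rule geometric_series_integral[OF compact_UNIV M_borel_prob[OF assms(1)]
          continuous_on_sym_translate[OF assms(2)] abs_sym_translate_le[OF B] assms(3)])
qed

lemma M_integral_translate_mult:
  fixes u v :: "'a \<Rightarrow> real"
  assumes "\<mu> \<in> M" "continuous_on UNIV u" "continuous_on UNIV v" "g \<in> carrier G"
  shows "(\<integral>x. u (\<phi> g x) * v x \<partial>\<mu>) = (\<integral>x. u x * v (\<phi> (inv\<^bsub>G\<^esub> g) x) \<partial>\<mu>)"
proof -
  have "(\<integral>x. u (\<phi> g (\<phi> (inv\<^bsub>G\<^esub> g) x)) * v (\<phi> (inv\<^bsub>G\<^esub> g) x) \<partial>\<mu>) = (\<integral>x. u (\<phi> g x) * v x \<partial>\<mu>)"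
    using assms group.inv_closed[OF group]
    by (intro M_integral_action[of _ _ "\<lambda>x. u (\<phi> g x) * v x"] continuous_on_mult
        continuous_on_compose_action) auto
  then show ?thesis using action_inverse[OF assms(4)] by simp
qed

lemma integral_sym_translate_mult:
  fixes u v :: "'a \<Rightarrow> real"
  assumes \<mu>: "\<mu> \<in> M" and u: "continuous_on UNIV u" and v: "continuous_on UNIV v"
  shows "(\<integral>x. sym_translate n u x * v x \<partial>\<mu>) =
    ((\<integral>x. u (\<phi> (enum n) x) * v x \<partial>\<mu>) + (\<integral>x. u (\<phi> (inv\<^bsub>G\<^esub> (enum n)) x) * v x \<partial>\<mu>)) / 2"
proof -
  have "integrable \<mu> (\<lambda>x. u (\<phi> g x) * v x)" if "g \<in> carrier G" for g
    by (intro M_integrable \<mu> continuous_on_mult continuous_on_compose_action u v that)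
  then have "(\<integral>x. (u (\<phi> (enum n) x) * v x + u (\<phi> (inv\<^bsub>G\<^esub> (enum n)) x) * v x) / 2 \<partial>\<mu>) =
    ((\<integral>x. u (\<phi> (enum n) x) * v x \<partial>\<mu>) + (\<integral>x. u (\<phi> (inv\<^bsub>G\<^esub> (enum n)) x) * v x \<partial>\<mu>)) / 2"
    using enum_in_carrier by simp
  then show ?thesis by (simp add: sym_translate_def add_divide_distrib distrib_right)
qed

lemma sym_translate_self_adjoint:
  assumes "\<mu> \<in> M" "continuous_on UNIV u" "continuous_on UNIV v"
  shows "(\<integral>x. sym_translate n u x * v x \<partial>\<mu>) = (\<integral>x. sym_translate n v x * u x \<partial>\<mu>)"
  unfolding integral_sym_translate_mult[OF assms] integral_sym_translate_mult[OF assms(1,3,2)]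
    M_integral_translate_mult[OF assms enum_in_carrier(1)] M_integral_translate_mult[OF assms enum_in_carrier(2)]
    group.inv_inv[OF group enum_in_carrier(1)]
  by (simp add: mult.commute add.commute)

lemma average_self_adjoint:
  assumes "\<mu> \<in> M" "continuous_on UNIV u" "continuous_on UNIV v"
  shows "(\<integral>x. average u x * v x \<partial>\<mu>) = (\<integral>x. average v x * u x \<partial>\<mu>)"
  using average_integral_sums[OF assms] average_integral_sums[OF assms(1,3,2)]
    sym_translate_self_adjoint[OF assms] sums_unique2 by fastforce

lemma M_integral_mult_le_squares:
  fixes u v :: "'a \<Rightarrow> real"
  assumes "\<mu> \<in> M" "continuous_on UNIV u" "continuous_on UNIV v"
  shows "(\<integral>x. u x * v x \<partial>\<mu>) \<le> ((\<integral>x. u x * u x \<partial>\<mu>) + (\<integral>x. v x * v x \<partial>\<mu>)) / 2"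
proof -
  have int: "integrable \<mu> (\<lambda>x. u x * v x)" "integrable \<mu> (\<lambda>x. u x * u x)" "integrable \<mu> (\<lambda>x. v x * v x)"
    by (intro M_integrable assms continuous_on_mult)+
  have "(\<integral>x. u x * v x \<partial>\<mu>) \<le> (\<integral>x. (u x * u x + v x * v x) / 2 \<partial>\<mu>)"
  proof (rule integral_mono)
    show "u x * v x \<le> (u x * u x + v x * v x) / 2" for x
      using sum_squares_bound[of "u x" "v x"] by (simp add: power2_eq_square)
  qed (use int in auto)
  then show ?thesis using int by simp
qed

text \<open>Call the two sides \<open>T\<close> and \<open>U\<close>. Then \<open>T\<close> is the
  mean of two inner products, each at most \<open>(U + T) / 2\<close> by the arithmetic-geometric
  inequality and invariance; absorbing \<open>T / 2\<close> gives the claim.\<close>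

lemma integral_sym_translate_square_le:
  assumes \<mu>: "\<mu> \<in> M" and u: "continuous_on UNIV u"
  shows "(\<integral>x. sym_translate n u x * sym_translate n u x \<partial>\<mu>) \<le> (\<integral>x. u x * u x \<partial>\<mu>)"
proof -
  have le: "(\<integral>x. u (\<phi> g x) * sym_translate n u x \<partial>\<mu>)
      \<le> ((\<integral>x. u x * u x \<partial>\<mu>) + (\<integral>x. sym_translate n u x * sym_translate n u x \<partial>\<mu>)) / 2"
    if "g \<in> carrier G" for g
    using M_integral_mult_le_squares[OF \<mu> continuous_on_compose_action[OF that u] continuous_on_sym_translate[OF u, of n]]
      M_integral_action[OF \<mu> that continuous_on_mult[OF u u]]
    by simp
  show ?thesis
    using le[OF enum_in_carrier(1)[of n]] le[OF enum_in_carrier(2)[of n]]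
    unfolding integral_sym_translate_mult[OF \<mu> u continuous_on_sym_translate[OF u]]
    by (simp add: field_simps)
qed

text \<open>The same absorption: \<open>?A\<close> is a weighted mean of inner products that are at
  most \<open>(?U + ?A) / 2\<close>.\<close>

lemma integral_average_square_le:
  assumes \<mu>: "\<mu> \<in> M" and u: "continuous_on UNIV u"
  shows "(\<integral>x. average u x * average u x \<partial>\<mu>) \<le> (\<integral>x. u x * u x \<partial>\<mu>)" (is "?A \<le> ?U")
proof -
  have "(1/2)^Suc n * (\<integral>x. sym_translate n u x * average u x \<partial>\<mu>) \<le> (1/2)^Suc n * ((?U + ?A) / 2)" for n
    using M_integral_mult_le_squares[OF \<mu> continuous_on_sym_translate[OF u, of n] continuous_on_average[OF u]]
      integral_sym_translate_square_le[OF \<mu> u, of n]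
    by (intro mult_left_mono) (auto simp: field_simps)
  from sums_le[OF this average_integral_sums[OF \<mu> u continuous_on_average[OF u]]
      sums_mult2[OF power_half_series]]
  show ?thesis by (simp add: field_simps)
qed

text \<open>Expanding the square and using invariance, half of the mean square of the increment is
  the inner product of \<open>u\<close> with \<open>u\<close> minus its symmetrized translate. The
  weighted sum over all \<open>n\<close> is the right side; its terms are nonnegative, so each
  single one is a lower bound.\<close>

lemma integral_average_defect:
  assumes \<mu>: "\<mu> \<in> M" and u: "continuous_on UNIV u"
  shows "(1/2)^Suc n * ((\<integral>x. (u (\<phi> (enum n) x) - u x)^2 \<partial>\<mu>) / 2)
    \<le> (\<integral>x. u x * u x \<partial>\<mu>) - (\<integral>x. average u x * u x \<partial>\<mu>)"
proof -
  let ?U = "\<integral>x. u x * u x \<partial>\<mu>"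
  have eq: "(\<integral>x. (u (\<phi> (enum n) x) - u x)^2 \<partial>\<mu>) / 2 = ?U - (\<integral>x. sym_translate n u x * u x \<partial>\<mu>)" for n
  proof -
    have g: "enum n \<in> carrier G" by (rule enum_in_carrier)
    have int: "integrable \<mu> (\<lambda>x. u (\<phi> (enum n) x) * u x)" "integrable \<mu> (\<lambda>x. u x * u x)"
      "integrable \<mu> (\<lambda>x. u (\<phi> (enum n) x) * u (\<phi> (enum n) x))"
      by (intro M_integrable \<mu> continuous_on_mult continuous_on_compose_action g u)+
    have "(\<integral>x. (u (\<phi> (enum n) x) - u x)^2 \<partial>\<mu>)
       = (\<integral>x. u (\<phi> (enum n) x) * u (\<phi> (enum n) x) + u x * u x - 2 * (u (\<phi> (enum n) x) * u x) \<partial>\<mu>)"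
      by (rule Bochner_Integration.integral_cong) (auto simp: power2_eq_square algebra_simps)
    also have "\<dots> = ?U + ?U - 2 * (\<integral>x. u (\<phi> (enum n) x) * u x \<partial>\<mu>)"
      using int M_integral_action[OF \<mu> g continuous_on_mult[OF u u]] by simp
    also have "(\<integral>x. sym_translate n u x * u x \<partial>\<mu>) = (\<integral>x. u (\<phi> (enum n) x) * u x \<partial>\<mu>)"
      using integral_sym_translate_mult[OF \<mu> u u, of n] M_integral_translate_mult[OF \<mu> u u g]
      by (simp add: mult.commute)
    ultimately show ?thesis by simp
  qed
  have "(\<lambda>n. (1/2)^Suc n * ?U - (1/2)^Suc n * (\<integral>x. sym_translate n u x * u x \<partial>\<mu>))
      sums (1 * ?U - (\<integral>x. average u x * u x \<partial>\<mu>))"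
    by (intro sums_diff sums_mult2[OF power_half_series] average_integral_sums \<mu> u)
  then have sums: "(\<lambda>n. (1/2)^Suc n * ((\<integral>x. (u (\<phi> (enum n) x) - u x)^2 \<partial>\<mu>) / 2))
      sums (?U - (\<integral>x. average u x * u x \<partial>\<mu>))"
    unfolding eq by (simp only: right_diff_distrib mult_1)
  have "sum (\<lambda>n. (1/2)^Suc n * ((\<integral>x. (u (\<phi> (enum n) x) - u x)^2 \<partial>\<mu>) / 2)) {n}
      \<le> suminf (\<lambda>n. (1/2)^Suc n * ((\<integral>x. (u (\<phi> (enum n) x) - u x)^2 \<partial>\<mu>) / 2))"
    by (intro sum_le_suminf sums_summable[OF sums]) auto
  then show ?thesis using sums_unique[OF sums] by simp
qed

lemma continuous_on_lazy_average:
  "continuous_on UNIV u \<Longrightarrow> continuous_on UNIV (lazy_average u)"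
  unfolding lazy_average_def[abs_def]
  by (intro continuous_on_divide continuous_on_add continuous_on_const continuous_on_average) auto

lemma abs_lazy_average_le:
  assumes "continuous_on UNIV u" "\<And>x. \<bar>u x\<bar> \<le> B"
  shows "\<bar>lazy_average u x\<bar> \<le> B"
  unfolding lazy_average_def by (intro abs_midpoint_le abs_average_le assms)

lemma lazy_average_one: "lazy_average (\<lambda>_. 1) = (\<lambda>_. 1)"
proof -
  have "average (\<lambda>_. 1) x = 1" for x
    using sums_unique[OF power_half_series] by (simp add: average_def sym_translate_def)
  then show ?thesis by (simp add: lazy_average_def fun_eq_iff)
qed

lemma integral_lazy_average_mult:
  assumes "\<mu> \<in> M" "continuous_on UNIV u" "continuous_on UNIV v"
  shows "(\<integral>x. lazy_average u x * v x \<partial>\<mu>) = ((\<integral>x. u x * v x \<partial>\<mu>) + (\<integral>x. average u x * v x \<partial>\<mu>)) / 2"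
proof -
  have "integrable \<mu> (\<lambda>x. u x * v x)" "integrable \<mu> (\<lambda>x. average u x * v x)"
    by (intro M_integrable assms continuous_on_mult continuous_on_average)+
  then have "(\<integral>x. (u x * v x + average u x * v x) / 2 \<partial>\<mu>) = ((\<integral>x. u x * v x \<partial>\<mu>) + (\<integral>x. average u x * v x \<partial>\<mu>)) / 2"
    by simp
  then show ?thesis by (simp add: lazy_average_def distrib_right)
qed

lemma lazy_average_self_adjoint:
  assumes "\<mu> \<in> M" "continuous_on UNIV u" "continuous_on UNIV v"
  shows "(\<integral>x. lazy_average u x * v x \<partial>\<mu>) = (\<integral>x. u x * lazy_average v x \<partial>\<mu>)"
  using integral_lazy_average_mult[OF assms] integral_lazy_average_mult[OF assms(1,3,2)]
    average_self_adjoint[OF assms]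
  by (simp add: mult.commute)

text \<open>Expand the square of \<open>(u + average u) / 2\<close> and bound the mean square of
  \<open>average u\<close> by that of \<open>u\<close>: the loss is at least half of the quantity in
  \<open>integral_average_defect\<close>. This forces limits of iterates to be invariant.\<close>

lemma lazy_average_defect:
  assumes \<mu>: "\<mu> \<in> M" and u: "continuous_on UNIV u"
  shows "(1/2)^Suc n / 4 * (\<integral>x. (u (\<phi> (enum n) x) - u x)^2 \<partial>\<mu>)
    \<le> (\<integral>x. u x * u x \<partial>\<mu>) - (\<integral>x. lazy_average u x * lazy_average u x \<partial>\<mu>)"
proof -
  have "(\<integral>x. lazy_average u x * lazy_average u x \<partial>\<mu>)
      = ((\<integral>x. u x * u x \<partial>\<mu>) + 2 * (\<integral>x. average u x * u x \<partial>\<mu>) + (\<integral>x. average u x * average u x \<partial>\<mu>)) / 4"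
    using integral_lazy_average_mult[OF \<mu> u continuous_on_lazy_average[OF u]]
      integral_lazy_average_mult[OF \<mu> u u] integral_lazy_average_mult[OF \<mu> u continuous_on_average[OF u]]
    by (simp add: mult.commute)
  moreover have "(1/2)^Suc n / 4 * (\<integral>x. (u (\<phi> (enum n) x) - u x)^2 \<partial>\<mu>)
      = ((1/2)^Suc n * ((\<integral>x. (u (\<phi> (enum n) x) - u x)^2 \<partial>\<mu>) / 2)) / 2"
    by simp
  moreover have "p \<le> U - L" if "L = (U + 2 * A + Q) / 4" "p = q / 2" "Q \<le> U" "q \<le> U - A"
    for p q U A Q L :: real
    using that by simp
  ultimately show ?thesis
    using integral_average_square_le[OF \<mu> u] integral_average_defect[OF \<mu> u, of n]
    by blast
qed

end


section \<open>Uniform mean ergodic convergence on the extreme boundary\<close>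

context compact_group_action
begin

text \<open>Cauchy-Schwarz, in the form that a variance is nonnegative.\<close>

lemma M_integral_abs_le_sqrt:
  fixes v :: "'a \<Rightarrow> real"
  assumes \<mu>: "\<mu> \<in> M" and v: "continuous_on UNIV v"
  shows "(\<integral>x. \<bar>v x\<bar> \<partial>\<mu>) \<le> sqrt (\<integral>x. v x * v x \<partial>\<mu>)"
proof (rule real_le_rsqrt)
  interpret prob_space \<mu> using M_borel_prob[OF \<mu>] by (simp add: borel_prob_def)
  define c where "c = (\<integral>x. \<bar>v x\<bar> \<partial>\<mu>)"
  have int: "integrable \<mu> (\<lambda>x. \<bar>v x\<bar>)" "integrable \<mu> (\<lambda>x. v x * v x)"
    by (intro M_integrable \<mu> continuous_on_mult continuous_on_rabs v)+
  have "0 \<le> (\<integral>x. (\<bar>v x\<bar> - c)^2 \<partial>\<mu>)" by simp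
  also have "(\<integral>x. (\<bar>v x\<bar> - c)^2 \<partial>\<mu>) = (\<integral>x. v x * v x - 2 * c * \<bar>v x\<bar> + c * c \<partial>\<mu>)"
    by (rule Bochner_Integration.integral_cong) (auto simp: power2_eq_square algebra_simps)
  also have "\<dots> = (\<integral>x. v x * v x \<partial>\<mu>) - 2 * c * c + c * c"
    using int prob_space by (simp add: c_def)
  finally show "(\<integral>x. \<bar>v x\<bar> \<partial>\<mu>)^2 \<le> (\<integral>x. v x * v x \<partial>\<mu>)"
    by (simp add: c_def power2_eq_square)
qed

lemma M_abs_integral_mult_le:
  fixes v h :: "'a \<Rightarrow> real"
  assumes \<mu>: "\<mu> \<in> M" and v: "continuous_on UNIV v" and h: "continuous_on UNIV h"
    and H: "\<And>x. \<bar>h x\<bar> \<le> H"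
  shows "\<bar>\<integral>x. v x * h x \<partial>\<mu>\<bar> \<le> H * sqrt (\<integral>x. v x * v x \<partial>\<mu>)"
proof -
  have int: "integrable \<mu> (\<lambda>x. \<bar>v x\<bar>)" "integrable \<mu> (\<lambda>x. \<bar>v x * h x\<bar>)"
    by (intro M_integrable \<mu> continuous_on_mult continuous_on_rabs v h)+
  have "\<bar>\<integral>x. v x * h x \<partial>\<mu>\<bar> \<le> (\<integral>x. \<bar>v x * h x\<bar> \<partial>\<mu>)" by (rule integral_abs_bound)
  also have "\<dots> \<le> (\<integral>x. H * \<bar>v x\<bar> \<partial>\<mu>)"
  proof (rule integral_mono[OF int(2)])
    show "\<bar>v x * h x\<bar> \<le> H * \<bar>v x\<bar>" for x
      using mult_right_mono[OF H[of x], of "\<bar>v x\<bar>"] by (simp add: abs_mult mult.commute)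
  qed (use int in auto)
  also have "\<dots> = H * (\<integral>x. \<bar>v x\<bar> \<partial>\<mu>)" by simp
  also have "\<dots> \<le> H * sqrt (\<integral>x. v x * v x \<partial>\<mu>)"
    using H[of undefined] by (intro mult_left_mono M_integral_abs_le_sqrt \<mu> v) linarith
  finally show ?thesis .
qed

end

context countable_group_action
begin

definition iter :: "('a \<Rightarrow> real) \<Rightarrow> nat \<Rightarrow> 'a \<Rightarrow> real" where
  "iter f n = (lazy_average ^^ n) f"

lemma iter_Suc: "iter f (Suc n) = lazy_average (iter f n)"
  by (simp add: iter_def)

lemma iter_0: "iter f 0 = f"
  by (simp add: iter_def)

lemma continuous_on_iter: "continuous_on UNIV f \<Longrightarrow> continuous_on UNIV (iter f n)"
  by (induction n) (simp_all add: iter_0 iter_Suc continuous_on_lazy_average)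

lemma abs_iter_le:
  assumes "continuous_on UNIV f" "\<And>x. \<bar>f x\<bar> \<le> B"
  shows "\<bar>iter f n x\<bar> \<le> B"
  by (induction n arbitrary: x)
    (simp_all add: iter_0 iter_Suc assms abs_lazy_average_le continuous_on_iter)

lemma integral_iter:
  assumes "\<mu> \<in> M" "continuous_on UNIV f"
  shows "(\<integral>x. iter f n x \<partial>\<mu>) = (\<integral>x. f x \<partial>\<mu>)"
proof (induction n)
  case (Suc n)
  have "(\<integral>x. lazy_average (iter f n) x * 1 \<partial>\<mu>) = (\<integral>x. iter f n x * lazy_average (\<lambda>_. 1) x \<partial>\<mu>)"
    by (rule lazy_average_self_adjoint[OF assms(1) continuous_on_iter[OF assms(2)]]) simp
  then show ?case using Suc by (simp add: iter_Suc lazy_average_one)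
qed (simp add: iter_0)

text \<open>By self-adjointness inner products of iterates depend only on the sum of the indices,
  which ties them to the monotone sequence of squared norms.\<close>

lemma integral_iter_mult_iter:
  assumes "\<mu> \<in> M" "continuous_on UNIV f"
  shows "(\<integral>x. iter f m x * iter f n x \<partial>\<mu>) = (\<integral>x. iter f (m + n) x * f x \<partial>\<mu>)"
proof (induction n arbitrary: m)
  case (Suc n)
  have "(\<integral>x. iter f m x * iter f (Suc n) x \<partial>\<mu>) = (\<integral>x. iter f (Suc m) x * iter f n x \<partial>\<mu>)"
    unfolding iter_Suc using assms by (intro lazy_average_self_adjoint[symmetric] continuous_on_iter)
  then show ?case using Suc[of "Suc m"] by simp
qed (simp add: iter_0)

lemma integral_iter_square_decreasing:
  assumes "\<mu> \<in> M" "continuous_on UNIV f"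
  shows "(\<integral>x. iter f (Suc n) x * iter f (Suc n) x \<partial>\<mu>) \<le> (\<integral>x. iter f n x * iter f n x \<partial>\<mu>)"
proof -
  have "0 \<le> (1/2)^Suc 0 / 4 * (\<integral>x. (iter f n (\<phi> (enum 0) x) - iter f n x)^2 \<partial>\<mu>)"
    by simp
  from order_trans[OF this lazy_average_defect[OF assms(1) continuous_on_iter[OF assms(2), of n], of 0]]
  show ?thesis unfolding iter_Suc by linarith
qed

text \<open>If \<open>\<mu>\<close> is extreme, then the weak limit \<open>L\<close> of \<open>iter f (2 * n)\<close> with respect to \<open>\<mu>\<close> is the
  constant \<open>F\<close>: otherwise the invariant densities proportional to \<open>1/2 + s * L\<close> and
  \<open>1/2 - s * L\<close> decompose \<open>\<mu>\<close>. Self-adjointness turns the weak limit into a strong one.\<close>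

lemma extreme_iter_square_tendsto:
  assumes \<mu>K: "\<mu> \<in> K" and f: "continuous_on UNIV f"
  shows "(\<lambda>n. \<integral>x. iter f n x * iter f n x \<partial>\<mu>) \<longlonglongrightarrow> (\<integral>x. f x \<partial>\<mu>)^2"
proof -
  have \<mu>: "\<mu> \<in> M" using \<mu>K K_subset_M by blast
  interpret \<mu>: prob_space \<mu> using M_borel_prob[OF \<mu>] by (simp add: borel_prob_def)
  define V where "V n = (\<integral>x. iter f n x * iter f n x \<partial>\<mu>)" for n
  define F where "F = (\<integral>x. f x \<partial>\<mu>)"
  have "decseq V"
    unfolding V_def by (intro decseq_SucI integral_iter_square_decreasing \<mu> f)
  moreover have "0 \<le> V n" for n
    unfolding V_def by simp
  ultimately obtain l where l: "V \<longlonglongrightarrow> l"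
    using decseq_convergent[of V 0] by blast
  obtain B where B: "B > 0" "\<And>x. \<bar>f x\<bar> \<le> B"
    using continuous_bounded_on_compact[OF compact_UNIV f] by metis
  \<comment> \<open>Even iterates are taken so that the inner product of \<open>w n\<close> and
    \<open>w m\<close> has the even total index \<open>2 * (n + m)\<close> and is therefore the
    squared norm \<open>V (n + m)\<close>.\<close>
  define w where "w n = iter f (2 * n)" for n
  have wc: "continuous_on UNIV (w n)" for n
    unfolding w_def by (rule continuous_on_iter[OF f])
  have wB: "\<bar>w n x\<bar> \<le> B" for n x
    unfolding w_def by (rule abs_iter_le[OF f B(2)])
  have ww: "(\<integral>x. w n x * w m x \<partial>\<mu>) = V (n + m)" for n m
    unfolding w_def V_def integral_iter_mult_iter[OF \<mu> f]
    by (rule arg_cong[of _ _ "\<lambda>k. \<integral>x. iter f k x * f x \<partial>\<mu>"]) simp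
  have int: "integrable \<mu> (\<lambda>x. w n x * h x)" if "continuous_on UNIV h" for n h
    by (intro M_integrable \<mu> continuous_on_mult wc that)
  have wdiff: "(\<integral>x. (w n x - w m x) * (w n x - w m x) \<partial>\<mu>) = V (n + n) - 2 * V (n + m) + V (m + m)" for n m
  proof -
    have "(\<integral>x. (w n x - w m x) * (w n x - w m x) \<partial>\<mu>)
        = (\<integral>x. w n x * w n x - 2 * (w n x * w m x) + w m x * w m x \<partial>\<mu>)"
      by (rule Bochner_Integration.integral_cong) (auto simp: algebra_simps)
    also have "\<dots> = V (n + n) - 2 * V (n + m) + V (m + m)"
      using int[OF wc] by (simp add: ww)
    finally show ?thesis .
  qed
  define X where "X h n = (\<integral>x. w n x * h x \<partial>\<mu>)" for h :: "'a \<Rightarrow> real" and n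
  \<comment> \<open>By \<open>wdiff\<close> the squared distances of the \<open>w n\<close> are
    combinations of late values of the convergent \<open>V\<close> with coefficients summing to
    \<open>0\<close>. So \<open>w\<close> is Cauchy in mean square, and pairing with a bounded
    \<open>h\<close> preserves this.\<close>
  have "Cauchy (X h)" if h: "continuous_on UNIV h" for h
  proof (rule CauchyI)
    fix e :: real assume e: "0 < e"
    obtain H where H: "H > 0" "\<And>x. \<bar>h x\<bar> \<le> H"
      using continuous_bounded_on_compact[OF compact_UNIV h] by metis
    define d where "d = (e / (2 * H))^2"
    have "d > 0" using e H by (simp add: d_def)
    then obtain N where N: "\<And>n. n \<ge> N \<Longrightarrow> \<bar>V n - l\<bar> < d / 4"
      using LIMSEQ_D[OF l, of "d / 4"] by auto
    have "norm (X h m - X h n) < e" if "m \<ge> N" "n \<ge> N" for m n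
    proof -
      have "V (m + m) - 2 * V (m + n) + V (n + n) \<le> d"
      proof -
        have "a - 2 * b + c \<le> d" if "\<bar>a - l\<bar> < d / 4" "\<bar>b - l\<bar> < d / 4" "\<bar>c - l\<bar> < d / 4" for a b c
          using that by (simp add: abs_real_def split: if_splits)
        then show ?thesis using N that by simp
      qed
      then have "sqrt (\<integral>x. (w m x - w n x) * (w m x - w n x) \<partial>\<mu>) \<le> sqrt d"
        unfolding wdiff by simp
      also have "sqrt d = e / (2 * H)"
        unfolding d_def using e H(1) by (intro real_sqrt_unique) auto
      finally have "H * sqrt (\<integral>x. (w m x - w n x) * (w m x - w n x) \<partial>\<mu>) \<le> H * (e / (2 * H))"
        using H(1) by (intro mult_left_mono) auto
      also have "\<dots> = e / 2" using H(1) by simp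
      finally have "\<bar>\<integral>x. (w m x - w n x) * h x \<partial>\<mu>\<bar> \<le> e / 2"
        using M_abs_integral_mult_le[OF \<mu> continuous_on_diff[OF wc wc] h H(2), of m n] by linarith
      moreover have "(\<integral>x. (w m x - w n x) * h x \<partial>\<mu>) = X h m - X h n"
        using int[OF h] by (simp add: X_def left_diff_distrib)
      ultimately show ?thesis using e by simp
    qed
    then show "\<exists>N. \<forall>m\<ge>N. \<forall>n\<ge>N. norm (X h m - X h n) < e" by blast
  qed
  then have conv: "\<exists>y. X h \<longlonglongrightarrow> y" if "continuous_on UNIV h" for h
    using that Cauchy_convergent convergent_def by blast
  \<comment> \<open>The \<open>L^2\<close> limit of \<open>w\<close> is represented by its integrals
    against continuous functions, so no limit function has to be constructed.\<close>
  define L where "L h = lim (X h)" for h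
  have L: "X h \<longlonglongrightarrow> L h" if "continuous_on UNIV h" for h
    unfolding L_def using conv[OF that] by (simp add: convergent_LIMSEQ_iff[symmetric] convergent_def)
  have L_add: "L (\<lambda>x. h x + k x) = L h + L k" if "continuous_on UNIV h" "continuous_on UNIV k" for h k
  proof (rule LIMSEQ_unique[OF L])
    have "X (\<lambda>x. h x + k x) = (\<lambda>n. X h n + X k n)"
      using int that by (auto simp: X_def distrib_left)
    then show "X (\<lambda>x. h x + k x) \<longlonglongrightarrow> L h + L k"
      using tendsto_add[OF L L] that by simp
  qed (rule continuous_on_add[OF that])
  have L_scale: "L (\<lambda>x. c * h x) = c * L h" if "continuous_on UNIV h" for c h
  proof (rule LIMSEQ_unique[OF L])
    have "X (\<lambda>x. c * h x) = (\<lambda>n. c * X h n)"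
      by (auto simp: X_def mult.left_commute)
    then show "X (\<lambda>x. c * h x) \<longlonglongrightarrow> c * L h"
      using tendsto_mult_left[OF L] that by simp
  qed (rule continuous_on_mult_left[OF that])
  have L_one: "L (\<lambda>_. 1) = F"
  proof (rule LIMSEQ_unique[OF L])
    have "X (\<lambda>_. 1) = (\<lambda>_. F)"
      by (rule ext) (simp add: X_def w_def F_def integral_iter[OF \<mu> f])
    then show "X (\<lambda>_. 1) \<longlonglongrightarrow> F" by simp
  qed simp
  have L_f: "L f = l"
  proof (rule LIMSEQ_unique[OF L[OF f]])
    have "X f = V"
      by (rule ext) (simp add: X_def w_def V_def mult_2 integral_iter_mult_iter[OF \<mu> f])
    then show "X f \<longlonglongrightarrow> l" using l by simp
  qed
  have L_inv: "L (\<lambda>x. h (\<phi> g x)) = L h" if h: "continuous_on UNIV h" and g: "g \<in> carrier G" for h g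
  proof -
    obtain k where k: "inv\<^bsub>G\<^esub> g = enum k"
      using enum_surj group.inv_closed[OF group g] by blast
    define c where "c = (1/2 :: real)^Suc k / 4"
    have c: "c > 0" by (simp add: c_def)
    obtain H where H: "H > 0" "\<And>x. \<bar>h x\<bar> \<le> H"
      using continuous_bounded_on_compact[OF compact_UNIV h] by metis
    \<comment> \<open>The defect estimate bounds the mean square of this increment by
      \<open>V (2 * n) - V (Suc (2 * n))\<close> up to the factor \<open>1 / c\<close>, and that
      difference of consecutive values tends to \<open>0\<close>.\<close>
    define d where "d n x = w n (\<phi> (enum k) x) - w n x" for n x
    have dc: "continuous_on UNIV (d n)" for n
      unfolding d_def using wc enum_in_carrier
      by (intro continuous_on_diff continuous_on_compose_action) auto
    have dV: "(\<integral>x. d n x * d n x \<partial>\<mu>) \<le> (V (2 * n) - V (Suc (2 * n))) / c" for n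
    proof -
      have "c * (\<integral>x. d n x * d n x \<partial>\<mu>) \<le> V (2 * n) - V (Suc (2 * n))"
        using lazy_average_defect[OF \<mu> wc[of n], of k]
        unfolding c_def[symmetric] V_def iter_Suc w_def d_def power2_eq_square .
      then show ?thesis using c by (simp add: field_simps)
    qed
    have le: "norm (X (\<lambda>x. h (\<phi> g x)) n - X h n) \<le> H * sqrt ((V (2 * n) - V (Suc (2 * n))) / c)" for n
    proof -
      have "X (\<lambda>x. h (\<phi> g x)) n = (\<integral>x. w n (\<phi> (enum k) x) * h x \<partial>\<mu>)"
        using M_integral_translate_mult[OF \<mu> h wc g] k by (simp add: X_def mult.commute)
      moreover have "integrable \<mu> (\<lambda>x. w n (\<phi> (enum k) x) * h x)"
        by (intro M_integrable \<mu> continuous_on_mult continuous_on_compose_action wc h enum_in_carrier)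
      ultimately have "X (\<lambda>x. h (\<phi> g x)) n - X h n = (\<integral>x. d n x * h x \<partial>\<mu>)"
        using int[OF h] by (simp add: X_def d_def left_diff_distrib)
      then have "norm (X (\<lambda>x. h (\<phi> g x)) n - X h n) \<le> H * sqrt (\<integral>x. d n x * d n x \<partial>\<mu>)"
        using M_abs_integral_mult_le[OF \<mu> dc h H(2)] by simp
      also have "\<dots> \<le> H * sqrt ((V (2 * n) - V (Suc (2 * n))) / c)"
        using H(1) dV by (intro mult_left_mono real_sqrt_le_mono) auto
      finally show ?thesis .
    qed
    have lim2: "(\<lambda>n. V (2 * n)) \<longlonglongrightarrow> l" "(\<lambda>n. V (Suc (2 * n))) \<longlonglongrightarrow> l"
      using LIMSEQ_subseq_LIMSEQ[OF l, of "\<lambda>n. 2 * n"] LIMSEQ_subseq_LIMSEQ[OF l, of "\<lambda>n. Suc (2 * n)"]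
      by (simp_all add: strict_mono_def o_def)
    have "(\<lambda>n. H * sqrt ((V (2 * n) - V (Suc (2 * n))) / c)) \<longlonglongrightarrow> H * sqrt ((l - l) / c)"
      by (intro tendsto_mult tendsto_const tendsto_real_sqrt tendsto_divide tendsto_diff lim2) (use c in auto)
    then have "(\<lambda>n. H * sqrt ((V (2 * n) - V (Suc (2 * n))) / c)) \<longlonglongrightarrow> 0" by simp
    from Lim_null_comparison[OF _ this, of "\<lambda>n. X (\<lambda>x. h (\<phi> g x)) n - X h n"] le
    have "(\<lambda>n. X (\<lambda>x. h (\<phi> g x)) n - X h n) \<longlonglongrightarrow> 0" by simp
    moreover have "(\<lambda>n. X (\<lambda>x. h (\<phi> g x)) n - X h n) \<longlonglongrightarrow> L (\<lambda>x. h (\<phi> g x)) - L h"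
      by (intro tendsto_diff L h continuous_on_compose_action g)
    ultimately show ?thesis using LIMSEQ_unique by fastforce
  qed
  have FB: "\<bar>F\<bar> \<le> B"
  proof -
    have "\<bar>F\<bar> \<le> (\<integral>x. \<bar>f x\<bar> \<partial>\<mu>)" unfolding F_def by (rule integral_abs_bound)
    also have "\<dots> \<le> (\<integral>x. B \<partial>\<mu>)"
      by (intro integral_mono M_integrable \<mu> continuous_on_rabs f) (use B in auto)
    finally show ?thesis using \<mu>.prob_space by simp
  qed
  have denom: "1/2 + \<sigma> * F > 0" if "\<bar>\<sigma>\<bar> * B \<le> 1/4" for \<sigma>
  proof -
    have "\<bar>\<sigma> * F\<bar> \<le> \<bar>\<sigma>\<bar> * B"
      unfolding abs_mult using FB by (intro mult_left_mono) auto
    then have "\<bar>\<sigma> * F\<bar> \<le> 1/4" using that by linarith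
    then show ?thesis by (simp add: abs_le_iff)
  qed
  \<comment> \<open>The functional with density \<open>1/2\<close> plus \<open>\<sigma>\<close>
    times the limit of \<open>w\<close>, relative to \<open>\<mu>\<close>. By \<open>L_one\<close>
    its total mass before normalization is \<open>1/2 + \<sigma> * F\<close>.\<close>
  define J where "J \<sigma> h = (1 / (1/2 + \<sigma> * F)) * (1/2 * (\<integral>x. h x \<partial>\<mu>) + \<sigma> * L h)" for \<sigma> :: real and h :: "'a \<Rightarrow> real"
  have J: "\<exists>\<nu>\<in>M. \<forall>h. continuous_on UNIV h \<longrightarrow> integral\<^sup>L \<nu> h = J \<sigma> h" if \<sigma>: "\<bar>\<sigma>\<bar> * B \<le> 1/4" for \<sigma>
  proof -
    note den = denom[OF \<sigma>]
    interpret normalized_positive_functional "J \<sigma>"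
    proof
      show "J \<sigma> (\<lambda>x. h x + k x) = J \<sigma> h + J \<sigma> k" if "continuous_on UNIV h" "continuous_on UNIV k" for h k
        using M_integrable[OF \<mu>] that by (simp add: J_def L_add algebra_simps)
      show "J \<sigma> (\<lambda>x. c * h x) = c * J \<sigma> h" if "continuous_on UNIV h" for h c
        using that by (simp add: J_def L_scale algebra_simps)
      show "J \<sigma> (\<lambda>_. 1) = 1"
        using den \<mu>.prob_space by (simp add: J_def L_one)
      show "0 \<le> J \<sigma> h" if h: "continuous_on UNIV h" and pos: "\<And>x. 0 \<le> h x" for h
      proof -
        have "0 \<le> 1/2 * (\<integral>x. h x \<partial>\<mu>) + \<sigma> * X h n" for n
        proof -
          have "\<bar>\<sigma> * w n x\<bar> \<le> \<bar>\<sigma>\<bar> * B" for x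
            unfolding abs_mult using wB by (intro mult_left_mono) auto
          then have "\<bar>\<sigma> * w n x\<bar> \<le> 1/4" for x using \<sigma> order_trans by blast
          then have "0 \<le> 1/2 + \<sigma> * w n x" for x
            using abs_le_D2[of "\<sigma> * w n x" "1/4"] by fastforce
          then have "0 \<le> (\<integral>x. (1/2 + \<sigma> * w n x) * h x \<partial>\<mu>)"
            using pos by (intro Bochner_Integration.integral_nonneg) auto
          also have "\<dots> = 1/2 * (\<integral>x. h x \<partial>\<mu>) + \<sigma> * X h n"
            using int[OF h] M_integrable[OF \<mu> h] by (simp add: X_def distrib_right mult.assoc)
          finally show ?thesis .
        qed
        moreover have "(\<lambda>n. 1/2 * (\<integral>x. h x \<partial>\<mu>) + \<sigma> * X h n) \<longlonglongrightarrow> 1/2 * (\<integral>x. h x \<partial>\<mu>) + \<sigma> * L h"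
          by (intro tendsto_add tendsto_const tendsto_mult L h)
        ultimately have "0 \<le> 1/2 * (\<integral>x. h x \<partial>\<mu>) + \<sigma> * L h"
          using LIMSEQ_le_const by blast
        then show ?thesis unfolding J_def using den by (intro mult_nonneg_nonneg) auto
      qed
    qed (rule compact_UNIV)
    have "riesz_measure \<in> M"
    proof (rule M_I[OF borel_prob_riesz_measure])
      fix g and h :: "'a \<Rightarrow> real" assume gh: "g \<in> carrier G" "continuous_on UNIV h"
      then have "J \<sigma> (\<lambda>x. h (\<phi> g x)) = J \<sigma> h"
        by (simp add: J_def L_inv M_integral_action[OF \<mu>])
      then show "(\<integral>x. h (\<phi> g x) \<partial>riesz_measure) = (\<integral>x. h x \<partial>riesz_measure)"
        using integral_riesz_measure[OF continuous_on_compose_action, of g h] integral_riesz_measure[of h] gh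
        by simp
    qed
    then show ?thesis using integral_riesz_measure by blast
  qed
  \<comment> \<open>Since \<open>w n\<close> is bounded by \<open>B\<close>, this size keeps
    \<open>s * w n\<close> between \<open>-1/4\<close> and \<open>1/4\<close>, so both densities
    stay positive.\<close>
  define s where "s = 1 / (4 * B)"
  have s: "s > 0" "\<bar>s\<bar> * B \<le> 1/4" "\<bar>-s\<bar> * B \<le> 1/4" using B(1) by (simp_all add: s_def)
  obtain \<nu>1 where \<nu>1: "\<nu>1 \<in> M" "\<And>h. continuous_on UNIV h \<Longrightarrow> integral\<^sup>L \<nu>1 h = J s h"
    using J[OF s(2)] by blast
  obtain \<nu>2 where \<nu>2: "\<nu>2 \<in> M" "\<And>h. continuous_on UNIV h \<Longrightarrow> integral\<^sup>L \<nu>2 h = J (-s) h"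
    using J[OF s(3)] by blast
  \<comment> \<open>\<open>1 - t\<close> and \<open>t\<close> are the masses of the two unnormalized
    pieces. With these weights the normalizations cancel and so do the two \<open>L\<close> terms,
    leaving \<open>\<mu>\<close>.\<close>
  define t where "t = 1/2 - s * F"
  have t: "0 < t" "t < 1" using denom[OF s(2)] denom[OF s(3)] by (simp_all add: t_def)
  have t1: "1 - t = 1/2 + s * F" by (simp add: t_def)
  have comb: "integral\<^sup>L \<mu> h = (1 - t) * integral\<^sup>L \<nu>1 h + t * integral\<^sup>L \<nu>2 h" if "continuous_on UNIV h" for h
  proof -
    have "(1 - t) * J s h = 1/2 * (\<integral>x. h x \<partial>\<mu>) + s * L h"
      unfolding J_def t1[symmetric] using t by simp
    moreover have "t * J (-s) h = 1/2 * (\<integral>x. h x \<partial>\<mu>) - s * L h"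
      unfolding J_def using t by (simp add: t_def)
    ultimately show ?thesis using \<nu>1(2)[OF that] \<nu>2(2)[OF that] by simp
  qed
  have "measure \<mu> A = (1 - t) * measure \<nu>1 A + t * measure \<nu>2 A" if "A \<in> sets borel" for A
    using comb that \<nu>1(1) \<nu>2(1) \<mu>
    by (intro measure_combination_of_integral_combination M_borel_prob) auto
  then have "\<nu>1 = \<nu>2"
    using \<mu>K \<nu>1(1) \<nu>2(1) t unfolding extreme_boundary_def extreme_measures_def by blast
  \<comment> \<open>The equal pieces are tested on \<open>f\<close> itself, because there
    \<open>L f\<close> is the limit \<open>l\<close> of the squared norms and the equation can only
    hold if \<open>l\<close> is the square of \<open>F\<close>.\<close>
  then have "J s f = J (-s) f" using \<nu>1(2)[OF f] \<nu>2(2)[OF f] by simp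
  then have "(1/2 * F + s * l) * (1/2 - s * F) = (1/2 * F - s * l) * (1/2 + s * F)"
    using denom[OF s(2)] denom[OF s(3)] unfolding J_def L_f F_def[symmetric] by (simp add: field_simps)
  then have "s * (l - F^2) = 0" by (simp add: algebra_simps power2_eq_square)
  then have "l = F^2" using s(1) by simp
  then show ?thesis using l unfolding V_def F_def by simp
qed

lemma compactin_K:
  assumes "bauer_invariant_measures G \<phi>"
  shows "compactin (weak_star_topology M) K"
  using assms compact_space_M closedin_compact_space unfolding bauer_invariant_measures_def by blast

text \<open>Dini's theorem makes the mean ergodic convergence uniform over \<open>K\<close>.\<close>

lemma uniform_constant_approximation:
  fixes f :: "'a \<Rightarrow> real"
  assumes bauer: "bauer_invariant_measures G \<phi>" and f: "continuous_on UNIV f" and e: "0 < e"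
  shows "\<exists>\<Theta>. continuous_on UNIV \<Theta> \<and> (\<forall>\<mu>\<in>K. (\<integral>x. \<bar>\<Theta> x - (\<integral>y. f y \<partial>\<mu>)\<bar> \<partial>\<mu>) \<le> e)"
proof -
  let ?W = "weak_star_topology M"
  define V where "V n \<mu> = (\<integral>x. iter f n x * iter f n x \<partial>\<mu>) - (\<integral>x. f x \<partial>\<mu>)^2" for n and \<mu> :: "'a measure"
  define O' where "O' n = {\<mu> \<in> topspace ?W. V n \<mu> \<in> {..<e^2}}" for n
  have "continuous_map ?W euclideanreal (V n)" for n
    unfolding V_def
    by (intro continuous_map_diff continuous_map_real_pow continuous_map_weak_star_integral
        continuous_on_mult continuous_on_iter f)
  then have op: "openin ?W (O' n)" for n
    unfolding O'_def by (rule openin_continuous_map_preimage) auto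
  have "K \<subseteq> \<Union>(range O')"
  proof
    fix \<mu> assume \<mu>: "\<mu> \<in> K"
    have "(\<lambda>n. V n \<mu>) \<longlonglongrightarrow> (\<integral>x. f x \<partial>\<mu>)^2 - (\<integral>x. f x \<partial>\<mu>)^2"
      unfolding V_def by (intro tendsto_diff tendsto_const extreme_iter_square_tendsto \<mu> f)
    then have "\<forall>\<^sub>F n in sequentially. V n \<mu> < e^2"
      using e by (intro order_tendstoD(2)) auto
    then obtain n where "V n \<mu> < e^2"
      using eventually_happens'[OF sequentially_bot] by blast
    then have "\<mu> \<in> O' n" using \<mu> K_subset_M by (auto simp: O'_def topspace_weak_star)
    then show "\<mu> \<in> \<Union>(range O')" by blast
  qed
  then obtain \<F> where fin: "finite \<F>" and sub: "\<F> \<subseteq> range O'" and cov: "K \<subseteq> \<Union>\<F>"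
    using compactinD[OF compactin_K[OF bauer], of "range O'"] op by auto
  obtain S where S: "finite S" "\<F> = O' ` S"
    using fin sub finite_subset_image by metis
  \<comment> \<open>The excess \<open>V n \<mu>\<close> decreases in \<open>n\<close>, so the
    largest index of the finite subcover serves every measure in \<open>K\<close>;
    \<open>insert 0\<close> covers an empty \<open>S\<close>.\<close>
  define N where "N = Max (insert 0 S)"
  have Vle: "V N \<mu> < e^2" if \<mu>: "\<mu> \<in> K" for \<mu>
  proof -
    obtain n where n: "n \<in> S" "\<mu> \<in> O' n" using cov S(2) \<mu> by auto
    have "decseq (\<lambda>n. V n \<mu>)"
      using \<mu> K_subset_M unfolding V_def
      by (intro decseq_SucI diff_right_mono integral_iter_square_decreasing f) auto
    moreover have "n \<le> N" using n(1) S(1) by (simp add: N_def)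
    ultimately have "V N \<mu> \<le> V n \<mu>" by (simp add: decseq_def)
    then show ?thesis using n(2) by (simp add: O'_def)
  qed
  have "(\<integral>x. \<bar>iter f N x - (\<integral>y. f y \<partial>\<mu>)\<bar> \<partial>\<mu>) \<le> e" if \<mu>K: "\<mu> \<in> K" for \<mu>
  proof -
    have \<mu>: "\<mu> \<in> M" using \<mu>K K_subset_M by blast
    interpret prob_space \<mu> using M_borel_prob[OF \<mu>] by (simp add: borel_prob_def)
    define F where "F = (\<integral>y. f y \<partial>\<mu>)"
    have int: "integrable \<mu> (\<lambda>x. iter f N x * iter f N x)" "integrable \<mu> (iter f N)"
      by (intro M_integrable \<mu> continuous_on_mult continuous_on_iter f)+
    have "(\<integral>x. (iter f N x - F) * (iter f N x - F) \<partial>\<mu>)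
        = (\<integral>x. iter f N x * iter f N x - 2 * F * iter f N x + F * F \<partial>\<mu>)"
      by (rule Bochner_Integration.integral_cong) (auto simp: algebra_simps)
    also have "\<dots> = (\<integral>x. iter f N x * iter f N x \<partial>\<mu>) - 2 * F * F + F * F"
      using int integral_iter[OF \<mu> f] prob_space by (simp add: F_def)
    also have "\<dots> = V N \<mu>" by (simp add: V_def F_def power2_eq_square)
    finally have "(\<integral>x. (iter f N x - F) * (iter f N x - F) \<partial>\<mu>) \<le> e^2"
      using Vle[OF \<mu>K] by simp
    then have "sqrt (\<integral>x. (iter f N x - F) * (iter f N x - F) \<partial>\<mu>) \<le> e"
      using e by (intro real_le_lsqrt) auto
    moreover have "continuous_on UNIV (\<lambda>x. iter f N x - F)"
      by (intro continuous_on_diff continuous_on_iter f continuous_on_const)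
    ultimately show ?thesis
      using M_integral_abs_le_sqrt[OF \<mu>, of "\<lambda>x. iter f N x - F"] by (simp add: F_def)
  qed
  then show ?thesis using continuous_on_iter[OF f] by blast
qed


section \<open>Lifting functions from the extreme boundary to the space\<close>

text \<open>On an ergodic measure \<open>\<mu>\<close> the ideal lift is the constant
  \<open>\<theta> \<mu>\<close>. A single continuous function has to serve all of \<open>K\<close>,
  so the lift is asked for in mean, and it may change with the accuracy
  \<open>\<eta>\<close>.\<close>

definition liftable :: "('a measure \<Rightarrow> real) \<Rightarrow> bool" where
  "liftable \<theta> \<longleftrightarrow> (\<forall>\<eta>>0. \<exists>\<Theta>. continuous_on UNIV \<Theta> \<and>
     (\<forall>\<mu>\<in>K. (\<integral>x. \<bar>\<Theta> x - \<theta> \<mu>\<bar> \<partial>\<mu>) \<le> \<eta>))"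

lemma liftableD:
  assumes "liftable \<theta>" "\<eta> > 0"
  obtains \<Theta> where "continuous_on UNIV \<Theta>" "\<And>\<mu>. \<mu> \<in> K \<Longrightarrow> (\<integral>x. \<bar>\<Theta> x - \<theta> \<mu>\<bar> \<partial>\<mu>) \<le> \<eta>"
  using assms unfolding liftable_def by blast

lemma liftable_integral:
  assumes "bauer_invariant_measures G \<phi>" "continuous_on UNIV f"
  shows "liftable (\<lambda>\<mu>. integral\<^sup>L \<mu> f)"
  unfolding liftable_def using uniform_constant_approximation[OF assms] by simp

lemma liftable_const: "liftable (\<lambda>_. c)"
  unfolding liftable_def by (intro allI impI exI[of _ "\<lambda>_. c"]) simp

lemma liftable_combine:
  fixes p :: "real \<Rightarrow> real \<Rightarrow> real"
  assumes lift: "liftable \<theta>\<^sub>1" "liftable \<theta>\<^sub>2"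
    and cont: "continuous_on UNIV (\<lambda>(a, b). p a b)"
    and lip: "C > 0" "\<And>a b c d. \<bar>p a b - p c d\<bar> \<le> C * (\<bar>a - c\<bar> + \<bar>b - d\<bar>)"
  shows "liftable (\<lambda>\<mu>. p (\<theta>\<^sub>1 \<mu>) (\<theta>\<^sub>2 \<mu>))"
  unfolding liftable_def
proof (intro allI impI)
  fix \<eta> :: real assume \<eta>: "\<eta> > 0"
  define d where "d = \<eta> / (2 * C)"
  have d: "d > 0" using \<eta> lip(1) by (simp add: d_def)
  obtain \<Theta>1 where \<Theta>1: "continuous_on UNIV \<Theta>1" "\<And>\<mu>. \<mu> \<in> K \<Longrightarrow> (\<integral>x. \<bar>\<Theta>1 x - \<theta>\<^sub>1 \<mu>\<bar> \<partial>\<mu>) \<le> d"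
    using liftableD[OF lift(1) d] by blast
  obtain \<Theta>2 where \<Theta>2: "continuous_on UNIV \<Theta>2" "\<And>\<mu>. \<mu> \<in> K \<Longrightarrow> (\<integral>x. \<bar>\<Theta>2 x - \<theta>\<^sub>2 \<mu>\<bar> \<partial>\<mu>) \<le> d"
    using liftableD[OF lift(2) d] by blast
  have c: "continuous_on UNIV (\<lambda>x. p (\<Theta>1 x) (\<Theta>2 x))"
    using continuous_on_compose2[OF cont continuous_on_Pair[OF \<Theta>1(1) \<Theta>2(1)]] by simp
  have "(\<integral>x. \<bar>p (\<Theta>1 x) (\<Theta>2 x) - p (\<theta>\<^sub>1 \<mu>) (\<theta>\<^sub>2 \<mu>)\<bar> \<partial>\<mu>) \<le> \<eta>" if \<mu>K: "\<mu> \<in> K" for \<mu>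
  proof -
    have \<mu>: "\<mu> \<in> M" using \<mu>K K_subset_M by blast
    have int: "integrable \<mu> (\<lambda>x. \<bar>\<Theta>1 x - \<theta>\<^sub>1 \<mu>\<bar>)" "integrable \<mu> (\<lambda>x. \<bar>\<Theta>2 x - \<theta>\<^sub>2 \<mu>\<bar>)"
      "integrable \<mu> (\<lambda>x. \<bar>p (\<Theta>1 x) (\<Theta>2 x) - p (\<theta>\<^sub>1 \<mu>) (\<theta>\<^sub>2 \<mu>)\<bar>)"
      by (intro M_integrable \<mu> continuous_on_rabs continuous_on_diff continuous_on_const \<Theta>1 \<Theta>2 c)+
    have "(\<integral>x. \<bar>p (\<Theta>1 x) (\<Theta>2 x) - p (\<theta>\<^sub>1 \<mu>) (\<theta>\<^sub>2 \<mu>)\<bar> \<partial>\<mu>)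
        \<le> (\<integral>x. C * (\<bar>\<Theta>1 x - \<theta>\<^sub>1 \<mu>\<bar> + \<bar>\<Theta>2 x - \<theta>\<^sub>2 \<mu>\<bar>) \<partial>\<mu>)"
      by (intro integral_mono lip(2) integrable_mult_right Bochner_Integration.integrable_add int)
    also have "\<dots> = C * ((\<integral>x. \<bar>\<Theta>1 x - \<theta>\<^sub>1 \<mu>\<bar> \<partial>\<mu>) + (\<integral>x. \<bar>\<Theta>2 x - \<theta>\<^sub>2 \<mu>\<bar> \<partial>\<mu>))"
      using int by simp
    also have "\<dots> \<le> C * (d + d)"
      using \<Theta>1(2)[OF \<mu>K] \<Theta>2(2)[OF \<mu>K] lip(1) by (intro mult_left_mono add_mono) auto
    also have "\<dots> = \<eta>" using lip(1) by (simp add: d_def)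
    finally show ?thesis .
  qed
  then show "\<exists>\<Theta>. continuous_on UNIV \<Theta> \<and> (\<forall>\<mu>\<in>K. (\<integral>x. \<bar>\<Theta> x - p (\<theta>\<^sub>1 \<mu>) (\<theta>\<^sub>2 \<mu>)\<bar> \<partial>\<mu>) \<le> \<eta>)"
    using c by blast
qed

lemma liftable_max:
  assumes "liftable \<theta>\<^sub>1" "liftable \<theta>\<^sub>2"
  shows "liftable (\<lambda>\<mu>. max (\<theta>\<^sub>1 \<mu>) (\<theta>\<^sub>2 \<mu>))"
proof (rule liftable_combine[OF assms, of max 1])
  show "continuous_on UNIV (\<lambda>(a, b). max a b :: real)"
    unfolding case_prod_beta by (intro continuous_on_max continuous_on_fst continuous_on_snd continuous_on_id)
qed (auto simp: max_def)

lemma liftable_affine: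
  assumes "liftable \<theta>"
  shows "liftable (\<lambda>\<mu>. r * \<theta> \<mu> + s)"
proof (rule liftable_combine[OF assms assms, of "\<lambda>a _. r * a + s" "\<bar>r\<bar> + 1"])
  show "continuous_on UNIV (\<lambda>(a, b). r * a + s :: real)"
    unfolding case_prod_beta
    by (intro continuous_on_add continuous_on_mult continuous_on_const continuous_on_fst continuous_on_id)
  show "\<bar>(r * a + s) - (r * c + s)\<bar> \<le> (\<bar>r\<bar> + 1) * (\<bar>a - c\<bar> + \<bar>b - d\<bar>)" for a b c d
  proof -
    have "\<bar>(r * a + s) - (r * c + s)\<bar> = \<bar>r\<bar> * \<bar>a - c\<bar>"
      by (simp add: abs_mult[symmetric] right_diff_distrib)
    also have "\<dots> \<le> (\<bar>r\<bar> + 1) * (\<bar>a - c\<bar> + \<bar>b - d\<bar>)"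
      by (intro mult_mono) auto
    finally show ?thesis .
  qed
qed simp

lemma liftable_abs:
  assumes "liftable \<theta>"
  shows "liftable (\<lambda>\<mu>. \<bar>\<theta> \<mu>\<bar>)"
proof -
  have "\<bar>a\<bar> = max a (-1 * a + 0)" for a :: real by simp
  then show ?thesis
    using liftable_max[OF assms liftable_affine[OF assms, of "-1" 0]] by presburger
qed

lemma liftable_finite_max:
  assumes "finite I" "\<And>i. i \<in> I \<Longrightarrow> liftable (\<theta> i)"
  shows "\<exists>m. liftable m \<and> (\<forall>\<mu>. 0 \<le> m \<mu> \<and> (\<forall>i\<in>I. \<theta> i \<mu> \<le> m \<mu>) \<and>
     (m \<mu> = 0 \<or> (\<exists>i\<in>I. m \<mu> = \<theta> i \<mu>)))"
  using assms
proof (induction rule: finite_induct)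
  case empty
  then show ?case using liftable_const[of 0] by auto
next
  case (insert i I)
  then obtain m where m: "liftable m" "\<And>\<mu>. 0 \<le> m \<mu>" "\<And>\<mu> i. i \<in> I \<Longrightarrow> \<theta> i \<mu> \<le> m \<mu>"
    "\<And>\<mu>. m \<mu> = 0 \<or> (\<exists>i\<in>I. m \<mu> = \<theta> i \<mu>)"
    by auto
  show ?case
  proof (intro exI[of _ "\<lambda>\<mu>. max (\<theta> i \<mu>) (m \<mu>)"] conjI allI)
    show "liftable (\<lambda>\<mu>. max (\<theta> i \<mu>) (m \<mu>))"
      using insert.prems by (intro liftable_max m) auto
    fix \<mu>
    show "0 \<le> max (\<theta> i \<mu>) (m \<mu>)" using m(2)[of \<mu>] by simp
    show "\<forall>j\<in>insert i I. \<theta> j \<mu> \<le> max (\<theta> i \<mu>) (m \<mu>)"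
      using m(3) by (simp add: le_max_iff_disj)
    show "max (\<theta> i \<mu>) (m \<mu>) = 0 \<or> (\<exists>j\<in>insert i I. max (\<theta> i \<mu>) (m \<mu>) = \<theta> j \<mu>)"
      using m(4)[of \<mu>] by (auto simp: max_def)
  qed
qed

lemma liftable_min:
  assumes "liftable \<theta>\<^sub>1" "liftable \<theta>\<^sub>2"
  shows "liftable (\<lambda>\<mu>. min (\<theta>\<^sub>1 \<mu>) (\<theta>\<^sub>2 \<mu>))"
proof (rule liftable_combine[OF assms, of min 1])
  show "continuous_on UNIV (\<lambda>(a, b). min a b :: real)"
    unfolding case_prod_beta by (intro continuous_on_min continuous_on_fst continuous_on_snd continuous_on_id)
qed (auto simp: min_def)

text \<open>A basic weak-star neighbourhood constrains finitely many integrals. Each constraint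
  yields a tent in that integral, and the minimum of the tents is the bump. It lifts because
  integrals do and because lattice and affine operations preserve liftability.\<close>

lemma liftable_bump:
  assumes bauer: "bauer_invariant_measures G \<phi>"
    and W: "openin (weak_star_topology M) W" and \<mu>: "\<mu> \<in> W"
  shows "\<exists>b. liftable b \<and> continuous_map (weak_star_topology M) euclideanreal b \<and> b \<mu> = 1 \<and>
    (\<forall>\<nu>. 0 \<le> b \<nu>) \<and> (\<forall>\<nu>\<in>M. 0 < b \<nu> \<longrightarrow> \<nu> \<in> W)"
proof -
  let ?W = "weak_star_topology M"
  define C where "C = {f :: 'a \<Rightarrow> real. continuous_on UNIV f}"
  define e where "e \<mu> = (\<lambda>f\<in>C. integral\<^sup>L \<mu> f)" for \<mu> :: "'a measure"
  obtain S where S: "openin (product_topology (\<lambda>_. euclideanreal) C) S" "W = e -` S \<inter> M"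
    using W unfolding weak_star_topology_def openin_pullback_topology e_def C_def by blast
  have "e \<mu> \<in> S" using \<mu> S(2) by auto
  then obtain U where U: "finite {f \<in> C. U f \<noteq> UNIV}" "\<And>f. f \<in> C \<Longrightarrow> open (U f)"
    "e \<mu> \<in> Pi\<^sub>E C U" "Pi\<^sub>E C U \<subseteq> S"
    using S(1) unfolding openin_product_topology_alt by (auto simp: open_openin[symmetric])
  define F where "F = {f \<in> C. U f \<noteq> UNIV}"
  have "\<exists>d>0. ball (integral\<^sup>L \<mu> f) d \<subseteq> U f" if "f \<in> C" for f
  proof -
    have "e \<mu> f \<in> U f" using U(3) that by (auto simp: PiE_def)
    then have "integral\<^sup>L \<mu> f \<in> U f" using that by (simp add: e_def)
    then show ?thesis using U(2)[OF that] open_contains_ball by blast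
  qed
  then obtain d where d: "\<And>f. f \<in> C \<Longrightarrow> d f > 0" "\<And>f. f \<in> C \<Longrightarrow> ball (integral\<^sup>L \<mu> f) (d f) \<subseteq> U f"
    by metis
  have bump: "\<exists>b. liftable b \<and> continuous_map ?W euclideanreal b \<and> b \<mu> = 1 \<and>
    (\<forall>\<nu>. 0 \<le> b \<nu>) \<and> (\<forall>\<nu>. 0 < b \<nu> \<longrightarrow> (\<forall>f\<in>F'. \<bar>integral\<^sup>L \<nu> f - integral\<^sup>L \<mu> f\<bar> < d f))"
    if "finite F'" "F' \<subseteq> C" for F'
    using that
  proof (induction rule: finite_induct)
    case empty
    show ?case
      by (rule exI[of _ "\<lambda>_. 1"]) (simp add: liftable_const)
  next
    case (insert f F')
    then obtain b where b: "liftable b" "continuous_map ?W euclideanreal b" "b \<mu> = 1" "\<And>\<nu>. 0 \<le> b \<nu>"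
      "\<And>\<nu> f. 0 < b \<nu> \<Longrightarrow> f \<in> F' \<Longrightarrow> \<bar>integral\<^sup>L \<nu> f - integral\<^sup>L \<mu> f\<bar> < d f"
      by auto
    have f: "f \<in> C" "continuous_on UNIV f" using insert.prems by (auto simp: C_def)
    \<comment> \<open>Height \<open>1\<close> at \<open>\<mu>\<close>, zero once the integral is off
      by \<open>d f\<close>. The redundant factor \<open>1\<close> and the added negative present
      the tent as nested affine maps, absolute value and maximum, to match the lifting
      lemmas.\<close>
    define q where "q \<nu> = max 0 ((- 1 / d f) * \<bar>1 * integral\<^sup>L \<nu> f + (- integral\<^sup>L \<mu> f)\<bar> + 1)" for \<nu>
    have "liftable q"
      unfolding q_def
      by (intro liftable_max liftable_affine liftable_abs liftable_integral bauer f liftable_const)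
    moreover have "continuous_map ?W euclideanreal q"
      unfolding q_def
      by (intro continuous_map_real_max continuous_map_add continuous_map_real_abs
          continuous_map_real_mult_left continuous_map_weak_star_integral f continuous_map_const[THEN iffD2]) auto
    moreover have "q \<mu> = 1" by (simp add: q_def)
    moreover have "\<bar>integral\<^sup>L \<nu> f - integral\<^sup>L \<mu> f\<bar> < d f" if "q \<nu> > 0" for \<nu>
      using that d(1)[OF f(1)] by (simp add: q_def max_def field_simps split: if_splits)
    moreover have "0 \<le> q \<nu>" for \<nu> by (simp add: q_def)
    ultimately show ?case
      using b
      by (intro exI[of _ "\<lambda>\<nu>. min (b \<nu>) (q \<nu>)"] conjI liftable_min continuous_map_real_min) auto
  qed
  obtain b where b: "liftable b" "continuous_map ?W euclideanreal b" "b \<mu> = 1" "\<And>\<nu>. 0 \<le> b \<nu>"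
      "\<And>\<nu> f. 0 < b \<nu> \<Longrightarrow> f \<in> F \<Longrightarrow> \<bar>integral\<^sup>L \<nu> f - integral\<^sup>L \<mu> f\<bar> < d f"
    using bump[of F] U(1) unfolding F_def by auto
  have "\<nu> \<in> W" if \<nu>: "\<nu> \<in> M" "0 < b \<nu>" for \<nu>
  proof -
    have "integral\<^sup>L \<nu> f \<in> U f" if f: "f \<in> C" for f
    proof (cases "f \<in> F")
      case True
      then have "integral\<^sup>L \<nu> f \<in> ball (integral\<^sup>L \<mu> f) (d f)"
        using b(5)[OF \<nu>(2)] by (auto simp: dist_real_def abs_minus_commute)
      then show ?thesis using d(2)[OF f] by blast
    next
      case False
      then show ?thesis using f by (simp add: F_def)
    qed
    then have "e \<nu> \<in> Pi\<^sub>E C U" by (simp add: e_def)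
    then show ?thesis using U(4) S(2) \<nu>(1) by blast
  qed
  then show ?thesis using b(1-4) by blast
qed

end


section \<open>Invariant measures of minimal actions have no atoms\<close>

context compact_group_action
begin

text \<open>All points of an orbit have equal mass, so an atom has a finite orbit. That orbit is
  closed and invariant, hence by minimality the whole space, which is infinite.\<close>

lemma M_measure_singleton:
  assumes \<mu>: "\<mu> \<in> M" and minimal: "minimal_action G \<phi>" and inf: "infinite (UNIV :: 'a set)"
  shows "measure \<mu> {x} = 0"
proof (rule ccontr)
  interpret prob_space \<mu> using M_borel_prob[OF \<mu>] by (simp add: borel_prob_def)
  interpret act: group_action G UNIV \<phi>
    using continuous_action by (simp add: continuous_action_def)
  have sets: "sets \<mu> = sets borel" using M_borel_prob[OF \<mu>] by (simp add: borel_prob_def)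
  assume "measure \<mu> {x} \<noteq> 0"
  then have c: "0 < measure \<mu> {x}" using measure_nonneg[of \<mu> "{x}"] by linarith
  define Orb where "Orb = (\<lambda>g. \<phi> g x) ` carrier G"
  have mass: "measure \<mu> {y} = measure \<mu> {x}" if y: "y \<in> Orb" for y
  proof -
    obtain g where g: "g \<in> carrier G" "y = \<phi> g x" using y unfolding Orb_def by blast
    have "measure (distr \<mu> borel (\<phi> g)) {y} = measure \<mu> (\<phi> g -` {y} \<inter> space \<mu>)"
      using action_measurable[OF M_borel_prob[OF \<mu>] g(1)] by (intro measure_distr) auto
    moreover have "\<phi> g -` {y} = {x}"
      using act.inj_prop[OF g(1)] g(2) by (auto simp: inj_on_def)
    ultimately show ?thesis
      using \<mu> g(1) borel_prob_space[OF M_borel_prob[OF \<mu>]] by (simp add: invariant_measures_def)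
  qed
  have "finite Orb"
  proof (rule ccontr)
    assume "infinite Orb"
    obtain n where n: "real n * measure \<mu> {x} > 1"
      using reals_Archimedean3[OF c] by auto
    obtain T where T: "T \<subseteq> Orb" "finite T" "card T = n"
      using infinite_arbitrarily_large[OF \<open>infinite Orb\<close>] by blast
    have "measure \<mu> T = (\<Sum>y\<in>T. measure \<mu> {y})"
      using T(2) by (intro finite_measure_eq_sum_singleton) (auto simp: sets)
    also have "\<dots> = real n * measure \<mu> {x}"
      using mass T by (simp add: subset_iff)
    finally show False using n prob_le_1[of T] by simp
  qed
  moreover have "\<phi> g ` Orb \<subseteq> Orb" if g: "g \<in> carrier G" for g
  proof
    fix y assume "y \<in> \<phi> g ` Orb"
    then obtain h where h: "h \<in> carrier G" "y = \<phi> g (\<phi> h x)" unfolding Orb_def by blast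
    then have "y = \<phi> (g \<otimes>\<^bsub>G\<^esub> h) x"
      using act.composition_rule[OF _ g h(1), of x] by simp
    moreover have "g \<otimes>\<^bsub>G\<^esub> h \<in> carrier G"
      using group.is_monoid[OF group] g h(1) by (simp add: monoid.m_closed)
    ultimately show "y \<in> Orb" unfolding Orb_def by blast
  qed
  moreover have "Orb \<noteq> {}"
    using group.is_monoid[OF group] monoid.one_closed unfolding Orb_def by blast
  ultimately have "Orb = UNIV"
    using minimal finite_imp_closed[of Orb] unfolding minimal_action_def by blast
  then show False using \<open>finite Orb\<close> inf by simp
qed

end


section \<open>Perturbations with small level sets\<close>

definition tent :: "real \<Rightarrow> real \<Rightarrow> real" where
  "tent \<delta> s = max 0 (1 - \<bar>s\<bar> / \<delta>)"

lemma tent_nonneg: "0 \<le> tent \<delta> s"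
  and tent_le_1: "\<delta> > 0 \<Longrightarrow> tent \<delta> s \<le> 1"
  and tent_eq_0: "\<delta> > 0 \<Longrightarrow> \<delta> \<le> \<bar>s\<bar> \<Longrightarrow> tent \<delta> s = 0"
  by (auto simp: tent_def)

lemma tent_ge_half: "\<delta> > 0 \<Longrightarrow> \<bar>s\<bar> \<le> \<delta> / 2 \<Longrightarrow> 1/2 \<le> tent \<delta> s"
  by (auto simp: tent_def field_simps max_def)

lemma continuous_on_tent:
  fixes f :: "'a::topological_space \<Rightarrow> real"
  shows "continuous_on S f \<Longrightarrow> \<delta> > 0 \<Longrightarrow> continuous_on S (\<lambda>x. tent \<delta> (f x))"
  unfolding tent_def
  by (intro continuous_on_max continuous_on_const continuous_on_diff continuous_on_divide continuous_on_rabs) auto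

lemma tent_lipschitz:
  assumes "\<delta> > 0"
  shows "tent \<delta> s \<le> tent \<delta> t + \<bar>s - t\<bar> / \<delta>"
proof -
  have "\<bar>t\<bar> / \<delta> \<le> \<bar>s\<bar> / \<delta> + \<bar>s - t\<bar> / \<delta>"
    using assms by (simp add: add_divide_distrib[symmetric] divide_right_mono)
  moreover have "1 - \<bar>t\<bar> / \<delta> \<le> tent \<delta> t" by (simp add: tent_def)
  moreover have "0 \<le> \<bar>s - t\<bar> / \<delta>" using assms by simp
  ultimately show ?thesis
    using tent_nonneg[of \<delta> t] unfolding tent_def[of \<delta> s] by (intro max.boundedI; linarith)
qed

text \<open>Reduces smallness at all levels \<open>t\<close> to finitely many levels, so that it
  becomes a finite intersection of open conditions on the measure. Levels farther out than
  \<open>\<bar>A\<bar> + \<delta>\<close> meet no value \<open>y\<close>; inside, the Lipschitz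
  constant \<open>1 / \<delta>\<close> makes a grid of fineness \<open>\<eta> * \<delta>\<close>
  sufficient.\<close>

lemma tent_finite_grid:
  assumes \<delta>: "\<delta> > 0" and \<eta>: "\<eta> > 0"
  shows "\<exists>T. finite T \<and> (\<forall>t. \<exists>t'\<in>T. \<forall>y. \<bar>y\<bar> \<le> A \<longrightarrow> tent \<delta> (y - t) \<le> tent \<delta> (y - t') + \<eta>)"
proof -
  define R where "R = \<bar>A\<bar> + \<delta>"
  have "R \<ge> 0" using \<delta> by (simp add: R_def)
  have "{-R..R} \<subseteq> (\<Union>t\<in>{-R..R}. ball t (\<eta> * \<delta>))"
    using \<delta> \<eta> by (auto intro!: bexI)
  from compactE_image[OF compact_Icc _ this] obtain T
    where T: "finite T" "T \<subseteq> {-R..R}" "{-R..R} \<subseteq> (\<Union>t\<in>T. ball t (\<eta> * \<delta>))"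
    by (metis open_ball)
  have "\<exists>t'\<in>T. \<forall>y. \<bar>y\<bar> \<le> A \<longrightarrow> tent \<delta> (y - t) \<le> tent \<delta> (y - t') + \<eta>" for t
  proof (cases "t \<in> {-R..R}")
    case True
    then obtain t' where "t' \<in> T" "t \<in> ball t' (\<eta> * \<delta>)"
      using T(3) by blast
    then have t': "t' \<in> T" "\<bar>t - t'\<bar> < \<eta> * \<delta>"
      by (auto simp: dist_real_def abs_minus_commute)
    have "tent \<delta> (y - t) \<le> tent \<delta> (y - t') + \<eta>" for y
    proof -
      have "tent \<delta> (y - t) \<le> tent \<delta> (y - t') + \<bar>(y - t) - (y - t')\<bar> / \<delta>"
        by (rule tent_lipschitz[OF \<delta>])
      moreover have "\<bar>(y - t) - (y - t')\<bar> / \<delta> \<le> \<eta>"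
        using t'(2) \<delta> by (simp add: field_simps abs_minus_commute)
      ultimately show ?thesis by linarith
    qed
    then show ?thesis using t'(1) by blast
  next
    case False
    have "tent \<delta> (y - t) = 0" if "\<bar>y\<bar> \<le> A" for y
      using False that \<delta> by (intro tent_eq_0) (auto simp: R_def)
    moreover have "0 \<in> {-R..R}" using \<open>R \<ge> 0\<close> by simp
    then obtain t' where "t' \<in> T" using T(3) by blast
    moreover have "0 \<le> tent \<delta> (y - t') + \<eta>" for y
      using \<eta> by (intro add_nonneg_nonneg tent_nonneg) simp
    ultimately show ?thesis by (intro bexI[of _ t']) auto
  qed
  then show ?thesis using T(1) by blast
qed

lemma injective_choice:
  assumes "\<And>i::nat. infinite (S i)"
  shows "\<exists>c. inj_on c {..<m} \<and> (\<forall>i<m. c i \<in> S i)"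
proof (induction m)
  case (Suc m)
  then obtain c where c: "inj_on c {..<m}" "\<forall>i<m. c i \<in> S i" by blast
  obtain y where y: "y \<in> S m" "y \<notin> c ` {..<m}"
    using assms[of m] by (metis finite_imageI finite_lessThan finite_subset subsetI)
  have "inj_on (c(m := y)) {..<Suc m}"
    using c(1) y(2) by (auto simp: inj_on_def lessThan_Suc)
  moreover have "\<forall>i<Suc m. (c(m := y)) i \<in> S i"
    using c(2) y(1) by (auto simp: less_Suc_eq)
  ultimately show ?case by blast
qed simp

context compact_group_action
begin

lemma M_small_ball:
  fixes f :: "'a \<Rightarrow> real"
  assumes \<mu>: "\<mu> \<in> M" and atom: "measure \<mu> {x} = 0" and f: "continuous_on UNIV f" and e: "e > 0"
  shows "\<exists>r>0. measure \<mu> (ball x r) < e \<and> (\<forall>y\<in>ball x r. \<bar>f y - f x\<bar> < e)"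
proof -
  interpret prob_space \<mu> using M_borel_prob[OF \<mu>] by (simp add: borel_prob_def)
  have sets: "sets \<mu> = sets borel" using M_borel_prob[OF \<mu>] by (simp add: borel_prob_def)
  let ?B = "\<lambda>n. ball x (1 / real (Suc n))"
  have "(\<lambda>n. measure \<mu> (?B n)) \<longlonglongrightarrow> measure \<mu> (\<Inter>n. ?B n)"
  proof (rule finite_Lim_measure_decseq)
    show "decseq ?B"
      by (intro decseq_SucI subset_ball) (simp add: frac_le)
  qed (auto simp: sets)
  moreover have "(\<Inter>n. ?B n) = {x}"
  proof -
    have "y = x" if y: "y \<in> (\<Inter>n. ?B n)" for y
    proof (rule ccontr)
      assume "y \<noteq> x"
      then obtain n where "1 / real (Suc n) < dist x y"
        using nat_approx_posE[of "dist x y"] by auto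
      moreover have "dist x y < 1 / real (Suc n)" using y by (simp add: INT_iff)
      ultimately show False by simp
    qed
    then show ?thesis by auto
  qed
  ultimately have "\<forall>\<^sub>F n in sequentially. measure \<mu> (?B n) < e"
    using atom e by (intro order_tendstoD(2)) auto
  then obtain n where n: "measure \<mu> (?B n) < e"
    using eventually_happens'[OF sequentially_bot] by blast
  obtain d where d: "d > 0" "\<And>y. dist y x < d \<Longrightarrow> dist (f y) (f x) < e"
    using f e unfolding continuous_on_iff by blast
  let ?r = "min d (1 / real (Suc n))"
  have "measure \<mu> (ball x ?r) \<le> measure \<mu> (?B n)"
    by (intro finite_measure_mono subset_ball) (auto simp: sets)
  then show ?thesis
    using n d by (intro exI[of _ ?r]) (auto simp: dist_commute dist_real_def)
qed

text \<open>Cover the space by finitely many balls of small measure on which \<open>f\<close>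
  oscillates little, and push \<open>f\<close> towards a step function with a different value for
  each ball. A level then meets the value of at most one ball and so has small measure. Steep
  continuous interpolation approaches the step function pointwise.\<close>

lemma local_perturbation:
  fixes f :: "'a \<Rightarrow> real"
  assumes \<mu>: "\<mu> \<in> M" and atom: "\<And>x. measure \<mu> {x} = 0" and f: "continuous_on UNIV f" and \<epsilon>: "\<epsilon> > 0"
  shows "\<exists>h \<delta> W. continuous_on UNIV h \<and> \<delta> > 0 \<and> (\<forall>x. \<bar>h x - f x\<bar> \<le> \<epsilon>) \<and>
    openin (weak_star_topology M) W \<and> \<mu> \<in> W \<and> (\<forall>\<nu>\<in>W. \<forall>t. (\<integral>x. tent \<delta> (h x - t) \<partial>\<nu>) < \<epsilon>)"
proof -
  let ?W = "weak_star_topology M"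
  interpret prob_space \<mu> using M_borel_prob[OF \<mu>] by (simp add: borel_prob_def)
  have sets: "sets \<mu> = sets borel" using M_borel_prob[OF \<mu>] by (simp add: borel_prob_def)
  have "\<exists>r>0. measure \<mu> (ball x r) < \<epsilon>/2 \<and> (\<forall>y\<in>ball x r. \<bar>f y - f x\<bar> < \<epsilon>/2)" for x
    using \<epsilon> by (intro M_small_ball \<mu> atom f) simp
  then obtain r where r: "\<And>x. r x > 0" "\<And>x. measure \<mu> (ball x (r x)) < \<epsilon>/2"
    "\<And>x y. y \<in> ball x (r x) \<Longrightarrow> \<bar>f y - f x\<bar> < \<epsilon>/2"
    by metis
  have "UNIV \<subseteq> (\<Union>x\<in>UNIV. ball x (r x))" using r(1) by (auto intro!: exI)
  from compactE_image[OF compact_UNIV _ this] obtain P where P: "finite P" "UNIV \<subseteq> (\<Union>x\<in>P. ball x (r x))"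
    by (metis open_ball)
  obtain p where p: "bij_betw p {0..<card P} P"
    using ex_bij_betw_nat_finite[OF P(1)] by blast
  define m where "m = card P"
  define B where "B i = ball (p i) (r (p i))" for i
  have Bcov: "\<exists>i<m. x \<in> B i" for x
  proof -
    obtain y where "y \<in> P" "x \<in> ball y (r y)" using P(2) by blast
    then show ?thesis using p unfolding bij_betw_def B_def m_def by force
  qed
  have "\<exists>c. inj_on c {..<m} \<and> (\<forall>i<m. c i \<in> {f (p i) - \<epsilon>/2<..<f (p i) + \<epsilon>/2})"
    using \<epsilon> by (intro injective_choice) simp
  then obtain c where c: "inj_on c {..<m}"
    and c': "\<And>i. i < m \<Longrightarrow> c i \<in> {f (p i) - \<epsilon>/2<..<f (p i) + \<epsilon>/2}"
    by blast
  have cB: "\<bar>c i - f x\<bar> \<le> \<epsilon>" if "i < m" "x \<in> B i" for i x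
    using c'[OF that(1)] r(3)[of x "p i"] that(2) unfolding B_def by (simp add: abs_if split: if_splits)
  \<comment> \<open>The inserted \<open>2\<close> keeps \<open>D\<close> nonempty when there is only
    one ball. With half of the least gap as \<open>\<delta>\<close>, no tent sees two of the values
    \<open>c i\<close>.\<close>
  define D where "D = insert 2 ((\<lambda>(i, j). \<bar>c i - c j\<bar>) ` {(i, j). i < m \<and> j < m \<and> i \<noteq> j})"
  have "finite {(i, j). i < m \<and> j < m \<and> i \<noteq> j}"
    by (rule finite_subset[of _ "{..<m} \<times> {..<m}"]) auto
  then have D: "finite D" "D \<noteq> {}" by (auto simp: D_def)
  have "0 < d" if "d \<in> D" for d
    using that c by (auto simp: D_def inj_on_def)
  then have "0 < Min D" using D by simp
  define \<delta> where "\<delta> = Min D / 2"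
  have \<delta>: "\<delta> > 0" using \<open>0 < Min D\<close> by (simp add: \<delta>_def)
  have gap: "i = j" if "i < m" "j < m" "\<bar>c i - c j\<bar> < 2 * \<delta>" for i j
  proof (rule ccontr)
    assume "i \<noteq> j"
    then have "\<bar>c i - c j\<bar> \<in> D" using that by (auto simp: D_def)
    then have "Min D \<le> \<bar>c i - c j\<bar>" using D(1) by simp
    then show False using that(3) by (simp add: \<delta>_def)
  qed
  define \<psi> where "\<psi> i N x = max 0 (min 1 (real N * (r (p i) - dist (p i) x)))" for i N x
  have \<psi>c: "continuous_on UNIV (\<psi> i N)" for i N
    unfolding \<psi>_def
    by (intro continuous_on_max continuous_on_min continuous_on_mult continuous_on_diff
        continuous_on_dist continuous_on_const continuous_on_id)
  have \<psi>01: "0 \<le> \<psi> i N x" "\<psi> i N x \<le> 1" for i N x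
    by (auto simp: \<psi>_def)
  have \<psi>out: "\<psi> i N x = 0" if "x \<notin> B i" for i N x
  proof -
    have "real N * (r (p i) - dist (p i) x) \<le> 0"
      using that by (intro mult_nonneg_nonpos) (auto simp: B_def)
    then show ?thesis by (simp add: \<psi>_def)
  qed
  have \<psi>in: "\<forall>\<^sub>F N in sequentially. \<psi> i N x = 1" if "x \<in> B i" for i x
  proof -
    have d: "r (p i) - dist (p i) x > 0" using that by (simp add: B_def)
    obtain N where N: "real N * (r (p i) - dist (p i) x) > 1"
      using reals_Archimedean3[OF d] by auto
    have "\<psi> i n x = 1" if "n \<ge> N" for n
    proof -
      have "real N * (r (p i) - dist (p i) x) \<le> real n * (r (p i) - dist (p i) x)"
        using that d by (intro mult_right_mono) auto
      then show ?thesis using N by (simp add: \<psi>_def)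
    qed
    then show ?thesis unfolding eventually_sequentially by blast
  qed
  \<comment> \<open>The values are written one after the other, each steeply cut off to its ball. In
    the limit a point receives the value of the last ball containing it, and every step is a convex
    combination of numbers within \<open>\<epsilon>\<close> of \<open>f x\<close>.\<close>
  define h where "h N = rec_nat f (\<lambda>i g x. (1 - \<psi> i N x) * g x + \<psi> i N x * c i)" for N
  have h0: "h N 0 = f" and hS: "h N (Suc i) x = (1 - \<psi> i N x) * h N i x + \<psi> i N x * c i" for N i x
    by (simp_all add: h_def)
  have hc: "continuous_on UNIV (h N i)" for N i
  proof (induction i)
    case (Suc i)
    have "h N (Suc i) = (\<lambda>x. (1 - \<psi> i N x) * h N i x + \<psi> i N x * c i)"
      by (rule ext) (rule hS)
    then show ?case
      using Suc \<psi>c by (simp only:) (intro continuous_on_add continuous_on_mult continuous_on_diff continuous_on_const)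
  qed (simp add: h0 f)
  have hf: "\<bar>h N i x - f x\<bar> \<le> \<epsilon>" if "i \<le> m" for N i x
    using that
  proof (induction i)
    case 0
    then show ?case using \<epsilon> by (simp add: h0)
  next
    case (Suc i)
    let ?p = "\<psi> i N x"
    have "?p * \<bar>c i - f x\<bar> \<le> ?p * \<epsilon>"
      using cB[of i x] \<psi>out[of x i N] \<psi>01(1)[of i N x] Suc.prems
      by (cases "x \<in> B i") (auto intro: mult_left_mono)
    moreover have "(1 - ?p) * \<bar>h N i x - f x\<bar> \<le> (1 - ?p) * \<epsilon>"
      using Suc \<psi>01(2)[of i N x] by (intro mult_left_mono) auto
    moreover have "h N (Suc i) x - f x = (1 - ?p) * (h N i x - f x) + ?p * (c i - f x)"
      unfolding hS by (simp add: algebra_simps)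
    then have "\<bar>h N (Suc i) x - f x\<bar> \<le> (1 - ?p) * \<bar>h N i x - f x\<bar> + ?p * \<bar>c i - f x\<bar>"
      using abs_triangle_ineq[of "(1 - ?p) * (h N i x - f x)" "?p * (c i - f x)"] \<psi>01[of i N x]
      by (simp add: abs_mult)
    ultimately have "\<bar>h N (Suc i) x - f x\<bar> \<le> (1 - ?p) * \<epsilon> + ?p * \<epsilon>" by linarith
    then show ?case by (simp add: algebra_simps)
  qed
  have "\<exists>j<i. x \<in> B j \<and> (\<forall>\<^sub>F N in sequentially. h N i x = c j)" if "\<exists>j<i. x \<in> B j" for i x
    using that
  proof (induction i)
    case (Suc i)
    show ?case
    proof (cases "x \<in> B i")
      case True
      have "\<forall>\<^sub>F N in sequentially. h N (Suc i) x = c i"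
        using \<psi>in[OF True] by (rule eventually_mono) (simp add: hS)
      then show ?thesis using True by blast
    next
      case False
      then have "\<exists>j<i. x \<in> B j" using Suc.prems less_Suc_eq by auto
      then obtain j where "j < i" "x \<in> B j" "\<forall>\<^sub>F N in sequentially. h N i x = c j"
        using Suc.IH by blast
      moreover have "h N (Suc i) x = h N i x" for N using \<psi>out[OF False] by (simp add: hS)
      ultimately show ?thesis by (intro exI[of _ j]) simp
    qed
  qed simp
  from this[OF Bcov] obtain \<kappa>
    where \<kappa>: "\<And>x. \<kappa> x < m" "\<And>x. x \<in> B (\<kappa> x)" "\<And>x. \<forall>\<^sub>F N in sequentially. h N m x = c (\<kappa> x)"
    by metis
  obtain A0 where A0: "\<And>x. \<bar>f x\<bar> \<le> A0"
    using continuous_bounded_on_compact[OF compact_UNIV f] by metis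
  have hA: "\<bar>h N m x\<bar> \<le> A0 + \<epsilon>" for N x
    using hf[of m N x] A0[of x] by linarith
  obtain T where T: "finite T"
    "\<And>t. \<exists>t'\<in>T. \<forall>y. \<bar>y\<bar> \<le> A0 + \<epsilon> \<longrightarrow> tent \<delta> (y - t) \<le> tent \<delta> (y - t') + \<epsilon>/4"
    using tent_finite_grid[OF \<delta>, of "\<epsilon>/4" "A0 + \<epsilon>"] \<epsilon> by auto
  have tc: "continuous_on UNIV (\<lambda>x. tent \<delta> (h N m x - t))" for N t
    by (intro continuous_on_tent continuous_on_diff continuous_on_const hc \<delta>)
  \<comment> \<open>The limit is at most \<open>\<epsilon> / 2\<close>, from the mass of one ball.
    The next quarter is slack for a finite \<open>N\<close>; the last quarter pays later for
    replacing \<open>t\<close> by a grid level.\<close>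
  have ev: "\<forall>\<^sub>F N in sequentially. (\<integral>x. tent \<delta> (h N m x - t) \<partial>\<mu>) < 3 * \<epsilon> / 4" for t
  proof -
    have lim: "(\<lambda>N. tent \<delta> (h N m x - t)) \<longlonglongrightarrow> tent \<delta> (c (\<kappa> x) - t)" for x
      by (rule tendsto_eventually) (use \<kappa>(3)[of x] in \<open>rule eventually_mono, simp\<close>)
    have meas: "(\<lambda>x. tent \<delta> (h N m x - t)) \<in> borel_measurable \<mu>" for N
      by (rule borel_prob_measurable[OF M_borel_prob[OF \<mu>] tc])
    then have meas': "(\<lambda>x. tent \<delta> (c (\<kappa> x) - t)) \<in> borel_measurable \<mu>"
      by (rule borel_measurable_LIMSEQ_real[rotated]) (rule lim)
    have "(\<lambda>N. \<integral>x. tent \<delta> (h N m x - t) \<partial>\<mu>) \<longlonglongrightarrow> (\<integral>x. tent \<delta> (c (\<kappa> x) - t) \<partial>\<mu>)"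
      by (rule integral_dominated_convergence[where w = "\<lambda>_. 1"])
        (use meas meas' lim tent_nonneg tent_le_1[OF \<delta>] in auto)
    moreover have "(\<integral>x. tent \<delta> (c (\<kappa> x) - t) \<partial>\<mu>) \<le> \<epsilon>/2"
    proof (cases "\<exists>i<m. \<bar>c i - t\<bar> < \<delta>")
      case True
      then obtain i where i: "i < m" "\<bar>c i - t\<bar> < \<delta>" by blast
      have le: "tent \<delta> (c (\<kappa> x) - t) \<le> indicator (B i) x" for x
      proof (cases "\<bar>c (\<kappa> x) - t\<bar> < \<delta>")
        case True
        then have "\<bar>c (\<kappa> x) - c i\<bar> < 2 * \<delta>" using i(2) by linarith
        then have "\<kappa> x = i" using gap \<kappa>(1) i(1) by blast
        then show ?thesis using \<kappa>(2)[of x] tent_le_1[OF \<delta>] by (simp add: indicator_def)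
      next
        case False
        then show ?thesis using tent_eq_0[OF \<delta>] by simp
      qed
      have "(\<integral>x. tent \<delta> (c (\<kappa> x) - t) \<partial>\<mu>) \<le> (\<integral>x. indicator (B i) x \<partial>\<mu>)"
      proof (rule integral_mono)
        show "integrable \<mu> (\<lambda>x. tent \<delta> (c (\<kappa> x) - t))"
          by (rule integrable_const_bound[of _ 1]) (use meas' tent_nonneg tent_le_1[OF \<delta>] in auto)
        show "integrable \<mu> (indicator (B i) :: 'a \<Rightarrow> real)"
          by (simp add: B_def sets emeasure_eq_measure)
      qed (rule le)
      also have "\<dots> = measure \<mu> (B i)" by (simp add: B_def sets)
      finally show ?thesis using r(2)[of "p i"] by (simp add: B_def)
    next
      case False
      have "tent \<delta> (c (\<kappa> x) - t) = 0" for x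
      proof (rule tent_eq_0[OF \<delta>])
        show "\<delta> \<le> \<bar>c (\<kappa> x) - t\<bar>" using \<kappa>(1)[of x] False not_le by blast
      qed
      then show ?thesis using \<epsilon> by simp
    qed
    ultimately show ?thesis
      using \<epsilon> by (intro order_tendstoD(2)) auto
  qed
  have "\<forall>\<^sub>F N in sequentially. \<forall>t\<in>T. (\<integral>x. tent \<delta> (h N m x - t) \<partial>\<mu>) < 3 * \<epsilon> / 4"
    using T(1) ev by (intro eventually_ball_finite) auto
  then obtain N where N: "\<And>t. t \<in> T \<Longrightarrow> (\<integral>x. tent \<delta> (h N m x - t) \<partial>\<mu>) < 3 * \<epsilon> / 4"
    using eventually_happens'[OF sequentially_bot] by blast
  define W where "W = (\<Inter>t\<in>T. {\<nu> \<in> topspace ?W. (\<integral>x. tent \<delta> (h N m x - t) \<partial>\<nu>) \<in> {..<3 * \<epsilon> / 4}}) \<inter> topspace ?W"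
  have "openin ?W W"
    unfolding W_def using T(1)
    by (intro openin_INT openin_continuous_map_preimage[OF continuous_map_weak_star_integral] tc) auto
  moreover have "\<mu> \<in> W"
    using \<mu> N by (simp add: W_def topspace_weak_star)
  moreover have "(\<integral>x. tent \<delta> (h N m x - t) \<partial>\<nu>) < \<epsilon>" if \<nu>: "\<nu> \<in> W" for \<nu> t
  proof -
    have \<nu>M: "\<nu> \<in> M" using \<nu> by (simp add: W_def topspace_weak_star)
    interpret \<nu>: prob_space \<nu> using M_borel_prob[OF \<nu>M] by (simp add: borel_prob_def)
    obtain t' where t': "t' \<in> T" "\<And>y. \<bar>y\<bar> \<le> A0 + \<epsilon> \<Longrightarrow> tent \<delta> (y - t) \<le> tent \<delta> (y - t') + \<epsilon>/4"
      using T(2)[of t] by blast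
    note int = M_integrable[OF \<nu>M tc]
    have "(\<integral>x. tent \<delta> (h N m x - t) \<partial>\<nu>) \<le> (\<integral>x. tent \<delta> (h N m x - t') + \<epsilon>/4 \<partial>\<nu>)"
      by (intro integral_mono int Bochner_Integration.integrable_add t'(2) hA) simp
    also have "\<dots> = (\<integral>x. tent \<delta> (h N m x - t') \<partial>\<nu>) + \<epsilon>/4"
      using int \<nu>.prob_space by simp
    also have "(\<integral>x. tent \<delta> (h N m x - t') \<partial>\<nu>) < 3 * \<epsilon> / 4"
      using \<nu> t'(1) unfolding W_def by blast
    finally show ?thesis by simp
  qed
  ultimately show ?thesis
    using hc[of N m] \<delta> hf[of m N] by (intro exI[of _ "h N m"] exI[of _ \<delta>] exI[of _ W]) auto
qed

end

section \<open>Gluing local perturbations along a cover of the extreme boundary\<close>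

lemma continuous_finite_maximum:
  fixes F :: "'i \<Rightarrow> 'a::topological_space \<Rightarrow> real"
  assumes "finite I" "I \<noteq> {}" "\<And>i. i \<in> I \<Longrightarrow> continuous_on UNIV (F i)"
  shows "\<exists>m. continuous_on UNIV m \<and> (\<forall>x. (\<forall>i\<in>I. F i x \<le> m x) \<and> (\<exists>i\<in>I. m x = F i x))"
  using assms
proof (induction rule: finite_ne_induct)
  case (singleton i)
  then show ?case by (intro exI[of _ "F i"]) auto
next
  case (insert i I)
  then obtain m where m: "continuous_on UNIV m" "\<And>x i. i \<in> I \<Longrightarrow> F i x \<le> m x" "\<And>x. \<exists>i\<in>I. m x = F i x"
    by auto
  show ?case
  proof (intro exI[of _ "\<lambda>x. max (F i x) (m x)"] conjI allI)
    show "continuous_on UNIV (\<lambda>x. max (F i x) (m x))"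
      using insert.prems by (intro continuous_on_max m) auto
    fix x
    show "\<forall>j\<in>insert i I. F j x \<le> max (F i x) (m x)"
      using m(2) by (simp add: le_max_iff_disj)
    show "\<exists>j\<in>insert i I. max (F i x) (m x) = F j x"
      using m(3)[of x] by (auto simp: max_def)
  qed
qed

context countable_group_action
begin

text \<open>The perturbation is the maximum over a finite cover of \<open>K\<close> of functions \<open>f\<^sub>V - \<theta>\<^sub>V\<close>, where
  \<open>f\<^sub>V\<close> has small level sets for the measures in \<open>V\<close> and the function \<open>\<theta>\<^sub>V\<close> of the measure vanishes
  on a core of \<open>V\<close> and is large outside \<open>V\<close>. At each measure only the few \<open>V\<close> that contain it
  contribute to a level set; this is where the covering dimension enters.\<close>

lemma perturbation_small_zero_set:
  fixes f :: "'a \<Rightarrow> real"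
  assumes bauer: "bauer_invariant_measures G \<phi>"
    and dim: "covering_dim_le (extreme_boundary_topology G \<phi>) n"
    and atom: "\<And>\<mu> x. \<mu> \<in> M \<Longrightarrow> measure \<mu> {x} = 0"
    and f: "continuous_on UNIV f" and \<epsilon>: "\<epsilon> > 0"
  shows "\<exists>h \<delta>. continuous_on UNIV h \<and> \<delta> > 0 \<and> (\<forall>x. \<bar>h x - f x\<bar> \<le> \<epsilon>) \<and>
    (\<forall>\<mu>\<in>K. (\<integral>x. tent \<delta> (h x) \<partial>\<mu>) \<le> \<epsilon>)"
proof (cases "K = {}")
  case True
  then show ?thesis using f \<epsilon> by (intro exI[of _ f] exI[of _ 1]) auto
next
  case False
  let ?W = "weak_star_topology M"
  let ?T = "extreme_boundary_topology G \<phi>"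
  have tsT: "topspace ?T = K"
    using K_subset_M by (auto simp: extreme_boundary_topology_def topspace_weak_star)
  \<comment> \<open>At most \<open>n + 1\<close> cover members contain a given measure and each
    contributes at most \<open>2 * \<epsilon>1\<close>, together \<open>\<epsilon> / 2\<close>. The
    lifting errors take the other half.\<close>
  define \<epsilon>1 where "\<epsilon>1 = \<epsilon> / (4 * (real n + 1))"
  have \<epsilon>1: "\<epsilon>1 > 0" "\<epsilon>1 \<le> \<epsilon> / 4"
    using \<epsilon> by (auto simp: \<epsilon>1_def field_simps)
  have "\<exists>h \<delta> W. continuous_on UNIV h \<and> \<delta> > 0 \<and> (\<forall>x. \<bar>h x - f x\<bar> \<le> \<epsilon>1) \<and>
    openin ?W W \<and> \<mu> \<in> W \<and> (\<forall>\<nu>\<in>W. \<forall>t. (\<integral>x. tent \<delta> (h x - t) \<partial>\<nu>) < \<epsilon>1)" if "\<mu> \<in> K" for \<mu>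
    using that K_subset_M by (intro local_perturbation atom f \<epsilon>1) auto
  then obtain h0 d0 W0 where loc: "\<And>\<mu>. \<mu> \<in> K \<Longrightarrow> continuous_on UNIV (h0 \<mu>) \<and> d0 \<mu> > 0 \<and>
    (\<forall>x. \<bar>h0 \<mu> x - f x\<bar> \<le> \<epsilon>1) \<and> openin ?W (W0 \<mu>) \<and> \<mu> \<in> W0 \<mu> \<and>
    (\<forall>\<nu>\<in>W0 \<mu>. \<forall>t. (\<integral>x. tent (d0 \<mu>) (h0 \<mu> x - t) \<partial>\<nu>) < \<epsilon>1)"
    by metis
  define \<U> where "\<U> = (\<lambda>\<mu>. W0 \<mu> \<inter> K) ` K"
  have "(\<forall>U\<in>\<U>. openin ?T U) \<and> \<Union>\<U> = topspace ?T"
    using loc unfolding \<U>_def tsT by (auto simp: extreme_boundary_topology_def openin_subtopology)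
  from dim[unfolded covering_dim_le_def, THEN spec, THEN mp, OF this]
  obtain \<V> where \<V>0: "\<forall>V\<in>\<V>. openin ?T V" "\<Union>\<V> = topspace ?T" "\<forall>V\<in>\<V>. \<exists>U\<in>\<U>. V \<subseteq> U"
    "\<forall>\<mu>\<in>topspace ?T. finite {V \<in> \<V>. \<mu> \<in> V} \<and> card {V \<in> \<V>. \<mu> \<in> V} \<le> n + 1"
    by (elim exE conjE)
  have \<V>: "\<And>V. V \<in> \<V> \<Longrightarrow> openin ?T V" "\<Union>\<V> = K" "\<And>V. V \<in> \<V> \<Longrightarrow> \<exists>U\<in>\<U>. V \<subseteq> U"
    "\<And>\<mu>. \<mu> \<in> K \<Longrightarrow> finite {V \<in> \<V>. \<mu> \<in> V} \<and> card {V \<in> \<V>. \<mu> \<in> V} \<le> n + 1"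
    using \<V>0 unfolding tsT by blast+
  have "\<exists>h d. continuous_on UNIV h \<and> d > 0 \<and> (\<forall>x. \<bar>h x - f x\<bar> \<le> \<epsilon>1) \<and>
    (\<forall>\<nu>\<in>V. \<forall>t. (\<integral>x. tent d (h x - t) \<partial>\<nu>) < \<epsilon>1)" if V: "V \<in> \<V>" for V
  proof -
    obtain \<mu> where "\<mu> \<in> K" "V \<subseteq> W0 \<mu>" using \<V>(3)[OF V] unfolding \<U>_def by blast
    then show ?thesis using loc[of \<mu>] by (intro exI[of _ "h0 \<mu>"] exI[of _ "d0 \<mu>"]) blast
  qed
  then obtain h d where h: "\<And>V. V \<in> \<V> \<Longrightarrow> continuous_on UNIV (h V)" and d: "\<And>V. V \<in> \<V> \<Longrightarrow> d V > 0"
    and hf: "\<And>V x. V \<in> \<V> \<Longrightarrow> \<bar>h V x - f x\<bar> \<le> \<epsilon>1"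
    and small: "\<And>V \<nu> t. V \<in> \<V> \<Longrightarrow> \<nu> \<in> V \<Longrightarrow> (\<integral>x. tent (d V) (h V x - t) \<partial>\<nu>) < \<epsilon>1"
    by metis
  have "\<exists>V b. V \<in> \<V> \<and> liftable b \<and> continuous_map ?W euclideanreal b \<and> b \<mu> = 1 \<and>
    (\<forall>\<nu>. 0 \<le> b \<nu>) \<and> (\<forall>\<nu>\<in>K. 0 < b \<nu> \<longrightarrow> \<nu> \<in> V)" if \<mu>: "\<mu> \<in> K" for \<mu>
  proof -
    obtain V where V: "V \<in> \<V>" "\<mu> \<in> V" using \<V>(2) \<mu> by blast
    obtain V' where V': "openin ?W V'" "V = V' \<inter> K"
      using \<V>(1)[OF V(1)] unfolding extreme_boundary_topology_def openin_subtopology by blast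
    then have "\<mu> \<in> V'" using V(2) by blast
    from liftable_bump[OF bauer V'(1) this] show ?thesis
      using V(1) V'(2) K_subset_M by blast
  qed
  then obtain V b where Vb: "\<And>\<mu>. \<mu> \<in> K \<Longrightarrow> V \<mu> \<in> \<V> \<and> liftable (b \<mu>) \<and>
    continuous_map ?W euclideanreal (b \<mu>) \<and> b \<mu> \<mu> = 1 \<and> (\<forall>\<nu>. 0 \<le> b \<mu> \<nu>) \<and>
    (\<forall>\<nu>\<in>K. 0 < b \<mu> \<nu> \<longrightarrow> \<nu> \<in> V \<mu>)"
    by metis
  then have V: "V \<mu> \<in> \<V>" and bl: "liftable (b \<mu>)"
    and bc: "continuous_map ?W euclideanreal (b \<mu>)" and b1: "b \<mu> \<mu> = 1"
    and b0: "0 \<le> b \<mu> \<nu>" and bV: "\<nu> \<in> K \<Longrightarrow> 0 < b \<mu> \<nu> \<Longrightarrow> \<nu> \<in> V \<mu>"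
    if "\<mu> \<in> K" for \<mu> \<nu>
    using that by blast+
  define N where "N \<mu> = {\<nu> \<in> topspace ?W. b \<mu> \<nu> \<in> {1/2<..}}" for \<mu>
  have "openin ?W U" if "U \<in> N ` K" for U
    using that unfolding N_def
    by (elim imageE) (simp only:, intro openin_continuous_map_preimage[OF bc], auto)
  moreover have "K \<subseteq> \<Union>(N ` K)"
    using b1 K_subset_M by (auto simp: N_def topspace_weak_star)
  ultimately obtain \<F> where \<F>: "finite \<F>" "\<F> \<subseteq> N ` K" "K \<subseteq> \<Union>\<F>"
    using compactinD[OF compactin_K[OF bauer], of "N ` K"] by blast
  obtain S where S: "S \<subseteq> K" "finite S" "\<F> = N ` S"
    using finite_subset_image[OF \<F>(1,2)] by blast
  have Scov: "\<exists>\<nu>\<in>S. b \<nu> \<mu> > 1/2" if "\<mu> \<in> K" for \<mu>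
    using \<F>(3) S(3) that unfolding N_def by blast
  define \<W> where "\<W> = V ` S"
  have \<W>: "finite \<W>" "\<W> \<subseteq> \<V>" "\<W> \<noteq> {}"
    using S V Scov False unfolding \<W>_def by auto
  \<comment> \<open>Several centres in \<open>S\<close> may share one member of the cover. Their
    bumps are merged into a single \<open>m w\<close>, because the multiplicity bound counts members
    and not centres.\<close>
  have "\<forall>w. \<exists>m. liftable m \<and> (\<forall>\<mu>. 0 \<le> m \<mu> \<and> (\<forall>i\<in>{\<nu>\<in>S. V \<nu> = w}. b i \<mu> \<le> m \<mu>) \<and>
     (m \<mu> = 0 \<or> (\<exists>i\<in>{\<nu>\<in>S. V \<nu> = w}. m \<mu> = b i \<mu>)))"
    using S bl by (intro allI liftable_finite_max) auto
  from choice[OF this] obtain m where m: "\<forall>w. liftable (m w) \<and> (\<forall>\<mu>. 0 \<le> m w \<mu> \<and>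
     (\<forall>i\<in>{\<nu>\<in>S. V \<nu> = w}. b i \<mu> \<le> m w \<mu>) \<and>
     (m w \<mu> = 0 \<or> (\<exists>i\<in>{\<nu>\<in>S. V \<nu> = w}. m w \<mu> = b i \<mu>)))"
    by (elim exE)
  have ml: "liftable (m w)" and m0: "0 \<le> m w \<mu>"
    and meq: "m w \<mu> = 0 \<or> (\<exists>i\<in>{\<nu>\<in>S. V \<nu> = w}. m w \<mu> = b i \<mu>)" for w \<mu>
    using m by blast+
  have mb: "b \<nu> \<mu> \<le> m w \<mu>" if "\<nu> \<in> S" "V \<nu> = w" for \<nu> \<mu> w
    using m that by blast
  obtain A where A: "\<And>x. \<bar>f x\<bar> \<le> A"
    using continuous_bounded_on_compact[OF compact_UNIV f] by metis
  \<comment> \<open>Since \<open>h w\<close> is at most \<open>A + \<epsilon>1\<close>, subtracting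
    \<open>C\<close> brings it to \<open>-1\<close> or below, out of reach of zero. This is what
    happens at measures outside \<open>w\<close>.\<close>
  define C where "C = A + \<epsilon> + 1"
  have C: "C > 0" using A[of undefined] \<epsilon> by (simp add: C_def)
  \<comment> \<open>The slope leads from \<open>C\<close> at bump height \<open>0\<close> down to
    zero at height \<open>1/2\<close>, the threshold that the finite subcover guarantees at every
    measure in \<open>K\<close> for some member.\<close>
  define \<theta> where "\<theta> w \<mu> = max 0 ((- 2 * C) * m w \<mu> + C)" for w \<mu>
  have \<theta>l: "liftable (\<theta> w)" for w
    unfolding \<theta>_def by (intro liftable_max liftable_const liftable_affine ml)
  have \<theta>0: "0 \<le> \<theta> w \<mu>" for w \<mu> by (simp add: \<theta>_def)
  have \<theta>core: "\<exists>w\<in>\<W>. \<theta> w \<mu> = 0" if \<mu>: "\<mu> \<in> K" for \<mu>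
  proof -
    obtain \<nu> where \<nu>: "\<nu> \<in> S" "b \<nu> \<mu> > 1/2" using Scov[OF \<mu>] by blast
    then have "m (V \<nu>) \<mu> > 1/2" using mb[of \<nu> "V \<nu>" \<mu>] by simp
    then have "2 * C * (1/2) \<le> 2 * C * m (V \<nu>) \<mu>" using C by (intro mult_left_mono) auto
    then have "\<theta> (V \<nu>) \<mu> = 0" unfolding \<theta>_def by simp
    then show ?thesis using \<nu>(1) by (auto simp: \<W>_def)
  qed
  have \<theta>out: "\<theta> w \<mu> = C" if \<mu>: "\<mu> \<in> K" "\<mu> \<notin> w" for w \<mu>
  proof -
    have "m w \<mu> = 0"
      using meq[of w \<mu>]
    proof
      assume "\<exists>i\<in>{\<nu>\<in>S. V \<nu> = w}. m w \<mu> = b i \<mu>"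
      then obtain i where i: "i \<in> S" "V i = w" "m w \<mu> = b i \<mu>" by blast
      then have "\<not> 0 < b i \<mu>" using bV[of i \<mu>] S(1) \<mu> by blast
      then show ?thesis using i(3) m0[of w \<mu>] by simp
    qed
    then show ?thesis using C by (simp add: \<theta>_def)
  qed
  \<comment> \<open>The entries yield \<open>\<rho> \<le> 1/2\<close>,
    \<open>\<rho> \<le> \<epsilon> / 2\<close> and \<open>\<rho> \<le> d w / 4\<close>. The first
    excludes zeros from members that do not contain the measure, the second keeps the clamp in
    \<open>q\<close> inactive where the lifts are good, the third makes the tent of width
    \<open>d w\<close> at least \<open>1/2\<close> near a zero.\<close>
  define D where "D = {2, 2 * \<epsilon>} \<union> d ` \<W>"
  have D: "finite D" "D \<noteq> {}" "\<And>r. r \<in> D \<Longrightarrow> 0 < r"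
    using \<W> d \<epsilon> by (auto simp: D_def)
  define \<rho> where "\<rho> = Min D / 4"
  have "0 < Min D" using D by simp
  moreover have "Min D \<le> 2" "Min D \<le> 2 * \<epsilon>" "\<And>w. w \<in> \<W> \<Longrightarrow> Min D \<le> d w"
    by (intro Min_le[OF D(1)]; simp add: D_def)+
  ultimately have \<rho>: "\<rho> > 0" "2 * \<rho> \<le> 1" "\<rho> \<le> \<epsilon> / 2" "\<And>w. w \<in> \<W> \<Longrightarrow> 2 * \<rho> \<le> d w / 2"
    by (auto simp: \<rho>_def)
  \<comment> \<open>Chosen so that Markov's inequality at threshold \<open>\<rho>\<close>, summed
    over \<open>\<W>\<close>, costs \<open>\<epsilon> / 2\<close>.\<close>
  define \<eta> where "\<eta> = \<rho> * \<epsilon> / (2 * real (card \<W>))"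
  have cW: "card \<W> > 0" using \<W> by (simp add: card_gt_0_iff)
  have \<eta>: "\<eta> > 0" using \<rho> \<epsilon> cW by (simp add: \<eta>_def)
  have "\<exists>\<Theta>. continuous_on UNIV \<Theta> \<and> (\<forall>\<mu>\<in>K. (\<integral>x. \<bar>\<Theta> x - \<theta> w \<mu>\<bar> \<partial>\<mu>) \<le> \<eta>)" for w
    using \<theta>l[of w] \<eta> unfolding liftable_def by blast
  then obtain \<Theta> where \<Theta>c: "\<And>w. continuous_on UNIV (\<Theta> w)"
    and \<Theta>: "\<And>w \<mu>. \<mu> \<in> K \<Longrightarrow> (\<integral>x. \<bar>\<Theta> w x - \<theta> w \<mu>\<bar> \<partial>\<mu>) \<le> \<eta>"
    by metis
  have "\<exists>p. continuous_on UNIV p \<and> (\<forall>x. (\<forall>w\<in>\<W>. h w x - \<Theta> w x \<le> p x) \<and> (\<exists>w\<in>\<W>. p x = h w x - \<Theta> w x))"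
    using \<W> h by (intro continuous_finite_maximum continuous_on_diff \<Theta>c) auto
  then obtain p where pc: "continuous_on UNIV p" and pge: "\<And>w x. w \<in> \<W> \<Longrightarrow> h w x - \<Theta> w x \<le> p x"
    and peq: "\<And>x. \<exists>w\<in>\<W>. p x = h w x - \<Theta> w x"
    by blast
  \<comment> \<open>The lifts are uncontrolled on a set of small measure, where \<open>p\<close> may
    be far from \<open>f\<close>; the clamp restores closeness everywhere. Where all lifts are good,
    a core member bounds \<open>p\<close> from below and \<open>\<theta>0\<close> bounds it from
    above, so there \<open>q\<close> is \<open>p\<close>.\<close>
  define q where "q x = max (f x - \<epsilon>) (min (f x + \<epsilon>) (p x))" for x
  have qc: "continuous_on UNIV q"
    unfolding q_def by (intro continuous_on_max continuous_on_min continuous_on_diff continuous_on_add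
        continuous_on_const f pc)
  have qf: "\<bar>q x - f x\<bar> \<le> \<epsilon>" for x
    using \<epsilon> by (auto simp: q_def max_def min_def)
  have "(\<integral>x. tent \<rho> (q x) \<partial>\<mu>) \<le> \<epsilon>" if \<mu>K: "\<mu> \<in> K" for \<mu>
  proof -
    have \<mu>: "\<mu> \<in> M" using \<mu>K K_subset_M by blast
    define \<W>\<mu> where "\<W>\<mu> = {w \<in> \<W>. \<mu> \<in> w}"
    define R1 where "R1 x = (\<Sum>w\<in>\<W>\<mu>. 2 * tent (d w) (h w x - \<theta> w \<mu>))" for x
    define R2 where "R2 x = (\<Sum>w\<in>\<W>. \<bar>\<Theta> w x - \<theta> w \<mu>\<bar> / \<rho>)" for x
    have fin: "finite \<W>\<mu>" using \<W>(1) by (simp add: \<W>\<mu>_def)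
    have R1_0: "0 \<le> R1 x" and R2_0: "0 \<le> R2 x" for x
      unfolding R1_def R2_def using \<rho>(1) by (auto intro!: sum_nonneg simp: tent_nonneg)
    \<comment> \<open>\<open>R2\<close> is at least \<open>1\<close> where some lift is off by
      \<open>\<rho>\<close>. Elsewhere a value of \<open>q\<close> close to zero comes from a member
      attaining the maximum; that member must contain \<open>\<mu>\<close>, and its summand in
      \<open>R1\<close> is at least \<open>1\<close>.\<close>
    have pointwise: "tent \<rho> (q x) \<le> R1 x + R2 x" for x
    proof (cases "\<exists>w\<in>\<W>. \<rho> \<le> \<bar>\<Theta> w x - \<theta> w \<mu>\<bar>")
      case True
      then obtain w where w: "w \<in> \<W>" "\<rho> \<le> \<bar>\<Theta> w x - \<theta> w \<mu>\<bar>" by blast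
      then have "1 \<le> \<bar>\<Theta> w x - \<theta> w \<mu>\<bar> / \<rho>" using \<rho>(1) by simp
      also have "\<dots> \<le> R2 x"
        unfolding R2_def using \<rho>(1) by (intro member_le_sum w \<W>) auto
      finally show ?thesis using tent_le_1[OF \<rho>(1), of "q x"] R1_0[of x] by linarith
    next
      case False
      then have close: "\<bar>\<Theta> w x - \<theta> w \<mu>\<bar> < \<rho>" if "w \<in> \<W>" for w
        using that by (auto simp: not_le)
      obtain w0 where w0: "w0 \<in> \<W>" "\<theta> w0 \<mu> = 0" using \<theta>core[OF \<mu>K] by blast
      have "f x - \<epsilon> \<le> h w0 x - \<Theta> w0 x"
        using hf[of w0 x] close[of w0] w0 \<W>(2) \<epsilon>1 \<rho>(3) by (auto simp: abs_le_iff abs_less_iff)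
      then have lower: "f x - \<epsilon> \<le> p x" using pge[OF w0(1), of x] by linarith
      obtain w where w: "w \<in> \<W>" "p x = h w x - \<Theta> w x" using peq by blast
      have hw: "\<bar>h w x - f x\<bar> \<le> \<epsilon>1" using hf w(1) \<W>(2) by blast
      have upper: "p x \<le> f x + \<epsilon>"
        using hw close[OF w(1)] w(2) \<theta>0[of w \<mu>] \<epsilon>1 \<rho>(3) by (auto simp: abs_le_iff abs_less_iff)
      have qp: "q x = p x" using lower upper by (simp add: q_def)
      show ?thesis
      proof (cases "\<rho> \<le> \<bar>q x\<bar>")
        case True
        then show ?thesis using tent_eq_0[OF \<rho>(1)] R1_0[of x] R2_0[of x] by simp
      next
        case False
        then have near: "\<bar>h w x - \<theta> w \<mu>\<bar> < 2 * \<rho>"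
          using close[OF w(1)] w(2) qp by (auto simp: abs_less_iff)
        have "\<mu> \<in> w"
        proof (rule ccontr)
          assume "\<mu> \<notin> w"
          then have "\<theta> w \<mu> = A + \<epsilon> + 1" using \<theta>out[OF \<mu>K] by (simp add: C_def)
          then have "h w x - \<theta> w \<mu> \<le> - 1"
            using hw A[of x] \<epsilon>1 \<epsilon> by (auto simp: abs_le_iff)
          then show False using near \<rho>(2) by (auto simp: abs_less_iff)
        qed
        then have wm: "w \<in> \<W>\<mu>" using w(1) by (simp add: \<W>\<mu>_def)
        have "1/2 \<le> tent (d w) (h w x - \<theta> w \<mu>)"
          using near \<rho>(4)[OF w(1)] d w(1) \<W>(2) by (intro tent_ge_half) auto
        then have "1 \<le> 2 * tent (d w) (h w x - \<theta> w \<mu>)" by simp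
        also have "\<dots> \<le> R1 x"
          unfolding R1_def using tent_nonneg by (intro member_le_sum wm fin) auto
        finally show ?thesis using tent_le_1[OF \<rho>(1), of "q x"] R2_0[of x] by linarith
      qed
    qed
    have i1: "integrable \<mu> (\<lambda>x. 2 * tent (d w) (h w x - \<theta> w \<mu>))" if "w \<in> \<W>\<mu>" for w
      using that \<W>(2) unfolding \<W>\<mu>_def
      by (intro M_integrable \<mu> continuous_on_mult continuous_on_const continuous_on_tent continuous_on_diff h d) auto
    have i2: "integrable \<mu> (\<lambda>x. \<bar>\<Theta> w x - \<theta> w \<mu>\<bar> / \<rho>)" for w
      using \<rho>(1) by (intro M_integrable \<mu> continuous_on_divide continuous_on_rabs continuous_on_diff
          continuous_on_const \<Theta>c) auto
    have iR: "integrable \<mu> R1" "integrable \<mu> R2"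
      unfolding R1_def R2_def by (intro Bochner_Integration.integrable_sum i1 i2; assumption)+
    have "(\<integral>x. tent \<rho> (q x) \<partial>\<mu>) \<le> (\<integral>x. R1 x + R2 x \<partial>\<mu>)"
      by (intro integral_mono M_integrable \<mu> continuous_on_tent qc \<rho>(1) Bochner_Integration.integrable_add iR pointwise)
    also have "\<dots> = (\<integral>x. R1 x \<partial>\<mu>) + (\<integral>x. R2 x \<partial>\<mu>)"
      by (rule Bochner_Integration.integral_add[OF iR])
    also have "(\<integral>x. R1 x \<partial>\<mu>) \<le> \<epsilon> / 2"
    proof -
      have "(\<integral>x. R1 x \<partial>\<mu>) = (\<Sum>w\<in>\<W>\<mu>. \<integral>x. 2 * tent (d w) (h w x - \<theta> w \<mu>) \<partial>\<mu>)"
        unfolding R1_def by (rule Bochner_Integration.integral_sum) (rule i1)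
      also have "\<dots> \<le> (\<Sum>w\<in>\<W>\<mu>. 2 * \<epsilon>1)"
      proof (rule sum_mono)
        fix w assume "w \<in> \<W>\<mu>"
        then have "(\<integral>x. tent (d w) (h w x - \<theta> w \<mu>) \<partial>\<mu>) < \<epsilon>1"
          using small \<W>(2) by (auto simp: \<W>\<mu>_def)
        then show "(\<integral>x. 2 * tent (d w) (h w x - \<theta> w \<mu>) \<partial>\<mu>) \<le> 2 * \<epsilon>1" by simp
      qed
      also have "\<dots> = real (card \<W>\<mu>) * (2 * \<epsilon>1)" by simp
      also have "\<dots> \<le> (real n + 1) * (2 * \<epsilon>1)"
      proof (rule mult_right_mono)
        have "card \<W>\<mu> \<le> card {V \<in> \<V>. \<mu> \<in> V}"
          using \<V>(4)[OF \<mu>K] \<W>(2) by (intro card_mono) (auto simp: \<W>\<mu>_def)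
        then have "card \<W>\<mu> \<le> n + 1" using \<V>(4)[OF \<mu>K] by linarith
        then show "real (card \<W>\<mu>) \<le> real n + 1" by linarith
      qed (use \<epsilon>1 in simp)
      also have "\<dots> = \<epsilon> / 2" by (simp add: \<epsilon>1_def field_simps)
      finally show ?thesis .
    qed
    also have "(\<integral>x. R2 x \<partial>\<mu>) \<le> \<epsilon> / 2"
    proof -
      have "(\<integral>x. R2 x \<partial>\<mu>) = (\<Sum>w\<in>\<W>. \<integral>x. \<bar>\<Theta> w x - \<theta> w \<mu>\<bar> / \<rho> \<partial>\<mu>)"
        unfolding R2_def by (rule Bochner_Integration.integral_sum) (rule i2)
      also have "\<dots> \<le> (\<Sum>w\<in>\<W>. \<eta> / \<rho>)"
        using \<Theta>[OF \<mu>K] \<rho>(1) by (intro sum_mono) (simp add: divide_right_mono)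
      also have "\<dots> = \<epsilon> / 2" using cW \<rho>(1) by (simp add: \<eta>_def)
      finally show ?thesis .
    qed
    finally show ?thesis by simp
  qed
  then show ?thesis using qc qf \<rho>(1) by blast
qed

end


section \<open>The small boundary property\<close>

lemma dense_open_dense_inter:
  fixes Q :: "nat \<Rightarrow> 'a::complete_space set"
  assumes op: "\<And>k. open (Q k)" and dense: "\<And>k f e. 0 < e \<Longrightarrow> Q k \<inter> ball f e \<noteq> {}" and e: "0 < e"
  shows "\<exists>g\<in>ball f e. \<forall>k. g \<in> Q k"
proof -
  have "euclidean closure_of \<Inter>(range Q) = topspace (euclidean :: 'a topology)"
  proof (rule Baire_category)
    show "completely_metrizable_space (euclidean :: 'a topology) \<or>
        locally_compact_space (euclidean :: 'a topology) \<and> regular_space (euclidean :: 'a topology)"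
      by (simp add: completely_metrizable_space_euclidean)
    fix T assume "T \<in> range Q"
    then obtain k where k: "T = Q k" by blast
    have "f \<in> closure T" for f
      unfolding closure_approachable
    proof (intro allI impI)
      fix e :: real assume "0 < e"
      then obtain y where "y \<in> Q k" "y \<in> ball f e" using dense[of e k f] by blast
      then show "\<exists>y\<in>T. dist y f < e" using k by (auto simp: dist_commute)
    qed
    then show "openin euclidean T \<and> euclidean closure_of T = topspace (euclidean :: 'a topology)"
      using op k by (auto simp: open_openin[symmetric])
  qed auto
  then have "f \<in> closure (\<Inter>(range Q))" by simp
  then obtain g where "g \<in> \<Inter>(range Q)" "dist g f < e"
    using e unfolding closure_approachable by blast
  then show ?thesis by (intro bexI[of _ g]) (auto simp: dist_commute)
qed

context countable_group_action
begin

text \<open>Baire's theorem in the Banach space of bounded continuous functions gives one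
  \<open>g\<close> for all invariant measures at once. The balls in \<open>Q k\<close> have radius
  \<open>\<delta> / 2\<close> so that \<open>tent_ge_half\<close> applies to \<open>H\<close> at
  each zero of \<open>g\<close>; hence the zero set has measure at most twice the tent integral,
  that is \<open>2 / (k + 1)\<close>.\<close>

lemma perturbation_null_zero_set:
  fixes f :: "'a \<Rightarrow> real"
  assumes bauer: "bauer_invariant_measures G \<phi>"
    and dim: "covering_dim_le (extreme_boundary_topology G \<phi>) n"
    and atom: "\<And>\<mu> x. \<mu> \<in> M \<Longrightarrow> measure \<mu> {x} = 0"
    and f: "continuous_on UNIV f" and \<epsilon>: "\<epsilon> > 0"
  shows "\<exists>g. continuous_on UNIV g \<and> (\<forall>x. \<bar>g x - f x\<bar> < \<epsilon>) \<and> (\<forall>\<mu>\<in>M. {x. g x = 0} \<in> null_sets \<mu>)"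
proof -
  have bc: "h \<in> bcontfun" if "continuous_on UNIV h" for h :: "'a \<Rightarrow> real"
  proof -
    have "bounded (range h)"
      using that compact_UNIV compact_continuous_image compact_imp_bounded by blast
    then show ?thesis using that by (simp add: bcontfun_def)
  qed
  have cont: "continuous_on UNIV (apply_bcontfun H)" for H :: "'a \<Rightarrow>\<^sub>C real"
    using apply_bcontfun[of H] by (simp add: bcontfun_def)
  define R where "R k = {(H :: 'a \<Rightarrow>\<^sub>C real, \<delta>). 0 < \<delta> \<and>
    (\<forall>\<mu>\<in>M. (\<integral>x. tent \<delta> (apply_bcontfun H x) \<partial>\<mu>) \<le> 1 / real (Suc k))}" for k
  define Q where "Q k = (\<Union>(H, \<delta>)\<in>R k. ball H (\<delta> / 2))" for k
  have "\<exists>g\<in>ball (Bcontfun f) \<epsilon>. \<forall>k. g \<in> Q k"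
  proof (rule dense_open_dense_inter[OF _ _ \<epsilon>])
    show "open (Q k)" for k unfolding Q_def by auto
    fix k and F :: "'a \<Rightarrow>\<^sub>C real" and e :: real assume e: "0 < e"
    define e' where "e' = min (e / 2) (1 / real (Suc k))"
    have e': "e' > 0" "e' \<le> e / 2" "e' \<le> 1 / real (Suc k)" using e by (auto simp: e'_def)
    obtain h \<delta> where h: "continuous_on UNIV h" "\<delta> > 0" "\<And>x. \<bar>h x - apply_bcontfun F x\<bar> \<le> e'"
      "\<And>\<mu>. \<mu> \<in> K \<Longrightarrow> (\<integral>x. tent \<delta> (h x) \<partial>\<mu>) \<le> e'"
      using perturbation_small_zero_set[OF bauer dim atom cont e'(1)] by blast
    \<comment> \<open>Here the bound passes from the extreme measures to all of \<open>M\<close>,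
      which is possible because the tent integrand is continuous.\<close>
    have hM: "(\<integral>x. tent \<delta> (h x) \<partial>\<mu>) \<le> 1 / real (Suc k)" if "\<mu> \<in> M" for \<mu>
      using integral_le_of_extreme[OF continuous_on_tent[OF h(1,2)] h(4) that] e'(3) by linarith
    have H: "apply_bcontfun (Bcontfun h) = h"
      using Bcontfun_inverse bc h(1) by blast
    have "(Bcontfun h, \<delta>) \<in> R k" using h(2) hM by (simp add: R_def H)
    moreover have "Bcontfun h \<in> ball (Bcontfun h) (\<delta> / 2)" using h(2) by simp
    ultimately have "Bcontfun h \<in> Q k" unfolding Q_def by blast
    moreover have "dist F (Bcontfun h) \<le> e'"
      by (rule dist_bound) (use h(3) in \<open>simp add: H dist_real_def abs_minus_commute\<close>)
    then have "Bcontfun h \<in> ball F e" using e e'(2) by simp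
    ultimately show "Q k \<inter> ball F e \<noteq> {}" by blast
  qed
  then obtain g where g: "dist (Bcontfun f) g < \<epsilon>" "\<And>k. g \<in> Q k" by auto
  let ?Z = "{x. apply_bcontfun g x = 0}"
  have "closed ?Z"
    using cont[of g] by (intro closed_Collect_eq) auto
  then have Zb: "?Z \<in> sets borel" by simp
  have "?Z \<in> null_sets \<mu>" if \<mu>: "\<mu> \<in> M" for \<mu>
  proof -
    interpret prob_space \<mu> using M_borel_prob[OF \<mu>] by (simp add: borel_prob_def)
    have Z: "?Z \<in> sets \<mu>" using M_borel_prob[OF \<mu>] Zb by (simp add: borel_prob_def)
    have le: "measure \<mu> ?Z \<le> 2 * (1 / real (Suc k))" for k
    proof -
      obtain H \<delta> where H: "(H, \<delta>) \<in> R k" "g \<in> ball H (\<delta> / 2)"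
        using g(2)[of k] unfolding Q_def by blast
      then have \<delta>: "0 < \<delta>" and Hle: "(\<integral>x. tent \<delta> (apply_bcontfun H x) \<partial>\<mu>) \<le> 1 / real (Suc k)"
        using \<mu> by (auto simp: R_def)
      have "measure \<mu> ?Z = (\<integral>x. indicator ?Z x \<partial>\<mu>)" using Z by simp
      also have "\<dots> \<le> (\<integral>x. 2 * tent \<delta> (apply_bcontfun H x) \<partial>\<mu>)"
      proof (rule integral_mono)
        show "integrable \<mu> (indicator ?Z :: 'a \<Rightarrow> real)"
          using Z by (simp add: emeasure_eq_measure)
        show "integrable \<mu> (\<lambda>x. 2 * tent \<delta> (apply_bcontfun H x))"
          by (intro integrable_mult_right M_integrable \<mu> continuous_on_tent cont \<delta>)
        fix x
        show "indicator ?Z x \<le> 2 * tent \<delta> (apply_bcontfun H x)"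
        proof (cases "x \<in> ?Z")
          case True
          have "dist (apply_bcontfun H x) (apply_bcontfun g x) < \<delta> / 2"
            using dist_bounded[of H x g] H(2) by simp
          then have "\<bar>apply_bcontfun H x\<bar> \<le> \<delta> / 2" using True by (simp add: dist_real_def)
          from tent_ge_half[OF \<delta> this] show ?thesis using True by simp
        next
          case False
          then show ?thesis using tent_nonneg[of \<delta> "apply_bcontfun H x"] by simp
        qed
      qed
      also have "\<dots> = 2 * (\<integral>x. tent \<delta> (apply_bcontfun H x) \<partial>\<mu>)" by simp
      finally show ?thesis using Hle by simp
    qed
    have "(\<lambda>k. 2 * (1 / real (Suc k))) \<longlonglongrightarrow> 2 * 0"
      using LIMSEQ_inverse_real_of_nat by (intro tendsto_mult tendsto_const) (simp add: inverse_eq_divide)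
    from LIMSEQ_le_const[OF this] le have "measure \<mu> ?Z \<le> 0" by simp
    then have "measure \<mu> ?Z = 0" using measure_nonneg[of \<mu> ?Z] by linarith
    then show ?thesis using Z by (simp add: null_sets_def emeasure_eq_measure)
  qed
  moreover have "\<bar>apply_bcontfun g x - f x\<bar> < \<epsilon>" for x
    using dist_bounded[of "Bcontfun f" x g] g(1) Bcontfun_inverse[OF bc[OF f]]
    by (simp add: dist_real_def abs_minus_commute)
  ultimately show ?thesis using cont[of g] by blast
qed

text \<open>Moving \<open>dist x y - r / 2\<close> by less than \<open>r / 2\<close> leaves it
  negative at \<open>x\<close> and positive outside the ball of radius \<open>r\<close>. The
  frontier of the negative set lies in the zero set.\<close>

lemma small_boundary_property_of_perturbation:
  assumes pert: "\<And>f \<epsilon>. continuous_on UNIV f \<Longrightarrow> 0 < \<epsilon> \<Longrightarrow>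
    \<exists>g :: 'a \<Rightarrow> real. continuous_on UNIV g \<and> (\<forall>x. \<bar>g x - f x\<bar> < \<epsilon>) \<and> (\<forall>\<mu>\<in>M. {x. g x = 0} \<in> null_sets \<mu>)"
  shows "small_boundary_property G \<phi>"
  unfolding small_boundary_property_def
proof (intro exI conjI)
  let ?B = "{U :: 'a set. open U \<and> (\<forall>\<mu>\<in>M. frontier U \<in> null_sets \<mu>)}"
  show "topological_basis ?B"
  proof (rule topological_basisI)
    fix U :: "'a set" and x assume "open U" "x \<in> U"
    then obtain r where r: "r > 0" "ball x r \<subseteq> U" using open_contains_ball by blast
    have "continuous_on UNIV (\<lambda>y. dist x y - r / 2)"
      by (intro continuous_on_diff continuous_on_dist continuous_on_const continuous_on_id)
    from pert[OF this, of "r / 2"] r(1) obtain g where g: "continuous_on UNIV g"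
      "\<And>y. \<bar>g y - (dist x y - r / 2)\<bar> < r / 2" "\<And>\<mu>. \<mu> \<in> M \<Longrightarrow> {y. g y = 0} \<in> null_sets \<mu>"
      by auto
    let ?V = "{y. g y < 0}"
    have op: "open ?V" using g(1) by (intro open_Collect_less) auto
    have "closed {y. g y \<le> 0}" using g(1) by (intro closed_Collect_le) auto
    then have "closure ?V \<subseteq> {y. g y \<le> 0}" by (intro closure_minimal) auto
    then have fr: "frontier ?V \<subseteq> {y. g y = 0}"
      using op unfolding frontier_def by (auto simp: interior_open)
    have "frontier ?V \<in> null_sets \<mu>" if \<mu>: "\<mu> \<in> M" for \<mu>
    proof (rule null_sets_subset[OF g(3)[OF \<mu>] _ fr])
      show "frontier ?V \<in> sets \<mu>" using M_borel_prob[OF \<mu>] by (simp add: borel_prob_def)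
    qed
    moreover have "x \<in> ?V" using g(2)[of x] abs_ge_self[of "g x + r / 2"] by simp
    moreover have "y \<in> U" if "g y < 0" for y
    proof -
      have "dist x y < r" using g(2)[of y] that abs_ge_minus_self[of "g y - (dist x y - r / 2)"] by simp
      then show ?thesis using r(2) by auto
    qed
    ultimately show "\<exists>B'\<in>?B. x \<in> B' \<and> B' \<subseteq> U"
      using op by (intro bexI[of _ ?V]) auto
  qed simp
qed simp

end

text \<open>Every set is clopen here, so frontiers are empty. The case stands apart because
  probability measures on a finite space have atoms.\<close>

lemma small_boundary_property_finite_space:
  fixes \<phi> :: "'g \<Rightarrow> 'a::metric_space \<Rightarrow> 'a"
  assumes "finite (UNIV :: 'a set)"
  shows "small_boundary_property G \<phi>"
proof -
  have closed: "closed S" for S :: "'a set"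
    using assms finite_imp_closed finite_subset subset_UNIV by blast
  then have "open S" for S :: "'a set" by (simp add: open_closed)
  then have "frontier S = {}" for S :: "'a set"
    using closed by (simp add: frontier_def interior_open)
  then show ?thesis
    unfolding small_boundary_property_def
    by (intro exI[of _ "Collect open"]) (auto intro!: topological_basisI)
qed

theorem theorem1:
  fixes G :: "('g, 'b) monoid_scheme"
    and \<phi> :: "'g \<Rightarrow> 'a::metric_space \<Rightarrow> 'a"
  assumes "compact (UNIV :: 'a set)"
    and "group G"
    and "countable (carrier G)"
    and "infinite (carrier G)"
    and "continuous_action G \<phi>"
    and "minimal_action G \<phi>"
    and "bauer_invariant_measures G \<phi>"
    and "finite_covering_dim (extreme_boundary_topology G \<phi>)"
  shows "small_boundary_property G \<phi>"
proof (cases "finite (UNIV :: 'a set)")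
  case True
  then show ?thesis by (rule small_boundary_property_finite_space)
next
  case False
  interpret countable_group_action G \<phi>
    by (intro countable_group_action.intro compact_group_action.intro
        countable_group_action_axioms.intro assms)
  obtain n where "covering_dim_le (extreme_boundary_topology G \<phi>) n"
    using assms(8) unfolding finite_covering_dim_def by blast
  from perturbation_null_zero_set[OF assms(7) this M_measure_singleton[OF _ assms(6) False]]
  show ?thesis by (rule small_boundary_property_of_perturbation)
qed

end
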